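(* Let $\lambda,\mu$ be partitions with $\mu\subseteq\lambda$ and let $\tau$ be a partition. Then $$s_{\lambda/\mu}\cdot\widetilde p_\tau=\sum_{\lambda^+\supseteq\lambda,\ \mu^-\subseteq\mu}(-1)^{|\mu/\mu^-|}\,\chi(\lambda^+,\lambda,\mu,\mu^-;\tau)\,s_{\lambda^+/\mu^-},$$ where the sum is over partitions $\lambda^+,\mu^-$ and $$\chi(\lambda^+,\lambda,\mu,\mu^-;\tau)=\sum_{(T',T'')}(-q)^{\mathrm{ht}(T')+\mathrm{wt}(T'')}(1-q)^{\mathrm{rib}(T')+\mathrm{rib}(T'')-1},$$ the sum being over all pairs $(T',T'')$ where $T'$ is a broken ribbon tableau of shape $\lambda^+/\lambda$ and type $\tau'$, $T''$ is a reverse broken ribbon tableau of shape $\mu/\mu^-$ and type $\tau''$, and $\tau'+\tau''=\tau$ (componentwise sum of sequences of nonnegative integers).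
   Context: For partitions, $\mu\subseteq\lambda$ means $\mu_i\le\lambda_i$ for all $i$ (with $\lambda_i=0$ for $i>\ell(\lambda)$, where $\ell(\lambda)$ is the number of parts). The skew diagram is $[\lambda/\mu]=\{(i,j):1\le i\le\ell(\lambda),\ \mu_i<j\le\lambda_i\}$ (row $i$, column $j$, rows numbered from top to bottom), and its size is $|\lambda/\mu|=|\lambda|-|\mu|$. A skew shape is a ribbon if its diagram is (non-empty and) connected and contains no $2\times 2$ block. It is a broken ribbon if its diagram contains no $2\times2$ block; the diagram is then a disjoint union of $\mathrm{rib}$ many ribbons (its connected components). The height $\mathrm{ht}$ (resp. width $\mathrm{wt}$) of a ribbon is the number of its non-empty rows (resp. columns) minus $1$; the height (resp. width) of a broken ribbon is the sum of those of its component ribbons. The empty shape has height, width and $\mathrm{rib}$ all equal to $0$. A broken ribbon tableau (resp. reverse broken ribbon tableau) of shape $\lambda/\mu$ and type $\tau=(\tau_1,\tau_2,\dots)$ (a sequence of nonnegative integers) is an assignment of positive integers to the cells of $[\lambda/\mu]$ such that every row and column is weakly increasing (resp. weakly decreasing), the integer $i$ appears $\tau_i$ times, and the set $T_i$ of cells occupied by $i$ forms a broken ribbon or is empty. For such $T$, $\mathrm{ht}(T)=\sum_i\mathrm{ht}(T_i)$, $\mathrm{wt}(T)=\sum_i\mathrm{wt}(T_i)$, $\mathrm{rib}(T)=\sum_i\mathrm{rib}(T_i)$. The skew Schur function is $s_{\lambda/\mu}=\sum_T x_1^{t_1(T)}x_2^{t_2(T)}\cdots$, summed over all fillings $T$ of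 $[\lambda/\mu]$ by positive integers with rows weakly increasing and columns strictly increasing, where $t_i(T)$ is the number of entries equal to $i$. The monomial symmetric function $m_\tau$ is the sum of all distinct monomials $x_{i_1}^{\tau_1}\cdots x_{i_\ell}^{\tau_\ell}$ with $\ell=\ell(\tau)$ and $i_1,\dots,i_\ell$ distinct. With $q$ an indeterminate, the quantum power sum functions are $$\widetilde p_r=\sum_{\tau\vdash r}(-1)^{\ell(\tau)-1}(q-1)^{\ell(\tau)-1}m_\tau,\qquad \widetilde p_\tau=\widetilde p_{\tau_1}\widetilde p_{\tau_2}\cdots\widetilde p_{\tau_{\ell(\tau)}},$$ where $\tau\vdash r$ means that $\tau$ is a partition of $r$.
   Formalization: The exponent of 1-q in chi is rib(T')+rib(T'')-ℓ(τ) instead of rib(T')+rib(T'')-1; as printed the identity fails whenever ℓ(τ)≠1 (e.g. λ=μ=∅, τ=(1,1): the coefficient of s_2 is 1, not 1-q), and both agree for ℓ(τ)=1. *)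

theory Defs
  imports
    "HOL-Library.Poly_Mapping"
    "HOL-Library.FuncSet"
    "HOL-Computational_Algebra.Polynomial"
begin

text \<open>
  Rows, columns, entries of fillings, parts of partitions and variables are all numbered
  from 0 instead of from 1: index \<open>i\<close> below is index \<open>i + 1\<close> in the usual convention.
\<close>


section \<open>Formal power series in the variables \<open>x 0, x 1, x 2, \<dots>\<close>\<close>

text \<open>
  A monomial is its finitely supported exponent sequence.  Symmetric functions live in this
  ring as formal power series in countably many variables.
\<close>

type_synonym mon = "nat \<Rightarrow>\<^sub>0 nat"

typedef 'a series = "UNIV :: (mon \<Rightarrow> 'a) set"
  morphisms mcoeff Series ..

lemma mcoeff_Series [simp]: "mcoeff (Series f) = f"
  by (simp add: Series_inverse)

lemma series_eqI: "(\<And>m. mcoeff f m = mcoeff g m) \<Longrightarrow> f = g"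
  by (metis ext mcoeff_inject)

lemma finite_mon_le: "finite {a :: mon. \<forall>i. Poly_Mapping.lookup a i \<le> Poly_Mapping.lookup m i}"
proof (rule finite_imageD)
  let ?S = "{a :: mon. \<forall>i. Poly_Mapping.lookup a i \<le> Poly_Mapping.lookup m i}"
  let ?r = "\<lambda>a :: mon. restrict (Poly_Mapping.lookup a) (Poly_Mapping.keys m)"
  show "finite (?r ` ?S)"
  proof (rule finite_subset)
    show "?r ` ?S \<subseteq> (\<Pi>\<^sub>E i\<in>Poly_Mapping.keys m. {..Poly_Mapping.lookup m i})"
      by auto
  qed (simp add: finite_PiE)
  show "inj_on ?r ?S"
  proof (rule inj_onI, rule poly_mapping_eqI)
    fix a b i
    assume a: "a \<in> ?S" and b: "b \<in> ?S" and eq: "?r a = ?r b"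
    show "Poly_Mapping.lookup a i = Poly_Mapping.lookup b i"
    proof (cases "i \<in> Poly_Mapping.keys m")
      case True
      with fun_cong[OF eq, of i] show ?thesis by simp
    next
      case False
      then have "Poly_Mapping.lookup m i = 0" by (simp add: in_keys_iff)
      with a b show ?thesis by (metis le_zero_eq mem_Collect_eq)
    qed
  qed
qed

lemma finite_mon_splits: "finite {(a, b). a + b = (m :: mon)}"
proof (rule finite_subset)
  let ?S = "{a :: mon. \<forall>i. Poly_Mapping.lookup a i \<le> Poly_Mapping.lookup m i}"
  show "{(a, b). a + b = m} \<subseteq> ?S \<times> ?S"
    by (auto simp: lookup_add)
qed (simp add: finite_mon_le)

instantiation series :: (comm_ring_1) comm_ring_1
begin

definition zero_series_def: "0 = Series (\<lambda>_. 0)"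

definition one_series_def: "1 = Series (\<lambda>m. if m = 0 then 1 else 0)"

definition plus_series_def: "f + g = Series (\<lambda>m. mcoeff f m + mcoeff g m)"

definition minus_series_def: "f - g = Series (\<lambda>m. mcoeff f m - mcoeff g m)"

definition uminus_series_def: "- f = Series (\<lambda>m. - mcoeff f m)"

definition times_series_def:
  "f * g = Series (\<lambda>m. \<Sum>(a, b)\<in>{(a, b). a + b = m}. mcoeff f a * mcoeff g b)"

instance
proof
  fix f g h :: "'a series"
  show "f + g + h = f + (g + h)" "f + g = g + f" "0 + f = f" "- f + f = 0" "f - g = f + - g"
    by (simp_all add: series_eqI plus_series_def zero_series_def uminus_series_def
        minus_series_def algebra_simps)
  show "f * g * h = f * (g * h)"
  proof (rule series_eqI)
    fix m
    have "mcoeff (f * g * h) m =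
        (\<Sum>(p, c)\<in>{(p, c). p + c = m}. \<Sum>(a, b)\<in>{(a, b). a + b = p}.
          mcoeff f a * mcoeff g b * mcoeff h c)"
      by (simp add: times_series_def sum_distrib_right case_prod_beta)
    also have "\<dots> = (\<Sum>((p, c), a, b)\<in>(SIGMA (p, c):{(p, c). p + c = m}. {(a, b). a + b = p}).
          mcoeff f a * mcoeff g b * mcoeff h c)"
      by (subst sum.Sigma[symmetric])
        (auto simp: finite_mon_splits case_prod_beta intro!: sum.cong)
    also have "\<dots> = (\<Sum>((a, p), b, c)\<in>(SIGMA (a, p):{(a, p). a + p = m}. {(b, c). b + c = p}).
          mcoeff f a * mcoeff g b * mcoeff h c)"
      by (rule sum.reindex_bij_witness
          [where i = "\<lambda>((a, p), b, c). ((a + b, c), a, b)"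
             and j = "\<lambda>((p, c), a, b). ((a, b + c), b, c)"])
        (auto simp: add.assoc)
    also have "\<dots> = (\<Sum>(a, p)\<in>{(a, p). a + p = m}. \<Sum>(b, c)\<in>{(b, c). b + c = p}.
          mcoeff f a * mcoeff g b * mcoeff h c)"
      by (subst sum.Sigma[symmetric])
        (auto simp: finite_mon_splits case_prod_beta intro!: sum.cong)
    also have "\<dots> = mcoeff (f * (g * h)) m"
      by (simp add: times_series_def sum_distrib_left case_prod_beta mult.assoc)
    finally show "mcoeff (f * g * h) m = mcoeff (f * (g * h)) m" .
  qed
  show "f * g = g * f"
  proof (rule series_eqI)
    fix m
    show "mcoeff (f * g) m = mcoeff (g * f) m"
      unfolding times_series_def mcoeff_Series
      by (rule sum.reindex_bij_witness[where i = prod.swap and j = prod.swap])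
        (auto simp: add.commute mult.commute)
  qed
  show "1 * f = f"
  proof (rule series_eqI)
    fix m
    have "mcoeff (1 * f) m = (\<Sum>(a, b)\<in>{(0, m)}. mcoeff 1 a * mcoeff f b)"
      unfolding times_series_def mcoeff_Series
      by (rule sum.mono_neutral_right[OF finite_mon_splits])
        (auto simp: one_series_def split: if_splits)
    then show "mcoeff (1 * f) m = mcoeff f m"
      by (simp add: one_series_def)
  qed
  show "(f + g) * h = f * h + g * h"
    by (rule series_eqI)
      (simp add: times_series_def plus_series_def case_prod_beta distrib_right sum.distrib)
  show "(0 :: 'a series) \<noteq> 1"
  proof
    assume "(0 :: 'a series) = 1"
    then have "mcoeff (0 :: 'a series) 0 = mcoeff 1 0" by simp
    then show False by (simp add: zero_series_def one_series_def)
  qed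
qed

end

definition scale :: "'a :: comm_ring_1 \<Rightarrow> 'a series \<Rightarrow> 'a series" where
  "scale c f = Series (\<lambda>m. c * mcoeff f m)"

text \<open>The coefficient ring is \<open>\<int>[q]\<close>.\<close>

abbreviation q :: "int poly" where
  "q \<equiv> monom 1 1"


section \<open>Partitions and skew diagrams\<close>

text \<open>Partitions are padded with zeros, so containment is the pointwise order on functions.\<close>

definition is_partition :: "(nat \<Rightarrow> nat) \<Rightarrow> bool" where
  "is_partition lam \<longleftrightarrow> antimono lam \<and> finite {i. lam i \<noteq> 0}"

definition num_parts :: "(nat \<Rightarrow> nat) \<Rightarrow> nat" where
  "num_parts lam = card {i. lam i \<noteq> 0}"

definition psize :: "(nat \<Rightarrow> nat) \<Rightarrow> nat" where
  "psize lam = (\<Sum>i\<in>{i. lam i \<noteq> 0}. lam i)"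

type_synonym cell = "nat \<times> nat"

definition diagram :: "(nat \<Rightarrow> nat) \<Rightarrow> (nat \<Rightarrow> nat) \<Rightarrow> cell set" where
  "diagram lam \<mu> = {(i, j). \<mu> i \<le> j \<and> j < lam i}"


section \<open>Broken ribbons\<close>

definition has_block :: "cell set \<Rightarrow> bool" where
  "has_block C \<longleftrightarrow> (\<exists>i j. {(i, j), (i, Suc j), (Suc i, j), (Suc i, Suc j)} \<subseteq> C)"

text \<open>The empty set of cells is a broken ribbon (the empty shape, with no components).\<close>

definition broken_ribbon :: "cell set \<Rightarrow> bool" where
  "broken_ribbon C \<longleftrightarrow>
    (\<exists>lam \<mu>. is_partition lam \<and> is_partition \<mu> \<and> \<mu> \<le> lam \<and> C = diagram lam \<mu>) \<and> \<not> has_block C"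

fun adjacent :: "cell \<Rightarrow> cell \<Rightarrow> bool" where
  "adjacent (i, j) (k, l) \<longleftrightarrow>
    i = k \<and> (l = Suc j \<or> j = Suc l) \<or> j = l \<and> (k = Suc i \<or> i = Suc k)"

definition linked :: "cell set \<Rightarrow> (cell \<times> cell) set" where
  "linked C = {(c, d). c \<in> C \<and> d \<in> C \<and> (c, d) \<in> {(a, b). a \<in> C \<and> b \<in> C \<and> adjacent a b}\<^sup>*}"

definition components :: "cell set \<Rightarrow> cell set set" where
  "components C = C // linked C"

definition rib :: "cell set \<Rightarrow> nat" where
  "rib C = card (components C)"

definition ht :: "cell set \<Rightarrow> nat" where
  "ht C = (\<Sum>K\<in>components C. card (fst ` K) - 1)"

definition wt :: "cell set \<Rightarrow> nat" where
  "wt C = (\<Sum>K\<in>components C. card (snd ` K) - 1)"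


section \<open>Fillings\<close>

text \<open>Fillings of a set \<open>D\<close> of cells are extensional functions: \<open>undefined\<close> off \<open>D\<close>.\<close>

type_synonym filling = "cell \<Rightarrow> nat"

definition entry_cells :: "cell set \<Rightarrow> filling \<Rightarrow> nat \<Rightarrow> cell set" where
  "entry_cells D T n = {c \<in> D. T c = n}"

definition rows_weakly_incr :: "cell set \<Rightarrow> filling \<Rightarrow> bool" where
  "rows_weakly_incr D T \<longleftrightarrow>
    (\<forall>i j j'. (i, j) \<in> D \<and> (i, j') \<in> D \<and> j < j' \<longrightarrow> T (i, j) \<le> T (i, j'))"

definition cols_weakly_incr :: "cell set \<Rightarrow> filling \<Rightarrow> bool" where
  "cols_weakly_incr D T \<longleftrightarrow>
    (\<forall>i i' j. (i, j) \<in> D \<and> (i', j) \<in> D \<and> i < i' \<longrightarrow> T (i, j) \<le> T (i', j))"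

definition cols_strictly_incr :: "cell set \<Rightarrow> filling \<Rightarrow> bool" where
  "cols_strictly_incr D T \<longleftrightarrow>
    (\<forall>i i' j. (i, j) \<in> D \<and> (i', j) \<in> D \<and> i < i' \<longrightarrow> T (i, j) < T (i', j))"

definition rows_weakly_decr :: "cell set \<Rightarrow> filling \<Rightarrow> bool" where
  "rows_weakly_decr D T \<longleftrightarrow>
    (\<forall>i j j'. (i, j) \<in> D \<and> (i, j') \<in> D \<and> j < j' \<longrightarrow> T (i, j) \<ge> T (i, j'))"

definition cols_weakly_decr :: "cell set \<Rightarrow> filling \<Rightarrow> bool" where
  "cols_weakly_decr D T \<longleftrightarrow>
    (\<forall>i i' j. (i, j) \<in> D \<and> (i', j) \<in> D \<and> i < i' \<longrightarrow> T (i, j) \<ge> T (i', j))"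

definition broken_ribbon_tableaux ::
    "(nat \<Rightarrow> nat) \<Rightarrow> (nat \<Rightarrow> nat) \<Rightarrow> (nat \<Rightarrow> nat) \<Rightarrow> filling set" where
  "broken_ribbon_tableaux lam \<mu> \<tau> =
    {T \<in> diagram lam \<mu> \<rightarrow>\<^sub>E UNIV.
      rows_weakly_incr (diagram lam \<mu>) T \<and> cols_weakly_incr (diagram lam \<mu>) T \<and>
      (\<forall>n. card (entry_cells (diagram lam \<mu>) T n) = \<tau> n) \<and>
      (\<forall>n. broken_ribbon (entry_cells (diagram lam \<mu>) T n))}"

definition reverse_broken_ribbon_tableaux ::
    "(nat \<Rightarrow> nat) \<Rightarrow> (nat \<Rightarrow> nat) \<Rightarrow> (nat \<Rightarrow> nat) \<Rightarrow> filling set" where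
  "reverse_broken_ribbon_tableaux lam \<mu> \<tau> =
    {T \<in> diagram lam \<mu> \<rightarrow>\<^sub>E UNIV.
      rows_weakly_decr (diagram lam \<mu>) T \<and> cols_weakly_decr (diagram lam \<mu>) T \<and>
      (\<forall>n. card (entry_cells (diagram lam \<mu>) T n) = \<tau> n) \<and>
      (\<forall>n. broken_ribbon (entry_cells (diagram lam \<mu>) T n))}"

text \<open>
  Only entries that occur are summed over; the cell sets of all others are empty and
  contribute 0.
\<close>

definition tab_rib :: "cell set \<Rightarrow> filling \<Rightarrow> nat" where
  "tab_rib D T = (\<Sum>n\<in>T ` D. rib (entry_cells D T n))"

definition tab_ht :: "cell set \<Rightarrow> filling \<Rightarrow> nat" where
  "tab_ht D T = (\<Sum>n\<in>T ` D. ht (entry_cells D T n))"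

definition tab_wt :: "cell set \<Rightarrow> filling \<Rightarrow> nat" where
  "tab_wt D T = (\<Sum>n\<in>T ` D. wt (entry_cells D T n))"


section \<open>Symmetric functions\<close>

text \<open>Collecting terms, the coefficient of a monomial counts the tableaux of that content.\<close>

definition skew_schur :: "(nat \<Rightarrow> nat) \<Rightarrow> (nat \<Rightarrow> nat) \<Rightarrow> int poly series" where
  "skew_schur lam \<mu> = Series (\<lambda>m. of_nat (card
    {T \<in> diagram lam \<mu> \<rightarrow>\<^sub>E UNIV.
      rows_weakly_incr (diagram lam \<mu>) T \<and> cols_strictly_incr (diagram lam \<mu>) T \<and>
      (\<forall>n. card (entry_cells (diagram lam \<mu>) T n) = Poly_Mapping.lookup m n)}))"

definition monomial_sym :: "(nat \<Rightarrow> nat) \<Rightarrow> int poly series" where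
  "monomial_sym \<tau> = Series (\<lambda>m.
    if \<exists>v :: nat \<Rightarrow> nat. inj_on v {..<num_parts \<tau>} \<and>
        m = (\<Sum>k<num_parts \<tau>. Poly_Mapping.single (v k) (\<tau> k))
    then 1 else 0)"

text \<open>Only used for \<open>r \<ge> 1\<close>, where every \<open>\<tau>\<close> in the sum has at least one part.\<close>

definition quantum_power_sum :: "nat \<Rightarrow> int poly series" where
  "quantum_power_sum r = (\<Sum>\<tau>\<in>{\<tau>. is_partition \<tau> \<and> psize \<tau> = r}.
    scale ((- 1) ^ (num_parts \<tau> - 1) * (q - 1) ^ (num_parts \<tau> - 1)) (monomial_sym \<tau>))"

definition quantum_power_sum_part :: "(nat \<Rightarrow> nat) \<Rightarrow> int poly series" where
  "quantum_power_sum_part \<tau> = (\<Prod>i<num_parts \<tau>. quantum_power_sum (\<tau> i))"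

text \<open>
  The exponent of \<open>1 - q\<close> drops by one for each part of \<open>\<tau>\<close>: a product of \<open>num_parts \<tau>\<close>
  quantum power sums contributes one factor \<open>(1 - q) ^ (\<dots> - 1)\<close> each.  The subtraction on
  \<open>nat\<close> does not truncate, as each \<open>n < num_parts \<tau>\<close> occurs as an entry of \<open>T'\<close> or \<open>T''\<close>.
  For \<open>\<tau>\<close> with a single part the exponent is \<open>rib T' + rib T'' - 1\<close>.
\<close>

definition chi ::
    "(nat \<Rightarrow> nat) \<Rightarrow> (nat \<Rightarrow> nat) \<Rightarrow> (nat \<Rightarrow> nat) \<Rightarrow> (nat \<Rightarrow> nat) \<Rightarrow> (nat \<Rightarrow> nat) \<Rightarrow> int poly" where
  "chi lam_plus lam \<mu> \<mu>_minus \<tau> =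
    (\<Sum>(T', T'') \<in> {(T', T''). \<exists>\<tau>' \<tau>''.
        T' \<in> broken_ribbon_tableaux lam_plus lam \<tau>' \<and>
        T'' \<in> reverse_broken_ribbon_tableaux \<mu> \<mu>_minus \<tau>'' \<and>
        (\<forall>n. \<tau>' n + \<tau>'' n = \<tau> n)}.
      (- q) ^ (tab_ht (diagram lam_plus lam) T' + tab_wt (diagram \<mu> \<mu>_minus) T'') *
      (1 - q) ^ (tab_rib (diagram lam_plus lam) T' + tab_rib (diagram \<mu> \<mu>_minus) T'' - num_parts \<tau>))"

end

theory Submission
  imports Defs "HOL-Computational_Algebra.Formal_Power_Series"
begin

text \<open>
  In \<open>1 - q\<close> times a quantum power sum, every variable of a monomial contributes one factor
  \<open>1 - q\<close>, whatever its exponent is.  Hence the generating function factors over the variables: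
  \<open>1 + (1 - q) (p\<^sub>1 t + p\<^sub>2 t\<^sup>2 + \<dots>)\<close> is the product over \<open>i\<close> of \<open>(1 - q x\<^sub>i t) / (1 - x\<^sub>i t)\<close>.
  The rule for one part is obtained by commuting such factors past operators that add and
  remove strips.

  Consider functions on the set of partitions whose values are power series in \<open>t\<close>.  Let \<open>D\<^sub>b\<close>
  send \<open>f\<close> to the function whose value at \<open>\<lambda>\<close> is the sum of \<open>(b t)\<^sup>s f(\<nu>)\<close> over all \<open>\<nu>\<close> such that
  \<open>\<nu>/\<lambda>\<close> is a horizontal strip of size \<open>s\<close>; let \<open>V\<^sub>a\<close> do the same with \<open>a\<close> and vertical strips;
  and let \<open>U\<^sub>x f(\<lambda>)\<close> be the sum of \<open>x\<^sup>s f(\<rho>)\<close> over all \<open>\<rho>\<close> such that \<open>\<lambda>/\<rho>\<close> is a horizontal strip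
  of size \<open>s\<close>.  Applying \<open>U\<close> once for each variable to the indicator function of \<open>\<mu>\<close> gives,
  at \<open>\<lambda>\<close>, the skew Schur function of \<open>\<lambda>/\<mu>\<close> in these variables.  Three facts about partitions
  carry the proof.

  \<^item> \<open>D\<^sub>b U\<^sub>x = (1 - b x t)\<^sup>-\<^sup>1 U\<^sub>x D\<^sub>b\<close> (\<open>act_hker_add_var\<close>), by a bijection that reflects each row
    in an interval.
  \<^item> \<open>D\<^sub>b\<close> and \<open>V\<^sub>-\<^sub>b\<close> are inverse to each other (\<open>hv_inverse\<close>, \<open>vh_inverse\<close>): the choices for
    the intermediate partition are independent in different rows, and in one row they cancel.
  \<^item> \<open>D\<^sub>b V\<^sub>a\<close> gives the shape \<open>\<kappa>/\<lambda>\<close> the weight \<open>a\<^sup>h b\<^sup>w (a + b)\<^sup>r\<close> if it is a broken ribbon of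
    height \<open>h\<close> and width \<open>w\<close> with \<open>r\<close> components, and the weight \<open>0\<close> otherwise
    (\<open>ribbon_weight\<close>): a cell with a cell above it must lie in the vertical strip, a cell with
    a cell to its right must lie in the horizontal strip, and the top right cell of each
    component is free.

  Conjugating the first fact by the second gives \<open>V\<^sub>-\<^sub>q U\<^sub>x = (1 - q x t) U\<^sub>x V\<^sub>-\<^sub>q\<close>.  So
  \<open>R = D\<^sub>1 V\<^sub>-\<^sub>q\<close> passes through all the operators \<open>U\<close> and leaves behind exactly the product of the
  factors \<open>(1 - q x\<^sub>i t) / (1 - x\<^sub>i t)\<close>.  Put \<open>R' = D\<^sub>q V\<^sub>-\<^sub>1\<close>.  Then \<open>R R' = 1\<close>, and evaluating
  \<open>R U \<dots> U R'\<close> on the indicator function of \<open>\<mu>\<close> in two ways gives the rule for one part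
  (\<open>ribbon_operators_cancel\<close>, \<open>ribbon_rule_finite\<close>): by the third fact \<open>R\<close> adds a broken ribbon
  to \<open>\<lambda>\<close>, \<open>R'\<close> removes one from \<open>\<mu>\<close>, and the coefficient of \<open>t\<^sup>r\<close> of the product is \<open>(1 - q) p\<^sub>r\<close>.
  Infinitely many variables cause no trouble, because the coefficient of a monomial involves
  only finitely many of them.

  For several parts the rule is iterated (\<open>skew_schur_times_quantum_power_sums\<close>).  A pair of
  tableaux records the successive steps: the last part is the largest entry, which occupies the
  outermost ribbon of the first tableau and the innermost ribbon of the reverse one.
\<close>


section \<open>Partitions\<close>

definition parts_between :: "(nat \<Rightarrow> nat) \<Rightarrow> (nat \<Rightarrow> nat) \<Rightarrow> (nat \<Rightarrow> nat) set" where
  "parts_between lam \<kappa> = {\<nu>. is_partition \<nu> \<and> lam \<le> \<nu> \<and> \<nu> \<le> \<kappa>}"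

definition parts_below :: "(nat \<Rightarrow> nat) \<Rightarrow> (nat \<Rightarrow> nat) set" where
  "parts_below \<kappa> = {\<nu>. is_partition \<nu> \<and> \<nu> \<le> \<kappa>}"

definition parts_above :: "(nat \<Rightarrow> nat) \<Rightarrow> nat \<Rightarrow> (nat \<Rightarrow> nat) set" where
  "parts_above lam n = {\<nu>. is_partition \<nu> \<and> lam \<le> \<nu> \<and> psize \<nu> \<le> psize lam + n}"

lemma partition_antimono: "is_partition lam \<Longrightarrow> i \<le> j \<Longrightarrow> lam j \<le> lam i"
  by (auto simp: is_partition_def antimono_def)

lemma support_subset:
  fixes lam :: "nat \<Rightarrow> nat"
  shows "(\<forall>i\<ge>N. lam i = 0) \<Longrightarrow> {i. lam i \<noteq> 0} \<subseteq> {..<N}"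
proof
  fix i assume "\<forall>i\<ge>N. lam i = 0" "i \<in> {i. lam i \<noteq> 0}"
  then show "i \<in> {..<N}"
    by (cases "N \<le> i") auto
qed

lemma is_partitionI:
  assumes "\<And>i. lam (Suc i) \<le> lam i" "\<forall>i\<ge>N. lam i = 0"
  shows "is_partition lam"
  unfolding is_partition_def
proof
  show "antimono lam"
    using assms(1) by (auto simp: antimono_iff_le_Suc)
  have "{i. lam i \<noteq> 0} \<subseteq> {..<N}"
    using assms(2) by (rule support_subset)
  then show "finite {i. lam i \<noteq> 0}"
    by (rule finite_subset) simp
qed

lemma partition_bound:
  assumes "is_partition lam"
  shows "\<exists>N. \<forall>i\<ge>N. lam i = 0"
proof -
  have "finite {i. lam i \<noteq> 0}"
    using assms by (simp add: is_partition_def)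
  then obtain N where "{i. lam i \<noteq> 0} \<subseteq> {..<N}"
    by (meson finite_nat_iff_bounded)
  then have "\<forall>i\<ge>N. lam i = 0"
    by (auto simp: subset_iff not_less)
  then show ?thesis ..
qed

lemma psize_eq_sum: "(\<forall>i\<ge>N. lam i = 0) \<Longrightarrow> psize lam = (\<Sum>i<N. lam i)"
proof -
  assume "\<forall>i\<ge>N. lam i = 0"
  then have "{i. lam i \<noteq> 0} \<subseteq> {..<N}"
    by (rule support_subset)
  then show ?thesis
    unfolding psize_def by (intro sum.mono_neutral_left) auto
qed

lemma zero_beyond_mono:
  fixes lam \<kappa> :: "nat \<Rightarrow> nat"
  assumes "lam \<le> \<kappa>" "\<forall>i\<ge>N. \<kappa> i = 0"
  shows "\<forall>i\<ge>N. lam i = 0"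
  using assms by (simp add: le_fun_def) (metis le_zero_eq)

lemma psize_diff:
  assumes "\<forall>i\<ge>N. \<kappa> i = 0" "lam \<le> \<kappa>"
  shows "psize \<kappa> - psize lam = (\<Sum>i<N. \<kappa> i - lam i)"
proof -
  note N' = zero_beyond_mono[OF assms(2,1)]
  show ?thesis
    using le_funD[OF assms(2)]
    by (simp add: psize_eq_sum[OF assms(1)] psize_eq_sum[OF N'] sum_subtractf_nat)
qed

lemma psize_mono:
  assumes "is_partition \<kappa>" "lam \<le> \<kappa>"
  shows "psize lam \<le> psize \<kappa>"
proof -
  obtain N where N: "\<forall>i\<ge>N. \<kappa> i = 0"
    using partition_bound[OF assms(1)] by auto
  note N' = zero_beyond_mono[OF assms(2) N]
  show ?thesis
    using le_funD[OF assms(2)]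
    by (simp add: psize_eq_sum[OF N] psize_eq_sum[OF N'] sum_mono)
qed

lemma psize_eq_imp_eq:
  assumes "is_partition \<kappa>" "lam \<le> \<kappa>" "psize \<kappa> \<le> psize lam"
  shows "lam = \<kappa>"
proof
  fix i
  obtain N where N: "\<forall>i\<ge>N. \<kappa> i = 0"
    using partition_bound[OF assms(1)] by auto
  have "(\<Sum>i<N. \<kappa> i - lam i) = 0"
    using psize_diff[OF N assms(2)] assms(3) by simp
  then have "i < N \<Longrightarrow> \<kappa> i - lam i = 0" by simp
  then show "lam i = \<kappa> i"
    using N le_funD[OF assms(2), of i] by (cases "i < N") auto
qed

lemma finite_parts_below:
  assumes "is_partition \<kappa>"
  shows "finite (parts_below \<kappa>)"
proof -
  obtain N where N: "\<forall>i\<ge>N. \<kappa> i = 0"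
    using partition_bound[OF assms(1)] by auto
  have "parts_below \<kappa> \<subseteq> {\<nu>. \<forall>i. (i \<in> {..<N} \<longrightarrow> \<nu> i \<in> {..\<kappa> 0}) \<and> (i \<notin> {..<N} \<longrightarrow> \<nu> i = 0)}"
  proof
    fix \<nu> assume "\<nu> \<in> parts_below \<kappa>"
    then have le: "\<nu> \<le> \<kappa>" by (simp add: parts_below_def)
    have "\<nu> i \<le> \<kappa> 0" for i
      using le_funD[OF le, of i] partition_antimono[OF assms, of 0 i] by simp
    then show "\<nu> \<in> {\<nu>. \<forall>i. (i \<in> {..<N} \<longrightarrow> \<nu> i \<in> {..\<kappa> 0}) \<and> (i \<notin> {..<N} \<longrightarrow> \<nu> i = 0)}"
      using zero_beyond_mono[OF le N] by auto
  qed
  then show ?thesis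
    by (rule finite_subset) (rule finite_set_of_finite_funs; simp)
qed

lemma finite_parts_between: "is_partition \<kappa> \<Longrightarrow> finite (parts_between lam \<kappa>)"
  by (rule finite_subset[OF _ finite_parts_below[of \<kappa>]])
    (auto simp: parts_between_def parts_below_def)

text \<open>A partition of size at most \<open>M\<close> has at most \<open>M\<close> parts, each of them at most \<open>M\<close>.\<close>

lemma finite_parts_size: "finite {\<nu>. is_partition \<nu> \<and> psize \<nu> \<le> M}"
proof -
  have "{\<nu>. is_partition \<nu> \<and> psize \<nu> \<le> M} \<subseteq>
    {\<nu>. \<forall>i. (i \<in> {..<M} \<longrightarrow> \<nu> i \<in> {..M}) \<and> (i \<notin> {..<M} \<longrightarrow> \<nu> i = 0)}"
  proof
    fix \<nu> assume "\<nu> \<in> {\<nu>. is_partition \<nu> \<and> psize \<nu> \<le> M}"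
    then have p: "is_partition \<nu>" and s: "psize \<nu> \<le> M" by auto
    obtain N where N: "\<forall>i\<ge>N. \<nu> i = 0"
      using partition_bound[OF p] by auto
    have sz: "psize \<nu> = (\<Sum>i<N. \<nu> i)" by (rule psize_eq_sum[OF N])
    have *: "Suc i * \<nu> i \<le> M" for i
    proof (cases "i < N")
      case True
      have "Suc i * \<nu> i = (\<Sum>j<Suc i. \<nu> i)" by simp
      also have "\<dots> \<le> (\<Sum>j<Suc i. \<nu> j)"
        by (rule sum_mono) (simp add: partition_antimono[OF p])
      also have "\<dots> \<le> (\<Sum>j<N. \<nu> j)"
        by (rule sum_mono2) (use True in auto)
      finally show ?thesis using s sz by simp
    qed (simp add: N)
    have "\<nu> i \<le> M \<and> (M \<le> i \<longrightarrow> \<nu> i = 0)" for i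
      using *[of i] by (cases "\<nu> i") auto
    then show "\<nu> \<in> {\<nu>. \<forall>i. (i \<in> {..<M} \<longrightarrow> \<nu> i \<in> {..M}) \<and> (i \<notin> {..<M} \<longrightarrow> \<nu> i = 0)}"
      by auto
  qed
  then show ?thesis
    by (rule finite_subset) (rule finite_set_of_finite_funs; simp)
qed

lemma finite_parts_above: "finite (parts_above lam n)"
  by (rule finite_subset[OF _ finite_parts_size[of "psize lam + n"]])
    (auto simp: parts_above_def)

lemma diagram_eq_Sigma:
  assumes "\<forall>i\<ge>N. \<kappa> i = 0"
  shows "diagram \<kappa> lam = (SIGMA i:{..<N}. {lam i..<\<kappa> i})"
proof -
  have "i < N" if "j < \<kappa> i" for i j
    using assms that by (cases "i < N") auto
  then show ?thesis by (auto simp: diagram_def)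
qed

lemma finite_diagram: "is_partition \<kappa> \<Longrightarrow> finite (diagram \<kappa> lam)"
proof -
  assume "is_partition \<kappa>"
  then obtain N where "\<forall>i\<ge>N. \<kappa> i = 0"
    using partition_bound by auto
  then show ?thesis by (subst diagram_eq_Sigma) auto
qed

lemma card_diagram:
  assumes "is_partition \<kappa>" "lam \<le> \<kappa>"
  shows "card (diagram \<kappa> lam) = psize \<kappa> - psize lam"
proof -
  obtain N where N: "\<forall>i\<ge>N. \<kappa> i = 0"
    using partition_bound[OF assms(1)] by auto
  show ?thesis
    by (simp add: diagram_eq_Sigma[OF N] psize_diff[OF N assms(2)])
qed

lemma down_closed_eq_lessThan:
  fixes S :: "nat set"
  assumes "finite S" "\<And>i j. j \<le> i \<Longrightarrow> i \<in> S \<Longrightarrow> j \<in> S"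
  shows "S = {..<card S}"
proof -
  obtain n where "S = {..<n}"
  proof (cases "S = {}")
    case True
    then show thesis using that[of 0] by simp
  next
    case False
    have "i \<in> S \<longleftrightarrow> i < Suc (Max S)" for i
      using Max_ge[OF assms(1), of i] assms(2)[of i "Max S"] Max_in[OF assms(1) False] by auto
    then show thesis using that[of "Suc (Max S)"] by auto
  qed
  then show ?thesis by simp
qed

lemma num_parts_iff:
  assumes "is_partition lam"
  shows "i < num_parts lam \<longleftrightarrow> lam i \<noteq> 0"
proof -
  have "{i. lam i \<noteq> 0} = {..<num_parts lam}"
    unfolding num_parts_def
  proof (rule down_closed_eq_lessThan)
    show "finite {i. lam i \<noteq> 0}" using assms by (simp add: is_partition_def)
    show "j \<in> {i. lam i \<noteq> 0}" if "j \<le> i" "i \<in> {i. lam i \<noteq> 0}" for i j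
      using that partition_antimono[OF assms, of j i] by simp
  qed
  then show ?thesis by auto
qed

section \<open>Horizontal and vertical strips\<close>

definition hstrip :: "(nat \<Rightarrow> nat) \<Rightarrow> (nat \<Rightarrow> nat) \<Rightarrow> bool" where
  "hstrip lam \<nu> \<longleftrightarrow> lam \<le> \<nu> \<and> (\<forall>i. \<nu> (Suc i) \<le> lam i)"

definition vstrip :: "(nat \<Rightarrow> nat) \<Rightarrow> (nat \<Rightarrow> nat) \<Rightarrow> bool" where
  "vstrip lam \<nu> \<longleftrightarrow> lam \<le> \<nu> \<and> (\<forall>i. \<nu> i \<le> Suc (lam i))"

definition hker :: "'a::comm_ring_1 \<Rightarrow> (nat \<Rightarrow> nat) \<Rightarrow> (nat \<Rightarrow> nat) \<Rightarrow> 'a" where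
  "hker b lam \<nu> = (if hstrip lam \<nu> then b ^ (psize \<nu> - psize lam) else 0)"

definition vker :: "'a::comm_ring_1 \<Rightarrow> (nat \<Rightarrow> nat) \<Rightarrow> (nat \<Rightarrow> nat) \<Rightarrow> 'a" where
  "vker a lam \<nu> = (if vstrip lam \<nu> then a ^ (psize \<nu> - psize lam) else 0)"

text \<open>
  Weights on pairs \<open>lam \<le> \<nu>\<close> form the incidence algebra of Young's lattice, and this is its
  product.
\<close>

definition conv :: "((nat \<Rightarrow> nat) \<Rightarrow> (nat \<Rightarrow> nat) \<Rightarrow> 'a::comm_ring_1) \<Rightarrow>
    ((nat \<Rightarrow> nat) \<Rightarrow> (nat \<Rightarrow> nat) \<Rightarrow> 'a) \<Rightarrow> (nat \<Rightarrow> nat) \<Rightarrow> (nat \<Rightarrow> nat) \<Rightarrow> 'a" where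
  "conv k l lam \<kappa> = (\<Sum>\<nu>\<in>parts_between lam \<kappa>. k lam \<nu> * l \<nu> \<kappa>)"

text \<open>
  The partitions between which strips are inserted are constrained row by row, so that sums
  over them turn into products over rows.
\<close>

lemma sum_over_box:
  fixes g :: "nat \<Rightarrow> nat \<Rightarrow> 'a::comm_ring_1"
  assumes "\<forall>i\<ge>N. lo i = 0" "\<forall>i\<ge>N. hi i = 0"
  shows "(\<Sum>\<nu>\<in>{\<nu>. \<forall>i. lo i \<le> \<nu> i \<and> \<nu> i \<le> hi i}. \<Prod>i<N. g i (\<nu> i)) =
         (\<Prod>i<N. \<Sum>v\<in>{lo i..hi i}. g i v)"
proof -
  have "(\<Prod>i<N. \<Sum>v\<in>{lo i..hi i}. g i v) =
        (\<Sum>p\<in>(\<Pi>\<^sub>E i\<in>{..<N}. {lo i..hi i}). \<Prod>i<N. g i (p i))"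
    by (rule prod_sum_PiE) simp_all
  also have "\<dots> = (\<Sum>\<nu>\<in>{\<nu>. \<forall>i. lo i \<le> \<nu> i \<and> \<nu> i \<le> hi i}. \<Prod>i<N. g i (\<nu> i))"
  proof (rule sum.reindex_bij_witness[where i = "\<lambda>\<nu>. restrict \<nu> {..<N}"
        and j = "\<lambda>p i. if i < N then p i else 0"], goal_cases)
    case (1 p)
    show ?case
    proof
      fix i show "restrict (\<lambda>i. if i < N then p i else 0) {..<N} i = p i"
        using PiE_arb[OF 1, of i] by auto
    qed
  next
    case (2 p)
    have "lo i \<le> (if i < N then p i else 0) \<and> (if i < N then p i else 0) \<le> hi i" for i
      using assms(1) PiE_mem[OF 2, of i] by auto
    then show ?case by simp
  next
    case (3 \<nu>)
    have "\<nu> i = 0" if "N \<le> i" for i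
      using 3 assms(2) that by (metis (mono_tags) le_zero_eq mem_Collect_eq)
    then show ?case by (auto simp: fun_eq_iff not_less)
  next
    case (4 \<nu>)
    then show ?case by (auto simp: PiE_iff)
  next
    case (5 p)
    then show ?case by simp
  qed
  finally show ?thesis by simp
qed

text \<open>
  The bound that the row above puts on row \<open>i\<close> of a horizontal strip over \<open>lam\<close>.  Nothing lies
  above row \<open>0\<close>; there \<open>t\<close> stands for any bound that holds anyway.
\<close>

definition prev_row :: "(nat \<Rightarrow> nat) \<Rightarrow> nat \<Rightarrow> nat \<Rightarrow> nat" where
  "prev_row lam t i = (case i of 0 \<Rightarrow> t | Suc j \<Rightarrow> lam j)"

text \<open>
  The rows are independent because the intermediate function is automatically antitone: for a
  horizontal strip over \<open>lam\<close>, \<open>\<nu> (Suc i) \<le> lam i \<le> \<nu> i\<close>.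
\<close>

lemma hv_strips_box:
  assumes "is_partition lam" "is_partition \<kappa>"
  shows "{\<nu> \<in> parts_between lam \<kappa>. hstrip lam \<nu> \<and> vstrip \<nu> \<kappa>} =
    {\<nu>. \<forall>i. max (lam i) (\<kappa> i - 1) \<le> \<nu> i \<and> \<nu> i \<le> min (\<kappa> i) (prev_row lam (\<kappa> 0) i)}"
    (is "?L = ?R")
proof
  show "?L \<subseteq> ?R"
  proof
    fix \<nu> assume "\<nu> \<in> ?L"
    then have *: "\<And>i. lam i \<le> \<nu> i" "\<And>i. \<nu> i \<le> \<kappa> i" "\<And>i. \<nu> (Suc i) \<le> lam i" "\<And>i. \<kappa> i \<le> Suc (\<nu> i)"
      by (auto simp: parts_between_def hstrip_def vstrip_def le_fun_def)
    have "\<kappa> i - 1 \<le> \<nu> i" for i using *(4)[of i] by simp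
    with * show "\<nu> \<in> ?R" by (auto simp: prev_row_def split: nat.split)
  qed
  show "?R \<subseteq> ?L"
  proof
    fix \<nu> assume "\<nu> \<in> ?R"
    then have *: "\<And>i. lam i \<le> \<nu> i" "\<And>i. \<kappa> i - 1 \<le> \<nu> i" "\<And>i. \<nu> i \<le> \<kappa> i"
      "\<And>i. \<nu> i \<le> prev_row lam (\<kappa> 0) i" by auto
    have h: "\<nu> (Suc i) \<le> lam i" for i
      using *(4)[of "Suc i"] by (simp add: prev_row_def)
    obtain N where N: "\<forall>i\<ge>N. \<kappa> i = 0"
      using partition_bound[OF assms(2)] by auto
    have le: "\<nu> \<le> \<kappa>" using *(3) by (simp add: le_fun_def)
    have "is_partition \<nu>"
      by (rule is_partitionI[OF order_trans[OF h *(1)] zero_beyond_mono[OF le N]])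
    moreover have "\<kappa> i \<le> Suc (\<nu> i)" for i using *(2)[of i] by simp
    ultimately show "\<nu> \<in> ?L"
      using * h by (auto simp: parts_between_def hstrip_def vstrip_def le_fun_def)
  qed
qed

text \<open>
  Here \<open>\<kappa>\<close> separates consecutive rows: \<open>\<nu> (Suc i) \<le> \<kappa> (Suc i) \<le> \<nu> i\<close>.
\<close>

lemma vh_strips_box:
  assumes "is_partition lam" "is_partition \<kappa>"
  shows "{\<nu> \<in> parts_between lam \<kappa>. vstrip lam \<nu> \<and> hstrip \<nu> \<kappa>} =
    {\<nu>. \<forall>i. max (lam i) (\<kappa> (Suc i)) \<le> \<nu> i \<and> \<nu> i \<le> min (\<kappa> i) (Suc (lam i))}"
    (is "?L = ?R")
proof
  show "?L \<subseteq> ?R"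
    by (auto simp: parts_between_def hstrip_def vstrip_def le_fun_def)
  show "?R \<subseteq> ?L"
  proof
    fix \<nu> assume "\<nu> \<in> ?R"
    then have *: "\<And>i. lam i \<le> \<nu> i" "\<And>i. \<kappa> (Suc i) \<le> \<nu> i" "\<And>i. \<nu> i \<le> \<kappa> i"
      "\<And>i. \<nu> i \<le> Suc (lam i)" by auto
    obtain N where N: "\<forall>i\<ge>N. \<kappa> i = 0"
      using partition_bound[OF assms(2)] by auto
    have le: "\<nu> \<le> \<kappa>" using *(3) by (simp add: le_fun_def)
    have "is_partition \<nu>"
      by (rule is_partitionI[OF order_trans[OF *(3) *(2)] zero_beyond_mono[OF le N]])
    then show "\<nu> \<in> ?L"
      using * by (auto simp: parts_between_def hstrip_def vstrip_def le_fun_def)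
  qed
qed

lemma power_psize_diff:
  fixes b :: "'a::comm_ring_1"
  assumes "\<forall>i\<ge>N. \<kappa> i = 0" "lam \<le> \<kappa>"
  shows "b ^ (psize \<kappa> - psize lam) = (\<Prod>i<N. b ^ (\<kappa> i - lam i))"
  by (simp add: psize_diff[OF assms] power_sum)

lemma conv_hker_vker:
  fixes a b :: "'a::comm_ring_1"
  assumes lam: "is_partition lam" and \<kappa>: "is_partition \<kappa>" and le: "lam \<le> \<kappa>"
    and N: "\<forall>i\<ge>N. \<kappa> i = 0"
  shows "conv (hker b) (vker a) lam \<kappa> =
    (\<Prod>i<N. \<Sum>v\<in>{max (lam i) (\<kappa> i - 1)..min (\<kappa> i) (prev_row lam (\<kappa> 0) i)}.
       b ^ (v - lam i) * a ^ (\<kappa> i - v))"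
proof -
  let ?B = "{\<nu>. \<forall>i. max (lam i) (\<kappa> i - 1) \<le> \<nu> i \<and> \<nu> i \<le> min (\<kappa> i) (prev_row lam (\<kappa> 0) i)}"
  have "conv (hker b) (vker a) lam \<kappa> =
    (\<Sum>\<nu>\<in>{\<nu> \<in> parts_between lam \<kappa>. hstrip lam \<nu> \<and> vstrip \<nu> \<kappa>}.
       b ^ (psize \<nu> - psize lam) * a ^ (psize \<kappa> - psize \<nu>))"
    unfolding conv_def hker_def vker_def
    by (rule sum.mono_neutral_cong_right) (auto simp: finite_parts_between[OF \<kappa>])
  also have "\<dots> = (\<Sum>\<nu>\<in>?B. \<Prod>i<N. b ^ (\<nu> i - lam i) * a ^ (\<kappa> i - \<nu> i))"
  proof (rule sum.cong[OF hv_strips_box[OF lam \<kappa>]])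
    fix \<nu> assume "\<nu> \<in> ?B"
    then have 1: "lam \<le> \<nu>" and 2: "\<nu> \<le> \<kappa>" by (auto simp: le_fun_def)
    show "b ^ (psize \<nu> - psize lam) * a ^ (psize \<kappa> - psize \<nu>) =
      (\<Prod>i<N. b ^ (\<nu> i - lam i) * a ^ (\<kappa> i - \<nu> i))"
      by (simp add: prod.distrib power_psize_diff[OF N 2]
          power_psize_diff[OF zero_beyond_mono[OF 2 N] 1])
  qed
  also have "\<dots> = (\<Prod>i<N. \<Sum>v\<in>{max (lam i) (\<kappa> i - 1)..min (\<kappa> i) (prev_row lam (\<kappa> 0) i)}.
       b ^ (v - lam i) * a ^ (\<kappa> i - v))"
    by (rule sum_over_box) (simp_all add: N zero_beyond_mono[OF le N])
  finally show ?thesis .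
qed

lemma conv_vker_hker:
  fixes a b :: "'a::comm_ring_1"
  assumes lam: "is_partition lam" and \<kappa>: "is_partition \<kappa>" and le: "lam \<le> \<kappa>"
    and N: "\<forall>i\<ge>N. \<kappa> i = 0"
  shows "conv (vker a) (hker b) lam \<kappa> =
    (\<Prod>i<N. \<Sum>v\<in>{max (lam i) (\<kappa> (Suc i))..min (\<kappa> i) (Suc (lam i))}.
       a ^ (v - lam i) * b ^ (\<kappa> i - v))"
proof -
  let ?B = "{\<nu>. \<forall>i. max (lam i) (\<kappa> (Suc i)) \<le> \<nu> i \<and> \<nu> i \<le> min (\<kappa> i) (Suc (lam i))}"
  have "conv (vker a) (hker b) lam \<kappa> =
    (\<Sum>\<nu>\<in>{\<nu> \<in> parts_between lam \<kappa>. vstrip lam \<nu> \<and> hstrip \<nu> \<kappa>}.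
       a ^ (psize \<nu> - psize lam) * b ^ (psize \<kappa> - psize \<nu>))"
    unfolding conv_def hker_def vker_def
    by (rule sum.mono_neutral_cong_right) (auto simp: finite_parts_between[OF \<kappa>])
  also have "\<dots> = (\<Sum>\<nu>\<in>?B. \<Prod>i<N. a ^ (\<nu> i - lam i) * b ^ (\<kappa> i - \<nu> i))"
  proof (rule sum.cong[OF vh_strips_box[OF lam \<kappa>]])
    fix \<nu> assume "\<nu> \<in> ?B"
    then have 1: "lam \<le> \<nu>" and 2: "\<nu> \<le> \<kappa>" by (auto simp: le_fun_def)
    show "a ^ (psize \<nu> - psize lam) * b ^ (psize \<kappa> - psize \<nu>) =
      (\<Prod>i<N. a ^ (\<nu> i - lam i) * b ^ (\<kappa> i - \<nu> i))"
      by (simp add: prod.distrib power_psize_diff[OF N 2]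
          power_psize_diff[OF zero_beyond_mono[OF 2 N] 1])
  qed
  also have "\<dots> = (\<Prod>i<N. \<Sum>v\<in>{max (lam i) (\<kappa> (Suc i))..min (\<kappa> i) (Suc (lam i))}.
       a ^ (v - lam i) * b ^ (\<kappa> i - v))"
    by (rule sum_over_box) (simp_all add: N zero_beyond_mono[OF le N])
  finally show ?thesis .
qed

text \<open>
  The vertical strip contains at most the last cell of the row.  That cell is free if no
  cell of the shape lies above it.  If the row overlaps the row above in just this cell, it is
  forced into the vertical strip.  If the rows overlap in two or more columns, the shape has a
  block, and no choice is valid.
\<close>

lemma hv_row_factor:
  fixes a b :: "'a::comm_ring_1"
  assumes lam: "is_partition lam" and \<kappa>: "is_partition \<kappa>" and le: "lam \<le> \<kappa>"
  shows "(\<Sum>v\<in>{max (lam i) (\<kappa> i - 1)..min (\<kappa> i) (prev_row lam (\<kappa> 0) i)}.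
       b ^ (v - lam i) * a ^ (\<kappa> i - v)) =
    (if \<kappa> i = lam i then 1
     else if \<kappa> i \<le> prev_row lam (\<kappa> 0) i then (a + b) * b ^ (\<kappa> i - lam i - 1)
     else if \<kappa> i = Suc (prev_row lam (\<kappa> 0) i) then a * b ^ (\<kappa> i - lam i - 1)
     else 0)"
proof -
  have up: "lam i \<le> prev_row lam (\<kappa> 0) i"
    using le_funD[OF le, of i] partition_antimono[OF lam]
    by (auto simp: prev_row_def split: nat.split)
  have le': "lam i \<le> \<kappa> i" using le_funD[OF le] .
  let ?p = "prev_row lam (\<kappa> 0) i"
  consider "\<kappa> i = lam i" | m where "\<kappa> i = Suc m" "lam i \<le> m" "\<kappa> i \<le> ?p"
    | m where "\<kappa> i = Suc m" "lam i \<le> m" "?p = m" | "\<kappa> i > lam i" "\<kappa> i > Suc ?p"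
    using le' by (cases "\<kappa> i") (auto simp: le_Suc_eq not_le less_Suc_eq, linarith)
  then show ?thesis
  proof cases
    case 1
    then have "{max (lam i) (\<kappa> i - 1)..min (\<kappa> i) ?p} = {lam i}" using up by auto
    then show ?thesis using 1 by simp
  next
    case 2
    then have "{max (lam i) (\<kappa> i - 1)..min (\<kappa> i) ?p} = {m, Suc m}" by auto
    then show ?thesis using 2 by (simp add: Suc_diff_le algebra_simps)
  next
    case 3
    then have "{max (lam i) (\<kappa> i - 1)..min (\<kappa> i) ?p} = {m}" by auto
    then show ?thesis using 3 by (simp add: algebra_simps)
  next
    case 4
    then have "{max (lam i) (\<kappa> i - 1)..min (\<kappa> i) ?p} = {}" by auto
    then show ?thesis using 4 by auto
  qed
qed

lemma differing_row:
  assumes "lam \<noteq> \<kappa>" "\<forall>i\<ge>N. \<kappa> i = 0" "lam \<le> (\<kappa> :: nat \<Rightarrow> nat)"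
  shows "{i. lam i \<noteq> \<kappa> i} \<noteq> {}" "{i. lam i \<noteq> \<kappa> i} \<subseteq> {..<N}"
proof -
  show "{i. lam i \<noteq> \<kappa> i} \<noteq> {}" using assms(1) by auto
  show "{i. lam i \<noteq> \<kappa> i} \<subseteq> {..<N}"
  proof
    fix i assume "i \<in> {i. lam i \<noteq> \<kappa> i}"
    then show "i \<in> {..<N}"
      using assms(2) zero_beyond_mono[OF assms(3,2)] by (cases "N \<le> i") auto
  qed
qed

text \<open>
  In the first row in which the partitions differ, no cell lies above the last cell, and the
  two choices for it cancel.
\<close>

lemma hv_inverse:
  fixes b :: "'a::comm_ring_1"
  assumes lam: "is_partition lam" and \<kappa>: "is_partition \<kappa>" and le: "lam \<le> \<kappa>"
  shows "conv (hker b) (vker (- b)) lam \<kappa> = (if lam = \<kappa> then 1 else 0)"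
proof -
  obtain N where N: "\<forall>i\<ge>N. \<kappa> i = 0"
    using partition_bound[OF \<kappa>] by auto
  show ?thesis
  proof (cases "lam = \<kappa>")
    case True
    then show ?thesis
      unfolding True conv_hker_vker[OF \<kappa> \<kappa> order_refl N] hv_row_factor[OF \<kappa> \<kappa> order_refl]
      by simp
  next
    case False
    note D = differing_row[OF False N le]
    define i where "i = (LEAST i. lam i \<noteq> \<kappa> i)"
    have i: "lam i \<noteq> \<kappa> i" using D(1) unfolding i_def by (metis (mono_tags) LeastI empty_Collect_eq)
    have min: "lam j = \<kappa> j" if "j < i" for j
      using not_less_Least[of j "\<lambda>i. lam i \<noteq> \<kappa> i"] that by (auto simp: i_def)
    have "\<kappa> i \<le> prev_row lam (\<kappa> 0) i"
      using min partition_antimono[OF \<kappa>] by (auto simp: prev_row_def split: nat.split)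
    then show ?thesis
      using D(2) i False
      unfolding conv_hker_vker[OF lam \<kappa> le N] hv_row_factor[OF lam \<kappa> le]
      by (auto intro!: prod_zero bexI[of _ i])
  qed
qed

text \<open>
  In the last row in which the partitions differ, no cell lies below the first cell, and the
  two choices for it cancel.
\<close>

lemma vh_inverse:
  fixes b :: "'a::comm_ring_1"
  assumes lam: "is_partition lam" and \<kappa>: "is_partition \<kappa>" and le: "lam \<le> \<kappa>"
  shows "conv (vker (- b)) (hker b) lam \<kappa> = (if lam = \<kappa> then 1 else 0)"
proof -
  obtain N where N: "\<forall>i\<ge>N. \<kappa> i = 0"
    using partition_bound[OF \<kappa>] by auto
  show ?thesis
  proof (cases "lam = \<kappa>")
    case True
    have "{max (\<kappa> i) (\<kappa> (Suc i))..min (\<kappa> i) (Suc (\<kappa> i))} = {\<kappa> i}" for i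
      using partition_antimono[OF \<kappa>, of i "Suc i"] by auto
    then show ?thesis
      using True by (simp add: conv_vker_hker[OF \<kappa> \<kappa> order_refl N])
  next
    case False
    note D = differing_row[OF False N le]
    define i where "i = Max {i. lam i \<noteq> \<kappa> i}"
    have fin: "finite {i. lam i \<noteq> \<kappa> i}" using finite_subset[OF D(2)] by simp
    have i: "lam i \<noteq> \<kappa> i" using Max_in[OF fin D(1)] by (simp add: i_def)
    have "lam (Suc i) = \<kappa> (Suc i)"
      using Max_ge[OF fin, of "Suc i"] by (auto simp: i_def)
    then have "\<kappa> (Suc i) \<le> lam i" using partition_antimono[OF lam, of i "Suc i"] by simp
    moreover obtain m where m: "\<kappa> i = Suc m" "lam i \<le> m"
      using i le_funD[OF le, of i] by (cases "\<kappa> i") auto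
    ultimately have "{max (lam i) (\<kappa> (Suc i))..min (\<kappa> i) (Suc (lam i))} = {lam i, Suc (lam i)}"
      by auto
    then have "(\<Sum>v\<in>{max (lam i) (\<kappa> (Suc i))..min (\<kappa> i) (Suc (lam i))}.
       (- b) ^ (v - lam i) * b ^ (\<kappa> i - v)) = 0"
      using m by (simp add: Suc_diff_le)
    moreover have "i < N" using D(2) i by auto
    ultimately show ?thesis
      using False by (subst conv_vker_hker[OF lam \<kappa> le N]) (auto intro!: prod_zero)
  qed
qed

section \<open>Components of broken ribbons\<close>

text \<open>
  A cell of a broken ribbon cannot have both an upper and a right neighbour, since these two
  would complete a block.  So every component is a path that goes up or to the right in each
  step, and it is determined by the cell in which it ends, its head.
\<close>

definition steps :: "cell set \<Rightarrow> (cell \<times> cell) set" where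
  "steps C = {(c, d). c \<in> C \<and> d \<in> C \<and>
     (fst c = Suc (fst d) \<and> snd c = snd d \<or> fst c = fst d \<and> snd d = Suc (snd c))}"

definition has_above :: "cell set \<Rightarrow> cell \<Rightarrow> bool" where
  "has_above C c \<longleftrightarrow> (\<exists>i. fst c = Suc i \<and> (i, snd c) \<in> C)"

definition has_right :: "cell set \<Rightarrow> cell \<Rightarrow> bool" where
  "has_right C c \<longleftrightarrow> (fst c, Suc (snd c)) \<in> C"

definition heads :: "cell set \<Rightarrow> cell set" where
  "heads C = {c \<in> C. \<not> has_above C c \<and> \<not> has_right C c}"

locale ribbon_cells =
  fixes C :: "cell set"
  assumes finite_C: "finite C"
    and row_convex: "(i, j) \<in> C \<Longrightarrow> (i, l) \<in> C \<Longrightarrow> j \<le> k \<Longrightarrow> k \<le> l \<Longrightarrow> (i, k) \<in> C"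
    and col_convex: "(i, j) \<in> C \<Longrightarrow> (l, j) \<in> C \<Longrightarrow> i \<le> k \<Longrightarrow> k \<le> l \<Longrightarrow> (k, j) \<in> C"
    and not_above_and_right: "c \<in> C \<Longrightarrow> has_above C c \<Longrightarrow> has_right C c \<Longrightarrow> False"
begin

lemma single_valued_steps: "single_valued (steps C)"
proof (rule single_valuedI)
  fix c d e assume "(c, d) \<in> steps C" "(c, e) \<in> steps C"
  then show "d = e"
    using not_above_and_right[of c]
    by (cases c; cases d; cases e) (auto simp: steps_def has_above_def has_right_def)
qed

lemma no_step_iff: "c \<in> C \<Longrightarrow> (\<nexists>d. (c, d) \<in> steps C) \<longleftrightarrow> c \<in> heads C"
  by (cases c) (auto simp: steps_def heads_def has_above_def has_right_def)

text \<open>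
  Every step moves closer to the top right corner of a box that contains \<open>C\<close>.
\<close>

lemma head_exists:
  assumes "c \<in> C"
  shows "\<exists>h\<in>heads C. (c, h) \<in> (steps C)\<^sup>*"
proof -
  obtain M where M: "snd ` C \<subseteq> {..<M}"
    using finite_C by (meson finite_imageI finite_nat_iff_bounded)
  show ?thesis
    using assms
  proof (induction "fst c + (M - snd c)" arbitrary: c rule: less_induct)
    case less
    show ?case
    proof (cases "c \<in> heads C")
      case False
      then obtain d where d: "(c, d) \<in> steps C"
        using no_step_iff[OF less.prems] by blast
      then have "d \<in> C" by (simp add: steps_def)
      moreover have "snd c < M" using less.prems M by auto
      ultimately obtain h where "h \<in> heads C" "(d, h) \<in> (steps C)\<^sup>*"
        using less.hyps[of d] d by (fastforce simp: steps_def)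
      then show ?thesis using d by (meson converse_rtrancl_into_rtrancl)
    qed auto
  qed
qed

lemma head_unique:
  assumes "(c, g) \<in> (steps C)\<^sup>*" "(c, h) \<in> (steps C)\<^sup>*" "g \<in> heads C" "h \<in> heads C"
  shows "g = h"
proof -
  have stuck: "x = y" if "(x, y) \<in> (steps C)\<^sup>*" "x \<in> heads C" for x y
    using that
  proof (cases rule: converse_rtranclE)
    case (step z)
    moreover have "x \<in> C" using that(2) by (simp add: heads_def)
    ultimately show ?thesis
      using no_step_iff that(2) by blast
  qed
  from single_valued_confluent[OF single_valued_steps assms(1,2)] show ?thesis
    using stuck assms(3,4) by blast
qed

definition head_of :: "cell \<Rightarrow> cell" where
  "head_of c = (THE h. h \<in> heads C \<and> (c, h) \<in> (steps C)\<^sup>*)"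

lemma head_of:
  assumes "c \<in> C"
  shows "head_of c \<in> heads C" "(c, head_of c) \<in> (steps C)\<^sup>*"
proof -
  have "\<exists>!h. h \<in> heads C \<and> (c, h) \<in> (steps C)\<^sup>*"
    using head_exists[OF assms] head_unique by blast
  from theI'[OF this] show "head_of c \<in> heads C" "(c, head_of c) \<in> (steps C)\<^sup>*"
    unfolding head_of_def by auto
qed

lemma head_of_eqI: "h \<in> heads C \<Longrightarrow> (c, h) \<in> (steps C)\<^sup>* \<Longrightarrow> head_of c = h"
  unfolding head_of_def using head_unique by blast

lemma head_of_step: "(c, d) \<in> steps C \<Longrightarrow> head_of c = head_of d"
proof -
  assume s: "(c, d) \<in> steps C"
  then have "d \<in> C" by (simp add: steps_def)
  then show ?thesis
    using head_of[of d] s by (intro head_of_eqI) (auto intro: converse_rtrancl_into_rtrancl)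
qed

lemma adjacent_eq_steps: "{(a, b). a \<in> C \<and> b \<in> C \<and> adjacent a b} = steps C \<union> (steps C)\<inverse>"
  by (auto simp: steps_def)

text \<open>
  A step does not change the head, and every cell is linked to its head.
\<close>

lemma linked_iff: "(c, d) \<in> linked C \<longleftrightarrow> c \<in> C \<and> d \<in> C \<and> head_of c = head_of d"
proof -
  have "head_of c = head_of d" if "(c, d) \<in> (steps C \<union> (steps C)\<inverse>)\<^sup>*"
    using that by induction (auto dest: head_of_step)
  moreover have "(c, d) \<in> (steps C \<union> (steps C)\<inverse>)\<^sup>*"
    if "c \<in> C" "d \<in> C" "head_of c = head_of d"
  proof -
    have "(c, head_of c) \<in> (steps C \<union> (steps C)\<inverse>)\<^sup>*"
      using head_of(2)[OF that(1)] by (metis in_rtrancl_UnI)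
    moreover have "(head_of d, d) \<in> (steps C \<union> (steps C)\<inverse>)\<^sup>*"
      using rtrancl_converseI[OF head_of(2)[OF that(2)]] by (metis in_rtrancl_UnI)
    ultimately show ?thesis using that(3) by simp
  qed
  ultimately show ?thesis
    unfolding linked_def adjacent_eq_steps by auto
qed

lemma components_eq: "components C = (\<lambda>h. {c \<in> C. head_of c = h}) ` heads C"
proof -
  have *: "linked C `` {c} = {d \<in> C. head_of d = head_of c}" if "c \<in> C" for c
    using that by (auto simp: linked_iff)
  have heads: "head_of h = h" "h \<in> C" if "h \<in> heads C" for h
    using that by (auto intro: head_of_eqI simp: heads_def)
  show ?thesis
    unfolding components_def quotient_def
    using * heads head_of(1) by (fastforce simp: image_iff)
qed

lemma inj_on_components: "inj_on (\<lambda>h. {c \<in> C. head_of c = h}) (heads C)"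
proof (rule inj_onI)
  fix g h assume g: "g \<in> heads C" and eq: "{c \<in> C. head_of c = g} = {c \<in> C. head_of c = h}"
  have "head_of g = g" by (rule head_of_eqI[OF g]) simp
  moreover have "g \<in> C" using g by (simp add: heads_def)
  ultimately have "g \<in> {c \<in> C. head_of c = h}" unfolding eq[symmetric] by simp
  then show "g = h" using \<open>head_of g = g\<close> by simp
qed

lemma rib_eq: "rib C = card (heads C)"
  by (simp add: rib_def components_eq card_image[OF inj_on_components])

lemma finite_heads: "finite (heads C)"
  using finite_C by (simp add: heads_def)

lemma card_by_head:
  assumes "A \<subseteq> C"
  shows "card A = (\<Sum>h\<in>heads C. card {c \<in> A. head_of c = h})"
proof -
  have fin: "finite A" using assms finite_C finite_subset by blast
  have "card A = (\<Sum>c\<in>A. 1)" by simp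
  also have "\<dots> = (\<Sum>h\<in>heads C. \<Sum>c\<in>{c \<in> A. head_of c = h}. 1)"
    by (rule sum.group[symmetric]) (use fin finite_heads assms head_of(1) in auto)
  finally show ?thesis by simp
qed

text \<open>
  In each row of a component exactly one cell, the last, has no right neighbour.  One of these
  cells is the head, and the others are the cells with an upper neighbour.
\<close>

lemma ht_eq: "ht C = card {c \<in> C. has_above C c}"
proof -
  have "card (fst ` {c \<in> C. head_of c = h}) - 1 = card {c \<in> {c \<in> C. has_above C c}. head_of c = h}"
    if h: "h \<in> heads C" for h
  proof -
    let ?K = "{c \<in> C. head_of c = h}"
    let ?E = "{c \<in> ?K. \<not> has_right C c}"
    have fin: "finite ?K" using finite_C by simp
    have inj: "inj_on fst ?E"
    proof (rule inj_onI)
      fix c d assume cd: "c \<in> ?E" "d \<in> ?E" "fst c = fst d"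
      have False if "x \<in> ?E" "y \<in> ?E" "fst x = fst y" "snd x < snd y" for x y
        using that row_convex[of "fst x" "snd x" "snd y" "Suc (snd x)"]
        by (cases x; cases y) (auto simp: has_right_def)
      from this[OF cd] this[OF cd(2,1)] cd(3) show "c = d"
        by (metis linorder_neqE_nat prod_eqI)
    qed
    have im: "fst ` ?E = fst ` ?K"
    proof
      show "fst ` ?K \<subseteq> fst ` ?E"
      proof
        fix i assume "i \<in> fst ` ?K"
        then obtain j0 where j0: "(i, j0) \<in> ?K" by auto
        define J where "J = {j. (i, j) \<in> ?K}"
        have "J \<subseteq> snd ` ?K" by (force simp: J_def)
        then have finJ: "finite J" using fin finite_subset by blast
        have "J \<noteq> {}" using j0 by (auto simp: J_def)
        then have m: "(i, Max J) \<in> ?K" using Max_in[OF finJ] by (auto simp: J_def)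
        have "\<not> has_right C (i, Max J)"
        proof
          assume r: "has_right C (i, Max J)"
          then have "((i, Max J), (i, Suc (Max J))) \<in> steps C"
            using m by (auto simp: has_right_def steps_def)
          then have "Suc (Max J) \<in> J"
            using head_of_step m r by (auto simp: J_def has_right_def)
          then show False using Max_ge[OF finJ, of "Suc (Max J)"] by simp
        qed
        then show "i \<in> fst ` ?E" using m by force
      qed
    qed auto
    have "card (fst ` ?K) = card ?E"
      by (simp only: im[symmetric] card_image[OF inj])
    also have "?E = insert h {c \<in> {c \<in> C. has_above C c}. head_of c = h}"
    proof -
      have "c = h" if "c \<in> ?E" "\<not> has_above C c" for c
      proof -
        have "c \<in> heads C" using that by (auto simp: heads_def)
        then have "head_of c = c" by (auto intro: head_of_eqI)
        then show ?thesis using that by auto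
      qed
      then show ?thesis
        using h not_above_and_right head_of_eqI[OF h, of h] by (auto simp: heads_def)
    qed
    also have "card \<dots> = Suc (card {c \<in> {c \<in> C. has_above C c}. head_of c = h})"
      using h finite_C by (subst card_insert_disjoint) (auto simp: heads_def)
    finally show ?thesis by simp
  qed
  then show ?thesis
    unfolding ht_def components_eq
    by (subst sum.reindex[OF inj_on_components]) (simp add: card_by_head[of "{c \<in> C. has_above C c}"])
qed

text \<open>
  In each column of a component exactly one cell, the first, has no upper neighbour.  One of
  these cells is the head, and the others are the cells with a right neighbour.
\<close>

lemma wt_eq: "wt C = card {c \<in> C. has_right C c}"
proof -
  have "card (snd ` {c \<in> C. head_of c = h}) - 1 = card {c \<in> {c \<in> C. has_right C c}. head_of c = h}"
    if h: "h \<in> heads C" for h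
  proof -
    let ?K = "{c \<in> C. head_of c = h}"
    let ?E = "{c \<in> ?K. \<not> has_above C c}"
    have fin: "finite ?K" using finite_C by simp
    have inj: "inj_on snd ?E"
    proof (rule inj_onI)
      fix c d assume cd: "c \<in> ?E" "d \<in> ?E" "snd c = snd d"
      have False if "x \<in> ?E" "y \<in> ?E" "snd x = snd y" "fst x < fst y" for x y
        using that col_convex[of "fst x" "snd x" "fst y" "fst y - 1"]
        by (cases x; cases y; cases "fst y") (auto simp: has_above_def)
      from this[OF cd] this[OF cd(2,1)] cd(3) show "c = d"
        by (metis linorder_neqE_nat prod_eqI)
    qed
    have im: "snd ` ?E = snd ` ?K"
    proof
      show "snd ` ?K \<subseteq> snd ` ?E"
      proof
        fix j assume "j \<in> snd ` ?K"
        then obtain i0 where i0: "(i0, j) \<in> ?K" by auto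
        define m where "m = (LEAST i. (i, j) \<in> ?K)"
        have m: "(m, j) \<in> ?K" unfolding m_def using i0 by (rule LeastI)
        have "\<not> has_above C (m, j)"
        proof
          assume r: "has_above C (m, j)"
          then obtain i where i: "m = Suc i" "(i, j) \<in> C" by (auto simp: has_above_def)
          then have "((m, j), (i, j)) \<in> steps C"
            using m by (auto simp: steps_def)
          then have "(i, j) \<in> ?K"
            using head_of_step m i by auto
          then show False using not_less_Least[of i "\<lambda>i. (i, j) \<in> ?K"] i by (auto simp: m_def)
        qed
        then show "j \<in> snd ` ?E" using m by force
      qed
    qed auto
    have "card (snd ` ?K) = card ?E"
      by (simp only: im[symmetric] card_image[OF inj])
    also have "?E = insert h {c \<in> {c \<in> C. has_right C c}. head_of c = h}"
    proof -
      have "c = h" if "c \<in> ?E" "\<not> has_right C c" for c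
      proof -
        have "c \<in> heads C" using that by (auto simp: heads_def)
        then have "head_of c = c" by (auto intro: head_of_eqI)
        then show ?thesis using that by auto
      qed
      then show ?thesis
        using h not_above_and_right head_of_eqI[OF h, of h] by (auto simp: heads_def)
    qed
    also have "card \<dots> = Suc (card {c \<in> {c \<in> C. has_right C c}. head_of c = h})"
      using h finite_C by (subst card_insert_disjoint) (auto simp: heads_def)
    finally show ?thesis by simp
  qed
  then show ?thesis
    unfolding wt_def components_eq
    by (subst sum.reindex[OF inj_on_components]) (simp add: card_by_head[of "{c \<in> C. has_right C c}"])
qed

end

section \<open>The weight of a broken ribbon\<close>

text \<open>
  Rows \<open>i\<close> and \<open>Suc i\<close> of the shape overlap in the columns from \<open>lam i\<close> to \<open>\<kappa> (Suc i) - 1\<close>.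
\<close>

lemma has_block_diagram:
  assumes "is_partition lam" "is_partition \<kappa>"
  shows "has_block (diagram \<kappa> lam) \<longleftrightarrow> (\<exists>i. Suc (lam i) < \<kappa> (Suc i))"
proof
  assume "has_block (diagram \<kappa> lam)"
  then obtain i j where "(i, j) \<in> diagram \<kappa> lam" "(Suc i, Suc j) \<in> diagram \<kappa> lam"
    by (auto simp: has_block_def)
  then have "Suc (lam i) < \<kappa> (Suc i)" by (simp add: diagram_def)
  then show "\<exists>i. Suc (lam i) < \<kappa> (Suc i)" ..
next
  assume "\<exists>i. Suc (lam i) < \<kappa> (Suc i)"
  then obtain i where i: "Suc (lam i) < \<kappa> (Suc i)" ..
  have "lam (Suc i) \<le> lam i" "\<kappa> (Suc i) \<le> \<kappa> i"
    using assms by (auto intro: partition_antimono)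
  then have "{(i, lam i), (i, Suc (lam i)), (Suc i, lam i), (Suc i, Suc (lam i))} \<subseteq> diagram \<kappa> lam"
    using i by (auto simp: diagram_def)
  then show "has_block (diagram \<kappa> lam)" unfolding has_block_def by blast
qed

lemma broken_ribbon_diagram:
  assumes "is_partition lam" "is_partition \<kappa>" "lam \<le> \<kappa>"
  shows "broken_ribbon (diagram \<kappa> lam) \<longleftrightarrow> (\<forall>i. \<kappa> (Suc i) \<le> Suc (lam i))"
  using assms has_block_diagram[OF assms(1,2)] unfolding broken_ribbon_def
  by (metis not_le)

lemma ribbon_cells_diagram:
  assumes lam: "is_partition lam" and \<kappa>: "is_partition \<kappa>"
    and nb: "\<And>i. \<kappa> (Suc i) \<le> Suc (lam i)"
  shows "ribbon_cells (diagram \<kappa> lam)"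
proof
  show "finite (diagram \<kappa> lam)" by (rule finite_diagram[OF \<kappa>])
  show "(i, k) \<in> diagram \<kappa> lam"
    if "(i, j) \<in> diagram \<kappa> lam" "(i, l) \<in> diagram \<kappa> lam" "j \<le> k" "k \<le> l" for i j k l
    using that by (auto simp: diagram_def)
  show "(k, j) \<in> diagram \<kappa> lam"
    if "(i, j) \<in> diagram \<kappa> lam" "(l, j) \<in> diagram \<kappa> lam" "i \<le> k" "k \<le> l" for i j k l
    using that partition_antimono[OF lam that(3)] partition_antimono[OF \<kappa> that(4)]
    by (auto simp: diagram_def)
  show False if c: "c \<in> diagram \<kappa> lam" "has_above (diagram \<kappa> lam) c" "has_right (diagram \<kappa> lam) c" for c
  proof -
    obtain i where "fst c = Suc i" "lam i \<le> snd c" "Suc (snd c) < \<kappa> (Suc i)"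
      using c by (cases c) (auto simp: has_above_def has_right_def diagram_def)
    then show False using nb[of i] by simp
  qed
qed

context
  fixes lam \<kappa> :: "nat \<Rightarrow> nat" and N :: nat
  assumes lam: "is_partition lam" and \<kappa>: "is_partition \<kappa>"
    and nb: "\<And>i. \<kappa> (Suc i) \<le> Suc (lam i)" and N: "\<forall>i\<ge>N. \<kappa> i = 0"
begin

interpretation ribbon_cells "diagram \<kappa> lam"
  by (rule ribbon_cells_diagram[OF lam \<kappa> nb])

lemma has_above_diagram:
  assumes "(i, j) \<in> diagram \<kappa> lam"
  shows "has_above (diagram \<kappa> lam) (i, j) \<longleftrightarrow> prev_row lam (\<kappa> 0) i \<le> j"
proof (cases i)
  case (Suc k)
  then show ?thesis
    using assms partition_antimono[OF \<kappa>, of k i] by (auto simp: has_above_def diagram_def prev_row_def)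
qed (use assms in \<open>auto simp: has_above_def diagram_def prev_row_def\<close>)

lemma has_right_diagram:
  assumes "(i, j) \<in> diagram \<kappa> lam"
  shows "has_right (diagram \<kappa> lam) (i, j) \<longleftrightarrow> Suc j < \<kappa> i"
  using assms by (auto simp: has_right_def diagram_def)

lemma row_bound: "i < N" if "j < \<kappa> i" for i j
  using N that by (cases "i < N") auto

lemma near_prev_row: "\<kappa> i \<le> Suc (prev_row lam (\<kappa> 0) i)"
  using nb by (auto simp: prev_row_def split: nat.split)

text \<open>
  Both the head of a component and a cell with an upper neighbour can only be the last cell of
  a row, so that heads and such cells are counted by rows.
\<close>

lemma rib_diagram:
  "rib (diagram \<kappa> lam) = card {i\<in>{..<N}. lam i < \<kappa> i \<and> \<kappa> i \<le> prev_row lam (\<kappa> 0) i}"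
proof -
  have "heads (diagram \<kappa> lam) =
    (\<lambda>i. (i, \<kappa> i - 1)) ` {i\<in>{..<N}. lam i < \<kappa> i \<and> \<kappa> i \<le> prev_row lam (\<kappa> 0) i}" (is "_ = ?R")
  proof
    show "heads (diagram \<kappa> lam) \<subseteq> ?R"
    proof
      fix c assume c: "c \<in> heads (diagram \<kappa> lam)"
      obtain i j where ij: "c = (i, j)" by force
      have m: "(i, j) \<in> diagram \<kappa> lam" using c ij by (simp add: heads_def)
      have "\<not> prev_row lam (\<kappa> 0) i \<le> j" "\<not> Suc j < \<kappa> i"
        using c ij has_above_diagram[OF m] has_right_diagram[OF m] by (auto simp: heads_def)
      moreover have "lam i \<le> j" "j < \<kappa> i" using m by (auto simp: diagram_def)
      ultimately have "j = \<kappa> i - 1" "lam i < \<kappa> i" "\<kappa> i \<le> prev_row lam (\<kappa> 0) i" "i < N"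
        by (auto intro: row_bound)
      then show "c \<in> ?R" using ij by auto
    qed
    show "?R \<subseteq> heads (diagram \<kappa> lam)"
    proof
      fix c assume "c \<in> ?R"
      then obtain i where i: "c = (i, \<kappa> i - 1)" "lam i < \<kappa> i" "\<kappa> i \<le> prev_row lam (\<kappa> 0) i"
        by auto
      then have m: "(i, \<kappa> i - 1) \<in> diagram \<kappa> lam" by (auto simp: diagram_def)
      then show "c \<in> heads (diagram \<kappa> lam)"
        using i has_above_diagram[OF m] has_right_diagram[OF m] by (auto simp: heads_def)
    qed
  qed
  then show ?thesis
    by (simp add: rib_eq card_image inj_on_def)
qed

lemma ht_diagram:
  "ht (diagram \<kappa> lam) = card {i\<in>{..<N}. lam i < \<kappa> i \<and> prev_row lam (\<kappa> 0) i < \<kappa> i}"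
proof -
  have "{c \<in> diagram \<kappa> lam. has_above (diagram \<kappa> lam) c} =
    (\<lambda>i. (i, \<kappa> i - 1)) ` {i\<in>{..<N}. lam i < \<kappa> i \<and> prev_row lam (\<kappa> 0) i < \<kappa> i}" (is "?L = ?R")
  proof
    show "?L \<subseteq> ?R"
    proof
      fix c assume c: "c \<in> ?L"
      obtain i j where ij: "c = (i, j)" by force
      have m: "(i, j) \<in> diagram \<kappa> lam" using c ij by simp
      have "prev_row lam (\<kappa> 0) i \<le> j"
        using c ij has_above_diagram[OF m] by auto
      moreover have "lam i \<le> j" "j < \<kappa> i" using m by (auto simp: diagram_def)
      ultimately have "j = \<kappa> i - 1" "lam i < \<kappa> i" "prev_row lam (\<kappa> 0) i < \<kappa> i" "i < N"
        using near_prev_row[of i] by (auto intro: row_bound)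
      then show "c \<in> ?R" using ij by auto
    qed
    show "?R \<subseteq> ?L"
    proof
      fix c assume "c \<in> ?R"
      then obtain i where i: "c = (i, \<kappa> i - 1)" "lam i < \<kappa> i" "prev_row lam (\<kappa> 0) i < \<kappa> i"
        by auto
      then have m: "(i, \<kappa> i - 1) \<in> diagram \<kappa> lam" by (auto simp: diagram_def)
      then show "c \<in> ?L"
        using i has_above_diagram[OF m] by auto
    qed
  qed
  then show ?thesis
    by (simp add: ht_eq card_image inj_on_def)
qed

lemma wt_diagram: "wt (diagram \<kappa> lam) = (\<Sum>i<N. \<kappa> i - lam i - 1)"
proof -
  have "{c \<in> diagram \<kappa> lam. has_right (diagram \<kappa> lam) c} = (SIGMA i:{..<N}. {lam i..<\<kappa> i - 1})"
    using row_bound by (auto simp: has_right_def diagram_def)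
  then show ?thesis
    by (simp add: wt_eq diff_commute diff_right_commute)
qed

end

lemma power_card_filter:
  fixes c :: "'a::comm_ring_1"
  assumes "finite A"
  shows "c ^ card {i \<in> A. P i} = (\<Prod>i\<in>A. if P i then c else 1)"
  using assms by (simp add: prod.If_cases Int_def)

text \<open>
  Multiplying out the row factors, the top row of each component contributes \<open>a + b\<close>, each
  of its other rows contributes \<open>a\<close>, and each cell that is not the last one of its row
  contributes \<open>b\<close>.
\<close>

lemma ribbon_weight:
  fixes a b :: "'a::comm_ring_1"
  assumes lam: "is_partition lam" and \<kappa>: "is_partition \<kappa>" and le: "lam \<le> \<kappa>"
  shows "conv (hker b) (vker a) lam \<kappa> =
    (if broken_ribbon (diagram \<kappa> lam)
     then a ^ ht (diagram \<kappa> lam) * b ^ wt (diagram \<kappa> lam) * (a + b) ^ rib (diagram \<kappa> lam)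
     else 0)"
proof -
  obtain N where N: "\<forall>i\<ge>N. \<kappa> i = 0"
    using partition_bound[OF \<kappa>] by auto
  let ?p = "prev_row lam (\<kappa> 0)"
  define fac where "fac i = (if \<kappa> i = lam i then 1
     else if \<kappa> i \<le> ?p i then (a + b) * b ^ (\<kappa> i - lam i - 1)
     else if \<kappa> i = Suc (?p i) then a * b ^ (\<kappa> i - lam i - 1)
     else 0)" for i
  have conv: "conv (hker b) (vker a) lam \<kappa> = (\<Prod>i<N. fac i)"
    unfolding conv_hker_vker[OF lam \<kappa> le N] hv_row_factor[OF lam \<kappa> le] fac_def ..
  show ?thesis
  proof (cases "broken_ribbon (diagram \<kappa> lam)")
    case True
    then have nb: "\<kappa> (Suc i) \<le> Suc (lam i)" for i
      by (simp add: broken_ribbon_diagram[OF lam \<kappa> le])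
    have "fac i = (if lam i < \<kappa> i \<and> ?p i < \<kappa> i then a else 1) * b ^ (\<kappa> i - lam i - 1) *
       (if lam i < \<kappa> i \<and> \<kappa> i \<le> ?p i then a + b else 1)" for i
      using near_prev_row[OF lam \<kappa> nb N, of i] le_funD[OF le, of i]
      by (auto simp: fac_def)
    then have "(\<Prod>i<N. fac i) = a ^ ht (diagram \<kappa> lam) * b ^ wt (diagram \<kappa> lam) * (a + b) ^ rib (diagram \<kappa> lam)"
      by (simp add: ht_diagram[OF lam \<kappa> nb N] wt_diagram[OF lam \<kappa> nb N] rib_diagram[OF lam \<kappa> nb N]
          prod.distrib power_sum power_card_filter[of "{..<N}", simplified])
    then show ?thesis using True conv by simp
  next
    case False
    then obtain i where i: "Suc (lam i) < \<kappa> (Suc i)"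
      by (auto simp: broken_ribbon_diagram[OF lam \<kappa> le] not_le)
    moreover have "lam (Suc i) \<le> lam i" using partition_antimono[OF lam] by simp
    ultimately have "fac (Suc i) = 0" by (simp add: fac_def prev_row_def)
    moreover have "Suc i < N" using i N by (cases "Suc i < N") auto
    ultimately show ?thesis using False conv by (auto intro: prod_zero)
  qed
qed

section \<open>Adding and removing strips as operators\<close>

text \<open>
  The sum of \<open>k lam \<nu> * t ^ s * f \<nu>\<close> over all partitions \<open>\<nu> \<ge> lam\<close>, where \<open>s\<close> is the size of
  \<open>\<nu>/lam\<close>.  It is infinite, but each power of \<open>t\<close> receives finitely many contributions, so it is
  given by its coefficients.
\<close>

definition act :: "((nat \<Rightarrow> nat) \<Rightarrow> (nat \<Rightarrow> nat) \<Rightarrow> 'a::comm_ring_1) \<Rightarrow>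
    ((nat \<Rightarrow> nat) \<Rightarrow> 'a fps) \<Rightarrow> (nat \<Rightarrow> nat) \<Rightarrow> 'a fps" where
  "act k f lam = Abs_fps (\<lambda>n. \<Sum>\<nu>\<in>parts_above lam n.
     k lam \<nu> * fps_nth (f \<nu>) (psize lam + n - psize \<nu>))"

text \<open>
  The branching rule of Schur functions: the cells filled with the entry of the variable \<open>x\<close>
  form a horizontal strip at the outer rim.
\<close>

definition add_var :: "'a::comm_ring_1 \<Rightarrow> ((nat \<Rightarrow> nat) \<Rightarrow> 'a fps) \<Rightarrow> (nat \<Rightarrow> nat) \<Rightarrow> 'a fps" where
  "add_var x f lam = (\<Sum>\<rho>\<in>{\<rho> \<in> parts_below lam. hstrip \<rho> lam}.
     fps_const (x ^ (psize lam - psize \<rho>)) * f \<rho>)"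

lemma parts_above_iff:
  "\<nu> \<in> parts_above lam n \<longleftrightarrow>
   is_partition \<nu> \<and> lam \<le> \<nu> \<and> psize lam \<le> psize \<nu> \<and> psize \<nu> \<le> psize lam + n"
  using psize_mono by (auto simp: parts_above_def)

lemma parts_between_iff:
  "is_partition \<kappa> \<Longrightarrow> \<nu> \<in> parts_between lam \<kappa> \<longleftrightarrow>
   is_partition \<nu> \<and> lam \<le> \<nu> \<and> \<nu> \<le> \<kappa> \<and> psize lam \<le> psize \<nu> \<and> psize \<nu> \<le> psize \<kappa>"
  using psize_mono by (auto simp: parts_between_def)

lemma act_cong:
  assumes "\<And>\<nu>. is_partition \<nu> \<Longrightarrow> f \<nu> = g \<nu>"
    and "\<And>\<nu>. is_partition \<nu> \<Longrightarrow> lam \<le> \<nu> \<Longrightarrow> k lam \<nu> = l lam \<nu>"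
  shows "act k f lam = act l g lam"
  unfolding act_def using assms
  by (intro arg_cong[where f = Abs_fps] ext sum.cong) (auto simp: parts_above_def)

lemma add_var_cong:
  assumes "\<And>\<nu>. is_partition \<nu> \<Longrightarrow> f \<nu> = g \<nu>"
  shows "add_var x f lam = add_var x g lam"
  unfolding add_var_def using assms by (intro sum.cong) (auto simp: parts_below_def)

lemma add_var_mult: "add_var x (\<lambda>\<nu>. c * f \<nu>) lam = c * add_var x f lam"
  by (simp add: add_var_def sum_distrib_left algebra_simps)

lemma act_mult: "act k (\<lambda>\<nu>. c * f \<nu>) lam = c * act k f lam"
proof (rule fps_ext)
  fix n
  have "fps_nth (act k (\<lambda>\<nu>. c * f \<nu>) lam) n =
    (\<Sum>\<nu>\<in>parts_above lam n. \<Sum>i\<in>{0..psize lam + n - psize \<nu>}.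
       fps_nth c i * (k lam \<nu> * fps_nth (f \<nu>) (psize lam + n - psize \<nu> - i)))"
    by (simp add: act_def fps_mult_nth sum_distrib_left algebra_simps)
  also have "\<dots> = (\<Sum>(\<nu>, i)\<in>(SIGMA \<nu>:parts_above lam n. {0..psize lam + n - psize \<nu>}).
       fps_nth c i * (k lam \<nu> * fps_nth (f \<nu>) (psize lam + n - psize \<nu> - i)))"
    by (rule sum.Sigma) (auto simp: finite_parts_above)
  also have "\<dots> = (\<Sum>(i, \<nu>)\<in>(SIGMA i:{0..n}. parts_above lam (n - i)).
       fps_nth c i * (k lam \<nu> * fps_nth (f \<nu>) (psize lam + (n - i) - psize \<nu>)))"
  proof (rule sum.reindex_bij_witness[where i = prod.swap and j = prod.swap], goal_cases)
    case (5 p)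
    obtain \<nu> i where p: "p = (\<nu>, i)" by force
    have "psize lam + (n - i) - psize \<nu> = psize lam + n - psize \<nu> - i"
      using 5 by (auto simp: p parts_above_iff)
    then show ?case by (simp add: p)
  qed (auto simp: parts_above_iff)
  also have "\<dots> = (\<Sum>i\<in>{0..n}. \<Sum>\<nu>\<in>parts_above lam (n - i).
       fps_nth c i * (k lam \<nu> * fps_nth (f \<nu>) (psize lam + (n - i) - psize \<nu>)))"
    by (rule sum.Sigma[symmetric]) (auto simp: finite_parts_above)
  also have "\<dots> = fps_nth (c * act k f lam) n"
    by (simp add: act_def fps_mult_nth sum_distrib_left)
  finally show "fps_nth (act k (\<lambda>\<nu>. c * f \<nu>) lam) n = fps_nth (c * act k f lam) n" .
qed

lemma act_act: "act k (act l f) lam = act (conv k l) f lam"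
proof (rule fps_ext)
  fix n
  let ?t = "\<lambda>\<nu> \<kappa>. k lam \<nu> * (l \<nu> \<kappa> * fps_nth (f \<kappa>) (psize lam + n - psize \<kappa>))"
  have "fps_nth (act k (act l f) lam) n =
    (\<Sum>\<nu>\<in>parts_above lam n. \<Sum>\<kappa>\<in>parts_above \<nu> (psize lam + n - psize \<nu>). ?t \<nu> \<kappa>)"
    by (auto simp: act_def sum_distrib_left parts_above_def intro!: sum.cong)
  also have "\<dots> = (\<Sum>(\<nu>, \<kappa>)\<in>(SIGMA \<nu>:parts_above lam n. parts_above \<nu> (psize lam + n - psize \<nu>)). ?t \<nu> \<kappa>)"
    by (rule sum.Sigma) (auto simp: finite_parts_above)
  also have "\<dots> = (\<Sum>(\<kappa>, \<nu>)\<in>(SIGMA \<kappa>:parts_above lam n. parts_between lam \<kappa>). ?t \<nu> \<kappa>)"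
    by (rule sum.reindex_bij_witness[where i = prod.swap and j = prod.swap])
      (auto simp: parts_above_iff parts_between_iff intro: order_trans)
  also have "\<dots> = (\<Sum>\<kappa>\<in>parts_above lam n. \<Sum>\<nu>\<in>parts_between lam \<kappa>. ?t \<nu> \<kappa>)"
    by (rule sum.Sigma[symmetric])
      (auto simp: finite_parts_above parts_above_iff intro: finite_parts_between)
  also have "\<dots> = fps_nth (act (conv k l) f lam) n"
    by (simp add: act_def conv_def sum_distrib_right mult.assoc)
  finally show "fps_nth (act k (act l f) lam) n = fps_nth (act (conv k l) f lam) n" .
qed

lemma act_identity:
  assumes "is_partition lam"
    and "\<And>\<nu>. is_partition \<nu> \<Longrightarrow> lam \<le> \<nu> \<Longrightarrow> k lam \<nu> = (if lam = \<nu> then 1 else 0)"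
  shows "act k f lam = f lam"
proof (rule fps_ext)
  fix n
  have "fps_nth (act k f lam) n = (\<Sum>\<nu>\<in>{lam}. k lam \<nu> * fps_nth (f \<nu>) (psize lam + n - psize \<nu>))"
    unfolding act_def fps_nth_Abs_fps
    by (rule sum.mono_neutral_right[OF finite_parts_above])
      (use assms in \<open>auto simp: parts_above_def\<close>)
  then show "fps_nth (act k f lam) n = fps_nth (f lam) n" using assms by simp
qed

lemma act_hker_vker:
  "is_partition lam \<Longrightarrow> act (hker b) (act (vker (- b)) f) lam = f lam"
  unfolding act_act by (rule act_identity) (auto simp: hv_inverse)

lemma act_vker_hker:
  "is_partition lam \<Longrightarrow> act (vker (- b)) (act (hker b) f) lam = f lam"
  unfolding act_act by (rule act_identity) (auto simp: vh_inverse)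

subsection \<open>Exchanging two horizontal strips\<close>

text \<open>
  Given \<open>lam\<close> and \<open>\<rho>\<close>, compare the partitions \<open>\<nu>\<close> that lie a horizontal strip above both with the
  partitions \<open>\<sigma>\<close> that lie a horizontal strip below both.  With \<open>M = max lam \<rho>\<close> and
  \<open>m = min lam \<rho>\<close>, both \<open>\<nu> (Suc j)\<close> and \<open>\<sigma> j\<close> range over the interval from \<open>M (Suc j)\<close> to \<open>m j\<close>,
  and reflecting this interval matches them.  What remains is the excess \<open>k\<close> of \<open>\<nu> 0\<close> over
  \<open>M 0\<close>, which is unbounded.
\<close>

definition exchange_up :: "(nat \<Rightarrow> nat) \<Rightarrow> (nat \<Rightarrow> nat) \<Rightarrow> nat \<Rightarrow> (nat \<Rightarrow> nat) \<Rightarrow> nat \<Rightarrow> nat" where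
  "exchange_up lam \<rho> k \<sigma> i = (case i of
     0 \<Rightarrow> max (lam 0) (\<rho> 0) + k
   | Suc j \<Rightarrow> max (lam (Suc j)) (\<rho> (Suc j)) + min (lam j) (\<rho> j) - \<sigma> j)"

definition exchange_down :: "(nat \<Rightarrow> nat) \<Rightarrow> (nat \<Rightarrow> nat) \<Rightarrow> (nat \<Rightarrow> nat) \<Rightarrow> nat \<Rightarrow> nat" where
  "exchange_down lam \<rho> \<nu> i = max (lam (Suc i)) (\<rho> (Suc i)) + min (lam i) (\<rho> i) - \<nu> (Suc i)"

lemma exchange_size:
  assumes lam: "is_partition lam" and \<rho>: "is_partition \<rho>"
    and \<nu>: "is_partition \<nu>" and \<sigma>: "is_partition \<sigma>"
    and 0: "\<nu> 0 = max (lam 0) (\<rho> 0) + k"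
    and Suc: "\<And>i. \<nu> (Suc i) + \<sigma> i = max (lam (Suc i)) (\<rho> (Suc i)) + min (lam i) (\<rho> i)"
  shows "psize \<nu> + psize \<sigma> = k + psize lam + psize \<rho>"
proof -
  obtain N1 N2 N3 N4 where "\<forall>i\<ge>N1. lam i = 0" "\<forall>i\<ge>N2. \<rho> i = 0" "\<forall>i\<ge>N3. \<nu> i = 0" "\<forall>i\<ge>N4. \<sigma> i = 0"
    using partition_bound[OF lam] partition_bound[OF \<rho>] partition_bound[OF \<nu>] partition_bound[OF \<sigma>]
    by auto
  moreover define N where "N = N1 + N2 + N3 + N4"
  ultimately have N: "\<forall>i\<ge>N. lam i = 0" "\<forall>i\<ge>N. \<rho> i = 0" "\<forall>i\<ge>Suc N. \<nu> i = 0" "\<forall>i\<ge>N. \<sigma> i = 0"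
    by auto
  let ?M = "\<lambda>i. max (lam i) (\<rho> i)"
  have "psize \<nu> + psize \<sigma> = \<nu> 0 + (\<Sum>i<N. \<nu> (Suc i) + \<sigma> i)"
    by (simp add: psize_eq_sum[OF N(3)] psize_eq_sum[OF N(4)] sum.lessThan_Suc_shift sum.distrib
        del: sum.lessThan_Suc)
  also have "\<dots> = k + (?M 0 + (\<Sum>i<N. ?M (Suc i))) + (\<Sum>i<N. min (lam i) (\<rho> i))"
    by (simp add: 0 Suc sum.distrib)
  also have "?M 0 + (\<Sum>i<N. ?M (Suc i)) = (\<Sum>i<Suc N. ?M i)"
    by (rule sum.lessThan_Suc_shift[symmetric])
  also have "\<dots> = (\<Sum>i<N. ?M i)" using N by simp
  also have "k + (\<Sum>i<N. ?M i) + (\<Sum>i<N. min (lam i) (\<rho> i)) = k + (\<Sum>i<N. ?M i + min (lam i) (\<rho> i))"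
    by (simp add: sum.distrib)
  also have "\<dots> = k + (\<Sum>i<N. lam i + \<rho> i)"
    by (intro arg_cong[where f = "(+) k"] sum.cong) auto
  also have "\<dots> = k + psize lam + psize \<rho>"
    by (simp add: psize_eq_sum[OF N(1)] psize_eq_sum[OF N(2)] sum.distrib)
  finally show ?thesis .
qed

lemma exchange_up:
  fixes k :: nat
  assumes lam: "is_partition lam" and \<rho>: "is_partition \<rho>" and \<sigma>: "is_partition \<sigma>"
    and h: "hstrip \<sigma> lam" "hstrip \<sigma> \<rho>"
  defines "\<nu> \<equiv> exchange_up lam \<rho> k \<sigma>"
  shows "is_partition \<nu>" "hstrip lam \<nu>" "hstrip \<rho> \<nu>" "psize \<nu> + psize \<sigma> = k + psize lam + psize \<rho>"
    "exchange_down lam \<rho> \<nu> = \<sigma>" "\<nu> 0 - max (lam 0) (\<rho> 0) = k"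
proof -
  have h': "\<sigma> i \<le> lam i" "\<sigma> i \<le> \<rho> i" "lam (Suc i) \<le> \<sigma> i" "\<rho> (Suc i) \<le> \<sigma> i" for i
    using h by (auto simp: hstrip_def le_fun_def)
  have e0: "\<nu> 0 = max (lam 0) (\<rho> 0) + k"
    and eS: "\<nu> (Suc i) = max (lam (Suc i)) (\<rho> (Suc i)) + min (lam i) (\<rho> i) - \<sigma> i" for i
    by (simp_all add: \<nu>_def exchange_up_def)
  have s: "\<nu> (Suc i) + \<sigma> i = max (lam (Suc i)) (\<rho> (Suc i)) + min (lam i) (\<rho> i)" for i
    using h'[of i] by (simp add: eS)
  have lo: "max (lam i) (\<rho> i) \<le> \<nu> i" for i
  proof (cases i)
    case (Suc j)
    have "\<sigma> j \<le> min (lam j) (\<rho> j)" using h' by simp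
    then show ?thesis unfolding Suc eS by linarith
  qed (simp add: e0)
  have hi: "\<nu> (Suc i) \<le> min (lam i) (\<rho> i)" for i
    using h'[of i] by (auto simp: eS)
  obtain N1 N2 where N: "\<forall>i\<ge>N1. lam i = 0" "\<forall>i\<ge>N2. \<rho> i = 0"
    using partition_bound[OF lam] partition_bound[OF \<rho>] by auto
  show \<nu>: "is_partition \<nu>"
  proof (rule is_partitionI)
    show "\<nu> (Suc i) \<le> \<nu> i" for i using hi[of i] lo[of i] by simp
    have "\<nu> i = 0" if i: "Suc (N1 + N2) \<le> i" for i
    proof -
      obtain j where j: "i = Suc j" "N1 \<le> j" using i by (cases i) auto
      then show ?thesis using hi[of j] N(1) by simp
    qed
    then show "\<forall>i\<ge>Suc (N1 + N2). \<nu> i = 0" by blast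
  qed
  show "hstrip lam \<nu>" "hstrip \<rho> \<nu>"
    using lo hi by (auto simp: hstrip_def le_fun_def)
  show "psize \<nu> + psize \<sigma> = k + psize lam + psize \<rho>"
    by (rule exchange_size[OF lam \<rho> \<nu> \<sigma> e0 s])
  show "exchange_down lam \<rho> \<nu> = \<sigma>"
  proof
    fix i show "exchange_down lam \<rho> \<nu> i = \<sigma> i"
      using s[of i] by (simp add: exchange_down_def)
  qed
  show "\<nu> 0 - max (lam 0) (\<rho> 0) = k" by (simp add: e0)
qed

lemma exchange_down:
  assumes lam: "is_partition lam" and \<rho>: "is_partition \<rho>" and \<nu>: "is_partition \<nu>"
    and h: "hstrip lam \<nu>" "hstrip \<rho> \<nu>"
  defines "\<sigma> \<equiv> exchange_down lam \<rho> \<nu>" and "k \<equiv> \<nu> 0 - max (lam 0) (\<rho> 0)"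
  shows "is_partition \<sigma>" "hstrip \<sigma> lam" "hstrip \<sigma> \<rho>" "psize \<nu> + psize \<sigma> = k + psize lam + psize \<rho>"
    "exchange_up lam \<rho> k \<sigma> = \<nu>"
proof -
  have h': "lam i \<le> \<nu> i" "\<rho> i \<le> \<nu> i" "\<nu> (Suc i) \<le> lam i" "\<nu> (Suc i) \<le> \<rho> i" for i
    using h by (auto simp: hstrip_def le_fun_def)
  have e: "\<sigma> i = max (lam (Suc i)) (\<rho> (Suc i)) + min (lam i) (\<rho> i) - \<nu> (Suc i)" for i
    by (simp add: \<sigma>_def exchange_down_def)
  have s: "\<nu> (Suc i) + \<sigma> i = max (lam (Suc i)) (\<rho> (Suc i)) + min (lam i) (\<rho> i)" for i
    using h'[of i] by (simp add: e)
  have e0: "\<nu> 0 = max (lam 0) (\<rho> 0) + k"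
    using h'[of 0] by (simp add: k_def)
  have lo: "max (lam (Suc i)) (\<rho> (Suc i)) \<le> \<sigma> i" for i
    using h'[of i] by (auto simp: e)
  have hi: "\<sigma> i \<le> min (lam i) (\<rho> i)" for i
    using s[of i] h'[of "Suc i"] by auto
  obtain N where N: "\<forall>i\<ge>N. lam i = 0"
    using partition_bound[OF lam] by auto
  have le: "\<sigma> \<le> lam" using hi by (auto simp: le_fun_def)
  show \<sigma>: "is_partition \<sigma>"
  proof (rule is_partitionI)
    show "\<sigma> (Suc i) \<le> \<sigma> i" for i using hi[of "Suc i"] lo[of i] by simp
    show "\<forall>i\<ge>N. \<sigma> i = 0" by (rule zero_beyond_mono[OF le N])
  qed
  show "hstrip \<sigma> lam" "hstrip \<sigma> \<rho>"
    using lo hi by (auto simp: hstrip_def le_fun_def)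
  show "psize \<nu> + psize \<sigma> = k + psize lam + psize \<rho>"
    by (rule exchange_size[OF lam \<rho> \<nu> \<sigma> e0 s])
  show "exchange_up lam \<rho> k \<sigma> = \<nu>"
  proof
    fix i show "exchange_up lam \<rho> k \<sigma> i = \<nu> i"
      using e0 s[of "i - 1"] by (cases i) (auto simp: exchange_up_def)
  qed
qed

lemma psize_hstrip_le: "is_partition lam \<Longrightarrow> hstrip \<sigma> lam \<Longrightarrow> psize \<sigma> \<le> psize lam"
  by (simp add: hstrip_def psize_mono)

lemma add_var_nth:
  "fps_nth (add_var x f lam) m = (\<Sum>\<sigma>\<in>{\<sigma> \<in> parts_below lam. hstrip \<sigma> lam}.
     x ^ (psize lam - psize \<sigma>) * fps_nth (f \<sigma>) m)"
  by (simp add: add_var_def fps_sum_nth)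

lemma act_hker_nth:
  "fps_nth (act (hker b) f lam) n = (\<Sum>\<nu>\<in>parts_above lam n. if hstrip lam \<nu>
     then b ^ (psize \<nu> - psize lam) * fps_nth (f \<nu>) (psize lam + n - psize \<nu>) else 0)"
  by (auto simp: act_def hker_def intro!: sum.cong)

text \<open>
  The excess \<open>k\<close> of the exchange bijection is the source of the geometric series.
\<close>

lemma act_hker_add_var:
  fixes b x :: "'a::comm_ring_1"
  assumes lam: "is_partition lam"
  shows "act (hker b) (add_var x f) lam =
    Abs_fps (\<lambda>k. (b * x) ^ k) * add_var x (act (hker b) f) lam"
proof (rule fps_ext)
  fix n
  let ?L = "SIGMA \<nu>:{\<nu> \<in> parts_above lam n. hstrip lam \<nu>}. {\<rho> \<in> parts_below \<nu>. hstrip \<rho> \<nu>}"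
  let ?S = "{\<sigma> \<in> parts_below lam. hstrip \<sigma> lam}"
  let ?A = "\<lambda>k \<sigma>. {\<rho> \<in> parts_above \<sigma> (n - k). hstrip \<sigma> \<rho>}"
  let ?l = "\<lambda>\<nu> \<rho>. b ^ (psize \<nu> - psize lam) *
    (x ^ (psize \<nu> - psize \<rho>) * fps_nth (f \<rho>) (psize lam + n - psize \<nu>))"
  let ?r = "\<lambda>k \<sigma> \<rho>. (b * x) ^ k * (x ^ (psize lam - psize \<sigma>) *
    (b ^ (psize \<rho> - psize \<sigma>) * fps_nth (f \<rho>) (psize \<sigma> + (n - k) - psize \<rho>)))"
  have finS: "finite ?S" using finite_parts_below[OF lam] by simp
  have "fps_nth (act (hker b) (add_var x f) lam) n =
    (\<Sum>\<nu>\<in>parts_above lam n. if hstrip lam \<nu> then (\<Sum>\<rho>\<in>{\<rho> \<in> parts_below \<nu>. hstrip \<rho> \<nu>}. ?l \<nu> \<rho>) else 0)"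
    unfolding act_hker_nth add_var_nth sum_distrib_left ..
  also have "\<dots> = (\<Sum>\<nu>\<in>{\<nu> \<in> parts_above lam n. hstrip lam \<nu>}. \<Sum>\<rho>\<in>{\<rho> \<in> parts_below \<nu>. hstrip \<rho> \<nu>}. ?l \<nu> \<rho>)"
    by (rule sum.inter_filter[symmetric]) (rule finite_parts_above)
  also have "\<dots> = (\<Sum>(\<nu>, \<rho>)\<in>?L. ?l \<nu> \<rho>)"
  proof (rule sum.Sigma)
    show "finite {\<nu> \<in> parts_above lam n. hstrip lam \<nu>}"
      by (simp add: finite_parts_above)
    show "\<forall>\<nu>\<in>{\<nu> \<in> parts_above lam n. hstrip lam \<nu>}. finite {\<rho> \<in> parts_below \<nu>. hstrip \<rho> \<nu>}"
      by (simp add: parts_above_iff finite_parts_below)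
  qed
  also have "\<dots> = (\<Sum>(k, \<sigma>, \<rho>)\<in>(SIGMA k:{0..n}. SIGMA \<sigma>:?S. ?A k \<sigma>). ?r k \<sigma> \<rho>)"
  proof (rule sum.reindex_bij_witness[
        where j = "\<lambda>(\<nu>, \<rho>). (\<nu> 0 - max (lam 0) (\<rho> 0), exchange_down lam \<rho> \<nu>, \<rho>)"
          and i = "\<lambda>(k, \<sigma>, \<rho>). (exchange_up lam \<rho> k \<sigma>, \<rho>)"], goal_cases)
    case (1 p)
    then obtain \<nu> \<rho> where p: "p = (\<nu>, \<rho>)" "is_partition \<nu>" "is_partition \<rho>" "hstrip lam \<nu>" "hstrip \<rho> \<nu>"
      by (auto simp: parts_above_def parts_below_def)
    then show ?case using exchange_down(5)[OF lam p(3,2,4,5)] by simp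
  next
    case (2 p)
    then obtain \<nu> \<rho> where p: "p = (\<nu>, \<rho>)" "is_partition \<nu>" "is_partition \<rho>" "hstrip lam \<nu>" "hstrip \<rho> \<nu>"
      and sz: "psize \<nu> \<le> psize lam + n"
      by (auto simp: parts_above_def parts_below_def)
    note d = exchange_down[OF lam p(3,2,4,5)]
    have "psize (exchange_down lam \<rho> \<nu>) \<le> psize \<rho>" "psize (exchange_down lam \<rho> \<nu>) \<le> psize lam"
      using d lam p by (auto intro: psize_hstrip_le)
    then show ?case
      using d sz p by (auto simp: parts_above_def parts_below_def hstrip_def)
  next
    case (3 p)
    then obtain k \<sigma> \<rho> where p: "p = (k, \<sigma>, \<rho>)" "is_partition \<rho>" "is_partition \<sigma>" "hstrip \<sigma> lam" "hstrip \<sigma> \<rho>"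
      by (auto simp: parts_above_def parts_below_def)
    then show ?case using exchange_up(5,6)[OF lam p(2,3,4,5), of k] by simp
  next
    case (4 p)
    then obtain k \<sigma> \<rho> where p: "p = (k, \<sigma>, \<rho>)" "is_partition \<rho>" "is_partition \<sigma>" "hstrip \<sigma> lam" "hstrip \<sigma> \<rho>"
      and sz: "k \<le> n" "psize \<rho> \<le> psize \<sigma> + (n - k)"
      by (auto simp: parts_above_def parts_below_def)
    note u = exchange_up[OF lam p(2,3,4,5), of k]
    show ?case
      using u sz p by (auto simp: parts_above_def parts_below_def hstrip_def)
  next
    case (5 p)
    then obtain \<nu> \<rho> where p: "p = (\<nu>, \<rho>)" "is_partition \<nu>" "is_partition \<rho>" "hstrip lam \<nu>" "hstrip \<rho> \<nu>"
      and sz: "psize \<nu> \<le> psize lam + n"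
      by (auto simp: parts_above_def parts_below_def)
    note d = exchange_down[OF lam p(3,2,4,5)]
    let ?k = "\<nu> 0 - max (lam 0) (\<rho> 0)" and ?\<sigma> = "exchange_down lam \<rho> \<nu>"
    have le: "psize ?\<sigma> \<le> psize \<rho>" "psize ?\<sigma> \<le> psize lam"
      using d lam p by (auto intro: psize_hstrip_le)
    have eqs: "psize \<nu> - psize lam = ?k + (psize \<rho> - psize ?\<sigma>)"
      "psize \<nu> - psize \<rho> = ?k + (psize lam - psize ?\<sigma>)"
      "psize lam + n - psize \<nu> = psize ?\<sigma> + (n - ?k) - psize \<rho>"
      using d(4) sz le by linarith+
    show ?case
      unfolding p prod.case eqs by (simp add: power_add power_mult_distrib algebra_simps)
  qed
  also have "\<dots> = (\<Sum>k\<in>{0..n}. \<Sum>(\<sigma>, \<rho>)\<in>(SIGMA \<sigma>:?S. ?A k \<sigma>). ?r k \<sigma> \<rho>)"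
    using finS by (subst sum.Sigma[symmetric]) (auto simp: finite_parts_above split_def)
  also have "\<dots> = (\<Sum>k\<in>{0..n}. \<Sum>\<sigma>\<in>?S. \<Sum>\<rho>\<in>?A k \<sigma>. ?r k \<sigma> \<rho>)"
    using finS by (subst sum.Sigma) (auto simp: finite_parts_above)
  also have "\<dots> = (\<Sum>k\<in>{0..n}. \<Sum>\<sigma>\<in>?S. \<Sum>\<rho>\<in>parts_above \<sigma> (n - k). if hstrip \<sigma> \<rho> then ?r k \<sigma> \<rho> else 0)"
    by (rule sum.cong[OF refl], rule sum.cong[OF refl], rule sum.inter_filter[OF finite_parts_above])
  also have "\<dots> = fps_nth (Abs_fps (\<lambda>k. (b * x) ^ k) * add_var x (act (hker b) f) lam) n"
    unfolding fps_mult_nth[of "Abs_fps _"] add_var_nth act_hker_nth sum_distrib_left fps_nth_Abs_fps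
    by (intro sum.cong refl) simp
  finally show "fps_nth (act (hker b) (add_var x f) lam) n =
    fps_nth (Abs_fps (\<lambda>k. (b * x) ^ k) * add_var x (act (hker b) f) lam) n" .
qed

lemma geometric_fps: "(1 - fps_const c * fps_X) * Abs_fps (\<lambda>k. c ^ k) = (1 :: 'a::comm_ring_1 fps)"
proof (rule fps_ext)
  fix n show "fps_nth ((1 - fps_const c * fps_X) * Abs_fps (\<lambda>k. c ^ k)) n = fps_nth 1 n"
    by (cases n) (simp_all add: left_diff_distrib mult.assoc)
qed

text \<open>
  Since \<open>vker (- b)\<close> inverts \<open>hker b\<close>, this is \<open>act_hker_add_var\<close> conjugated by it.
\<close>

lemma act_vker_add_var:
  fixes b x :: "'a::comm_ring_1"
  assumes lam: "is_partition lam"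
  shows "act (vker (- b)) (add_var x f) lam =
    (1 - fps_const (b * x) * fps_X) * add_var x (act (vker (- b)) f) lam"
proof -
  let ?g = "act (vker (- b)) f" and ?c = "1 - fps_const (b * x) * fps_X"
  (* Let D be the action of hker b and write f = D g; then (1 - b x t) D U g = U D g = U f. *)
  have "act (vker (- b)) (add_var x f) lam =
    act (vker (- b)) (\<lambda>\<nu>. ?c * act (hker b) (add_var x ?g) \<nu>) lam"
  proof (rule act_cong)
    fix \<nu> assume \<nu>: "is_partition \<nu>"
    have "?c * act (hker b) (add_var x ?g) \<nu> = add_var x (act (hker b) ?g) \<nu>"
      by (simp add: act_hker_add_var[OF \<nu>] mult.assoc[symmetric] geometric_fps)
    also have "\<dots> = add_var x f \<nu>"
      by (rule add_var_cong) (rule act_hker_vker)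
    finally show "add_var x f \<nu> = ?c * act (hker b) (add_var x ?g) \<nu>" ..
  qed simp
  then show ?thesis
    by (simp add: act_mult act_vker_hker[OF lam])
qed

subsection \<open>Finitely many variables\<close>

primrec add_vars :: "(nat \<Rightarrow> 'a::comm_ring_1) \<Rightarrow> nat \<Rightarrow> ((nat \<Rightarrow> nat) \<Rightarrow> 'a fps) \<Rightarrow> (nat \<Rightarrow> nat) \<Rightarrow> 'a fps" where
  "add_vars x 0 f = f"
| "add_vars x (Suc n) f = add_var (x n) (add_vars x n f)"

lemma add_vars_cong:
  assumes "\<And>\<nu>. is_partition \<nu> \<Longrightarrow> f \<nu> = g \<nu>" "is_partition lam"
  shows "add_vars x n f lam = add_vars x n g lam"
  using assms(2) by (induction n arbitrary: lam) (auto intro: add_var_cong assms(1))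

text \<open>
  This is \<open>(1 - b x t) / (1 - x t)\<close>.
\<close>

definition ribbon_factor :: "'a::comm_ring_1 \<Rightarrow> 'a \<Rightarrow> 'a fps" where
  "ribbon_factor b x = (1 - fps_const (b * x) * fps_X) * Abs_fps (\<lambda>k. x ^ k)"

lemma act_ribbon_add_vars:
  fixes b :: "'a::comm_ring_1"
  assumes lam: "is_partition lam"
  shows "act (hker 1) (act (vker (- b)) (add_vars x n f)) lam =
    (\<Prod>i<n. ribbon_factor b (x i)) * add_vars x n (act (hker 1) (act (vker (- b)) f)) lam"
  using lam
proof (induction n arbitrary: lam)
  case (Suc n)
  let ?g = "add_vars x n f"
  have "act (hker 1) (act (vker (- b)) (add_var (x n) ?g)) lam =
    act (hker 1) (\<lambda>\<nu>. (1 - fps_const (b * x n) * fps_X) * add_var (x n) (act (vker (- b)) ?g) \<nu>) lam"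
    by (rule act_cong) (simp_all add: act_vker_add_var)
  also have "\<dots> = ribbon_factor b (x n) * add_var (x n) (act (hker 1) (act (vker (- b)) ?g)) lam"
    by (simp add: act_mult act_hker_add_var[OF Suc.prems] ribbon_factor_def mult.assoc)
  also have "add_var (x n) (act (hker 1) (act (vker (- b)) ?g)) lam =
    add_var (x n) (\<lambda>\<nu>. (\<Prod>i<n. ribbon_factor b (x i)) *
      add_vars x n (act (hker 1) (act (vker (- b)) f)) \<nu>) lam"
    by (rule add_var_cong) (rule Suc.IH)
  finally show ?case
    by (simp add: add_var_mult mult.assoc mult.commute mult.left_commute)
qed simp

text \<open>
  The left operator moves past all variables, and what it then meets is its inverse: in
  \<open>D\<^sub>1 V\<^sub>-\<^sub>b D\<^sub>b V\<^sub>-\<^sub>1\<close> the inner two operators cancel, and then the outer two.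
\<close>

theorem ribbon_operators_cancel:
  fixes b :: "'a::comm_ring_1"
  assumes lam: "is_partition lam"
  shows "act (conv (hker 1) (vker (- b))) (add_vars x n (act (conv (hker b) (vker (- 1))) f)) lam =
    (\<Prod>i<n. ribbon_factor b (x i)) * add_vars x n f lam"
proof -
  have id: "act (hker 1) (act (vker (- b)) (act (hker b) (act (vker (- 1)) f))) \<nu> = f \<nu>"
    if \<nu>: "is_partition \<nu>" for \<nu>
  proof -
    have "act (hker 1) (act (vker (- b)) (act (hker b) (act (vker (- 1)) f))) \<nu> =
      act (hker 1) (act (vker (- 1)) f) \<nu>"
      by (rule act_cong) (simp_all add: act_vker_hker)
    then show ?thesis using act_hker_vker[OF \<nu>, of 1 f] by simp
  qed
  show ?thesis
    unfolding act_act[symmetric] act_ribbon_add_vars[OF lam]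
    by (rule arg_cong[where f = "(*) _"]) (rule add_vars_cong[OF id lam])
qed

section \<open>The ribbon rule in finitely many variables\<close>

lemma (in ribbon_cells) card_eq_ht_wt_rib: "card C = ht C + wt C + rib C"
proof -
  let ?A = "{c \<in> C. has_above C c}" and ?R = "{c \<in> C. has_right C c}"
  have "C = ?A \<union> ?R \<union> heads C" by (auto simp: heads_def)
  then have "card C = card (?A \<union> ?R \<union> heads C)" by simp
  also have "\<dots> = card (?A \<union> ?R) + card (heads C)"
    by (rule card_Un_disjoint) (use finite_C in \<open>auto simp: heads_def\<close>)
  also have "card (?A \<union> ?R) = card ?A + card ?R"
    by (rule card_Un_disjoint) (use finite_C not_above_and_right in auto)
  finally show ?thesis by (simp add: ht_eq wt_eq rib_eq)
qed

text \<open>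
  The factors of the coefficient that belong to the ribbon added to \<open>lam\<close> and to the ribbon
  removed from \<open>\<mu>\<close>; the product of both has one factor \<open>1 - b\<close> too many.
\<close>

definition outer_weight :: "'a::comm_ring_1 \<Rightarrow> (nat \<Rightarrow> nat) \<Rightarrow> (nat \<Rightarrow> nat) \<Rightarrow> 'a" where
  "outer_weight b \<kappa> lam = (if broken_ribbon (diagram \<kappa> lam)
     then (- b) ^ ht (diagram \<kappa> lam) * (1 - b) ^ rib (diagram \<kappa> lam) else 0)"

definition inner_weight :: "'a::comm_ring_1 \<Rightarrow> (nat \<Rightarrow> nat) \<Rightarrow> (nat \<Rightarrow> nat) \<Rightarrow> 'a" where
  "inner_weight b \<kappa> lam = (if broken_ribbon (diagram \<kappa> lam)
     then (- b) ^ wt (diagram \<kappa> lam) * (1 - b) ^ rib (diagram \<kappa> lam) else 0)"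

lemma conv_outer:
  assumes "is_partition lam" "is_partition \<kappa>" "lam \<le> \<kappa>"
  shows "conv (hker 1) (vker (- b)) lam \<kappa> = outer_weight b \<kappa> lam"
  by (simp add: ribbon_weight[OF assms] outer_weight_def)

text \<open>
  The rule for ribbon weights gives \<open>(- 1) ^ ht * b ^ wt * (b - 1) ^ rib\<close>.  As every cell is
  counted exactly once by height, width or number of components, pulling out one sign per cell
  gives the stated form.
\<close>

lemma conv_inner:
  assumes "is_partition lam" "is_partition \<kappa>" "lam \<le> \<kappa>"
  shows "conv (hker b) (vker (- 1)) lam \<kappa> = (- 1) ^ (psize \<kappa> - psize lam) * inner_weight b \<kappa> lam"
proof (cases "broken_ribbon (diagram \<kappa> lam)")
  case True
  interpret ribbon_cells "diagram \<kappa> lam"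
    using True by (intro ribbon_cells_diagram assms) (simp add: broken_ribbon_diagram[OF assms])
  let ?C = "diagram \<kappa> lam"
  have sq: "(- 1) ^ wt ?C * (- b) ^ wt ?C = b ^ wt ?C" "(- 1) ^ rib ?C * (1 - b) ^ rib ?C = (- 1 + b) ^ rib ?C"
    by (simp_all flip: power_mult_distrib)
  have "(- 1) ^ (psize \<kappa> - psize lam) * inner_weight b \<kappa> lam =
    (- 1) ^ ht ?C * ((- 1) ^ wt ?C * (- b) ^ wt ?C) * ((- 1) ^ rib ?C * (1 - b) ^ rib ?C)"
    using card_eq_ht_wt_rib card_diagram[OF assms(2,3)] True
    by (simp add: inner_weight_def power_add mult_ac)
  then show ?thesis
    unfolding sq using True by (simp add: ribbon_weight[OF assms])
qed (simp add: ribbon_weight[OF assms] inner_weight_def)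

primrec schur_vars :: "(nat \<Rightarrow> 'a::comm_ring_1) \<Rightarrow> nat \<Rightarrow> (nat \<Rightarrow> nat) \<Rightarrow> (nat \<Rightarrow> nat) \<Rightarrow> 'a" where
  "schur_vars x 0 \<mu> lam = (if lam = \<mu> then 1 else 0)"
| "schur_vars x (Suc n) \<mu> lam = (\<Sum>\<rho>\<in>{\<rho> \<in> parts_below lam. hstrip \<rho> lam}.
     x n ^ (psize lam - psize \<rho>) * schur_vars x n \<mu> \<rho>)"

lemma schur_vars_zero: "\<not> \<mu> \<le> lam \<Longrightarrow> schur_vars x n \<mu> lam = 0"
proof (induction n arbitrary: lam)
  case (Suc n)
  have "schur_vars x n \<mu> \<rho> = 0" if "\<rho> \<le> lam" for \<rho>
    using Suc that order_trans by blast
  then show ?case by (auto simp: parts_below_def intro!: sum.neutral)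
qed auto

lemma add_vars_nth:
  assumes "is_partition lam"
  shows "fps_nth (add_vars x n f lam) e =
    (\<Sum>\<kappa>\<in>parts_below lam. schur_vars x n \<kappa> lam * fps_nth (f \<kappa>) e)"
  using assms
proof (induction n arbitrary: lam)
  case 0
  have "(\<Sum>\<kappa>\<in>parts_below lam. schur_vars x 0 \<kappa> lam * fps_nth (f \<kappa>) e) =
    (\<Sum>\<kappa>\<in>{lam}. schur_vars x 0 \<kappa> lam * fps_nth (f \<kappa>) e)"
    by (rule sum.mono_neutral_right) (use 0 in \<open>auto simp: finite_parts_below, auto simp: parts_below_def\<close>)
  then show ?case by simp
next
  case (Suc n)
  let ?S = "{\<rho> \<in> parts_below lam. hstrip \<rho> lam}"
  have "fps_nth (add_vars x (Suc n) f lam) e =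
    (\<Sum>\<rho>\<in>?S. x n ^ (psize lam - psize \<rho>) * (\<Sum>\<kappa>\<in>parts_below lam. schur_vars x n \<kappa> \<rho> * fps_nth (f \<kappa>) e))"
    unfolding add_vars.simps add_var_nth
  proof (rule sum.cong[OF refl])
    fix \<rho> assume "\<rho> \<in> ?S"
    then have \<rho>: "is_partition \<rho>" "\<rho> \<le> lam" by (auto simp: parts_below_def)
    have "fps_nth (add_vars x n f \<rho>) e = (\<Sum>\<kappa>\<in>parts_below \<rho>. schur_vars x n \<kappa> \<rho> * fps_nth (f \<kappa>) e)"
      by (rule Suc.IH[OF \<rho>(1)])
    also have "\<dots> = (\<Sum>\<kappa>\<in>parts_below lam. schur_vars x n \<kappa> \<rho> * fps_nth (f \<kappa>) e)"
      by (rule sum.mono_neutral_left[OF finite_parts_below[OF Suc.prems]])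
        (use \<rho> in \<open>auto simp: parts_below_def schur_vars_zero\<close>)
    finally show "x n ^ (psize lam - psize \<rho>) * fps_nth (add_vars x n f \<rho>) e =
      x n ^ (psize lam - psize \<rho>) * (\<Sum>\<kappa>\<in>parts_below lam. schur_vars x n \<kappa> \<rho> * fps_nth (f \<kappa>) e)"
      by simp
  qed
  also have "\<dots> = (\<Sum>\<kappa>\<in>parts_below lam. schur_vars x (Suc n) \<kappa> lam * fps_nth (f \<kappa>) e)"
    by (simp add: sum_distrib_left sum_distrib_right mult.assoc) (rule sum.swap)
  finally show ?case .
qed

text \<open>
  The index set of the rule for one part of size \<open>r\<close>: \<open>r\<close> cells in total are added to \<open>lam\<close> or
  removed from \<open>\<mu>\<close>.
\<close>

definition shifts :: "(nat \<Rightarrow> nat) \<Rightarrow> (nat \<Rightarrow> nat) \<Rightarrow> nat \<Rightarrow> ((nat \<Rightarrow> nat) \<times> (nat \<Rightarrow> nat)) set" where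
  "shifts lam \<mu> r = {(\<nu>, \<kappa>). is_partition \<nu> \<and> is_partition \<kappa> \<and> lam \<le> \<nu> \<and> \<kappa> \<le> \<mu> \<and>
     (psize \<nu> - psize lam) + (psize \<mu> - psize \<kappa>) = r}"

lemma finite_shifts: "is_partition \<mu> \<Longrightarrow> finite (shifts lam \<mu> r)"
  by (rule finite_subset[of _ "parts_above lam r \<times> parts_below \<mu>"])
    (auto simp: shifts_def finite_parts_above finite_parts_below, auto simp: parts_above_def parts_below_def)

lemma shifts_iff:
  "(\<nu>, \<kappa>) \<in> shifts lam \<mu> r \<longleftrightarrow>
   \<nu> \<in> parts_above lam r \<and> \<kappa> \<in> parts_below \<mu> \<and> psize \<mu> - psize \<kappa> = psize lam + r - psize \<nu>"
proof (cases "is_partition \<nu> \<and> lam \<le> \<nu>")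
  case True
  then have "psize lam \<le> psize \<nu>" by (simp add: psize_mono)
  then show ?thesis using True by (auto simp: shifts_def parts_above_def parts_below_def)
qed (auto simp: shifts_def parts_above_def)

definition delta :: "(nat \<Rightarrow> nat) \<Rightarrow> (nat \<Rightarrow> nat) \<Rightarrow> 'a::comm_ring_1 fps" where
  "delta \<mu> \<nu> = (if \<nu> = \<mu> then 1 else 0)"

lemma act_delta_nth:
  assumes "is_partition \<mu>"
  shows "fps_nth (act k (delta \<mu>) \<kappa>) e = (if \<kappa> \<le> \<mu> \<and> psize \<mu> = psize \<kappa> + e then k \<kappa> \<mu> else 0)"
proof -
  have "fps_nth (act k (delta \<mu>) \<kappa>) e =
    (\<Sum>\<nu>\<in>parts_above \<kappa> e. if \<nu> = \<mu> then (if psize \<mu> = psize \<kappa> + e then k \<kappa> \<mu> else 0) else 0)"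
    unfolding act_def fps_nth_Abs_fps
    by (intro sum.cong refl) (auto simp: delta_def parts_above_def)
  then show ?thesis
    using assms by (auto simp: finite_parts_above, auto simp: parts_above_def)
qed

text \<open>
  Comparison of the coefficients of \<open>t ^ r\<close> in the operator identity, applied to the indicator
  function of \<open>\<mu>\<close>.
\<close>

theorem ribbon_rule_finite:
  fixes b :: "'a::comm_ring_1"
  assumes lam: "is_partition lam" and \<mu>: "is_partition \<mu>" and le: "\<mu> \<le> lam"
  shows "(\<Sum>(\<nu>, \<kappa>)\<in>shifts lam \<mu> r. (- 1) ^ (psize \<mu> - psize \<kappa>) *
       (outer_weight b \<nu> lam * inner_weight b \<mu> \<kappa>) * schur_vars x n \<kappa> \<nu>) =
     fps_nth (\<Prod>i<n. ribbon_factor b (x i)) r * schur_vars x n \<mu> lam"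
proof -
  let ?R = "conv (hker 1) (vker (- b))" and ?R' = "conv (hker b) (vker (- 1))"
  have const: "add_vars x n (delta \<mu>) lam = fps_const (schur_vars x n \<mu> lam)"
  proof (rule fps_ext)
    fix e
    have "\<mu> \<in> parts_below lam" using \<mu> le by (simp add: parts_below_def)
    moreover have "fps_nth (add_vars x n (delta \<mu>) lam) e =
      (\<Sum>\<kappa>\<in>parts_below lam. if \<kappa> = \<mu> then schur_vars x n \<mu> lam * fps_nth 1 e else 0)"
      unfolding add_vars_nth[OF lam] by (intro sum.cong refl) (auto simp: delta_def)
    ultimately show "fps_nth (add_vars x n (delta \<mu>) lam) e = fps_nth (fps_const (schur_vars x n \<mu> lam)) e"
      using finite_parts_below[OF lam] by simp
  qed
  have inner: "fps_nth (add_vars x n (act ?R' (delta \<mu>)) \<nu>) e =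
    (\<Sum>\<kappa>\<in>parts_below \<mu>. if psize \<mu> - psize \<kappa> = e
       then (- 1) ^ (psize \<mu> - psize \<kappa>) * inner_weight b \<mu> \<kappa> * schur_vars x n \<kappa> \<nu> else 0)"
    if \<nu>: "is_partition \<nu>" "lam \<le> \<nu>" for \<nu> e
  proof -
    have "fps_nth (add_vars x n (act ?R' (delta \<mu>)) \<nu>) e =
      (\<Sum>\<kappa>\<in>parts_below \<nu>. schur_vars x n \<kappa> \<nu> * (if \<kappa> \<le> \<mu> \<and> psize \<mu> = psize \<kappa> + e then ?R' \<kappa> \<mu> else 0))"
      unfolding add_vars_nth[OF \<nu>(1)] act_delta_nth[OF \<mu>] ..
    also have "\<dots> = (\<Sum>\<kappa>\<in>parts_below \<mu>. schur_vars x n \<kappa> \<nu> * (if \<kappa> \<le> \<mu> \<and> psize \<mu> = psize \<kappa> + e then ?R' \<kappa> \<mu> else 0))"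
    proof (rule sum.mono_neutral_right[OF finite_parts_below[OF \<nu>(1)]])
      show "parts_below \<mu> \<subseteq> parts_below \<nu>"
        using le \<nu>(2) by (auto simp: parts_below_def)
    qed (auto simp: parts_below_def)
    also have "\<dots> = (\<Sum>\<kappa>\<in>parts_below \<mu>. if psize \<mu> - psize \<kappa> = e
       then (- 1) ^ (psize \<mu> - psize \<kappa>) * inner_weight b \<mu> \<kappa> * schur_vars x n \<kappa> \<nu> else 0)"
    proof (rule sum.cong[OF refl])
      fix \<kappa> assume "\<kappa> \<in> parts_below \<mu>"
      then have \<kappa>: "is_partition \<kappa>" "\<kappa> \<le> \<mu>" by (auto simp: parts_below_def)
      have "psize \<mu> = psize \<kappa> + e \<longleftrightarrow> psize \<mu> - psize \<kappa> = e"
        using psize_mono[OF \<mu> \<kappa>(2)] by auto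
      then show "schur_vars x n \<kappa> \<nu> * (if \<kappa> \<le> \<mu> \<and> psize \<mu> = psize \<kappa> + e then ?R' \<kappa> \<mu> else 0) =
        (if psize \<mu> - psize \<kappa> = e
       then (- 1) ^ (psize \<mu> - psize \<kappa>) * inner_weight b \<mu> \<kappa> * schur_vars x n \<kappa> \<nu> else 0)"
        using \<kappa> by (simp add: conv_inner[OF \<kappa>(1) \<mu> \<kappa>(2)] mult_ac)
    qed
    finally show ?thesis .
  qed
  let ?t = "\<lambda>\<nu> \<kappa>. (- 1) ^ (psize \<mu> - psize \<kappa>) *
       (outer_weight b \<nu> lam * inner_weight b \<mu> \<kappa>) * schur_vars x n \<kappa> \<nu>"
  have "fps_nth (act ?R (add_vars x n (act ?R' (delta \<mu>))) lam) r =
    (\<Sum>\<nu>\<in>parts_above lam r. \<Sum>\<kappa>\<in>parts_below \<mu>.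
      if psize \<mu> - psize \<kappa> = psize lam + r - psize \<nu> then ?t \<nu> \<kappa> else 0)"
    unfolding act_def[of ?R] fps_nth_Abs_fps
  proof (rule sum.cong[OF refl])
    fix \<nu> assume "\<nu> \<in> parts_above lam r"
    then have \<nu>: "is_partition \<nu>" "lam \<le> \<nu>" by (auto simp: parts_above_def)
    show "?R lam \<nu> * fps_nth (add_vars x n (act ?R' (delta \<mu>)) \<nu>) (psize lam + r - psize \<nu>) =
      (\<Sum>\<kappa>\<in>parts_below \<mu>. if psize \<mu> - psize \<kappa> = psize lam + r - psize \<nu> then ?t \<nu> \<kappa> else 0)"
      unfolding inner[OF \<nu>] conv_outer[OF lam \<nu>] sum_distrib_left
      by (intro sum.cong refl) (simp add: mult_ac)
  qed
  also have "\<dots> = (\<Sum>(\<nu>, \<kappa>)\<in>parts_above lam r \<times> parts_below \<mu>.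
      if psize \<mu> - psize \<kappa> = psize lam + r - psize \<nu> then ?t \<nu> \<kappa> else 0)"
    by (rule sum.cartesian_product)
  also have "\<dots> = (\<Sum>(\<nu>, \<kappa>)\<in>shifts lam \<mu> r. ?t \<nu> \<kappa>)"
    by (rule sum.mono_neutral_cong_right)
      (auto simp: finite_parts_above finite_parts_below[OF \<mu>] shifts_iff)
  finally show ?thesis
    unfolding ribbon_operators_cancel[OF lam] const by simp
qed

section \<open>Monotone fillings\<close>

text \<open>
  The order relation is a parameter so that increasing and decreasing fillings can be treated
  at once.
\<close>

definition mono_fillings :: "(cell \<Rightarrow> cell \<Rightarrow> bool) \<Rightarrow> cell set \<Rightarrow> nat \<Rightarrow> filling set" where
  "mono_fillings R D n = {T \<in> D \<rightarrow>\<^sub>E {..<n}. \<forall>c\<in>D. \<forall>d\<in>D. R c d \<longrightarrow> T c \<le> T d}"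

definition lower_sets :: "(cell \<Rightarrow> cell \<Rightarrow> bool) \<Rightarrow> cell set \<Rightarrow> cell set set" where
  "lower_sets R D = {E. E \<subseteq> D \<and> (\<forall>c\<in>D. \<forall>d\<in>E. R c d \<longrightarrow> c \<in> E)}"

definition extend :: "cell set \<Rightarrow> cell set \<Rightarrow> nat \<Rightarrow> filling \<Rightarrow> filling" where
  "extend D E n T c = (if c \<in> E then T c else if c \<in> D then n else undefined)"

lemma finite_mono_fillings: "finite D \<Longrightarrow> finite (mono_fillings R D n)"
  unfolding mono_fillings_def by (rule finite_subset[of _ "D \<rightarrow>\<^sub>E {..<n}"]) (auto intro: finite_PiE)

lemma finite_lower_sets: "finite D \<Longrightarrow> finite (lower_sets R D)"
  by (rule finite_subset[of _ "Pow D"]) (auto simp: lower_sets_def)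

lemma mono_fillings_undefined: "T \<in> mono_fillings R D n \<Longrightarrow> c \<notin> D \<Longrightarrow> T c = undefined"
  by (auto simp: mono_fillings_def dest: PiE_arb)

text \<open>
  The cells of a monotone filling whose entries are smaller than \<open>n\<close> form a lower set, and any
  monotone filling of a lower set can be completed by the entry \<open>n\<close>.
\<close>

lemma sum_mono_fillings_Suc:
  assumes fin: "finite D"
  shows "(\<Sum>T\<in>mono_fillings R D (Suc n). G T) =
    (\<Sum>E\<in>lower_sets R D. \<Sum>T\<in>mono_fillings R E n. G (extend D E n T))"
proof -
  have "(\<Sum>T\<in>mono_fillings R D (Suc n). G T) =
    (\<Sum>(E, T)\<in>(SIGMA E:lower_sets R D. mono_fillings R E n). G (extend D E n T))"
  proof (rule sum.reindex_bij_witness[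
        where j = "\<lambda>T. ({c \<in> D. T c < n}, restrict T {c \<in> D. T c < n})"
          and i = "\<lambda>(E, T). extend D E n T"], goal_cases)
    case (1 T)
    have "T c = n" if "c \<in> D" "\<not> T c < n" for c
      using 1 that by (auto simp: mono_fillings_def PiE_iff less_Suc_eq)
    moreover have "T c = undefined" if "c \<notin> D" for c
      using mono_fillings_undefined[OF 1 that] .
    ultimately show ?case by (auto simp: extend_def fun_eq_iff)
  next
    case (2 T)
    have "c \<in> {c \<in> D. T c < n}" if "c \<in> D" "d \<in> {c \<in> D. T c < n}" "R c d" for c d
    proof -
      have "T c \<le> T d" using 2 that by (auto simp: mono_fillings_def)
      then show ?thesis using that by auto
    qed
    then show ?case
      using 2 by (auto simp: mono_fillings_def lower_sets_def)
  next
    case (3 p)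
    then obtain E T where p: "p = (E, T)" "E \<in> lower_sets R D" "T \<in> mono_fillings R E n" by auto
    have lt: "T c < n" if "c \<in> E" for c using p(3) that by (auto simp: mono_fillings_def PiE_iff)
    have E: "{c \<in> D. extend D E n T c < n} = E"
      using p(2) lt by (auto simp: extend_def lower_sets_def split: if_splits)
    have "T c = undefined" if "c \<notin> E" for c
      using mono_fillings_undefined[OF p(3) that] .
    then have "restrict (extend D E n T) E = T"
      by (auto simp: extend_def fun_eq_iff)
    then show ?case using E p(1) by simp
  next
    case (4 p)
    then obtain E T where p: "p = (E, T)" "E \<in> lower_sets R D" "T \<in> mono_fillings R E n" by auto
    have lt: "T c < n" if "c \<in> E" for c using p(3) that by (auto simp: mono_fillings_def PiE_iff)
    have ext: "extend D E n T \<in> D \<rightarrow>\<^sub>E {..<Suc n}"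
      using p(2) lt less_SucI by (fastforce simp: extend_def lower_sets_def)
    have "extend D E n T c \<le> extend D E n T d" if cd: "c \<in> D" "d \<in> D" "R c d" for c d
    proof (cases "d \<in> E")
      case True
      moreover from True have "c \<in> E" using p(2) cd by (auto simp: lower_sets_def)
      ultimately show ?thesis using p(3) cd by (simp add: extend_def mono_fillings_def)
    next
      case False
      then show ?thesis using cd lt[of c] less_imp_le by (auto simp: extend_def)
    qed
    then show ?case using ext p(1) by (auto simp: mono_fillings_def)
  next
    case (5 T)
    have "T c = n" if "c \<in> D" "\<not> T c < n" for c
      using 5 that by (auto simp: mono_fillings_def PiE_iff less_Suc_eq)
    moreover have "T c = undefined" if "c \<notin> D" for c
      using mono_fillings_undefined[OF 5 that] .
    ultimately have "extend D {c \<in> D. T c < n} n (restrict T {c \<in> D. T c < n}) = T"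
      by (auto simp: extend_def fun_eq_iff)
    then show ?case by simp
  qed
  also have "\<dots> = (\<Sum>E\<in>lower_sets R D. \<Sum>T\<in>mono_fillings R E n. G (extend D E n T))"
    using fin by (intro sum.Sigma[symmetric] finite_lower_sets)
      (auto intro!: finite_mono_fillings simp: lower_sets_def intro: finite_subset)
  finally show ?thesis .
qed

lemma entry_cells_extend:
  assumes "E \<subseteq> D" "T \<in> mono_fillings R E n"
  shows "i < n \<Longrightarrow> entry_cells D (extend D E n T) i = entry_cells E T i"
    and "entry_cells D (extend D E n T) n = D - E"
proof -
  have lt: "T c < n" if "c \<in> E" for c using assms(2) that by (auto simp: mono_fillings_def PiE_iff)
  show "entry_cells D (extend D E n T) i = entry_cells E T i" if "i < n"
    using assms(1) that by (auto simp: entry_cells_def extend_def)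
  show "entry_cells D (extend D E n T) n = D - E"
    using assms(1) lt by (auto simp: entry_cells_def extend_def)
qed

definition before :: "cell \<Rightarrow> cell \<Rightarrow> bool" where
  "before c d \<longleftrightarrow> fst c = fst d \<and> snd c < snd d \<or> snd c = snd d \<and> fst c < fst d"

lemma diagram_diff_outer: "\<mu> \<le> \<nu> \<Longrightarrow> \<nu> \<le> lam \<Longrightarrow> diagram lam \<mu> - diagram \<nu> \<mu> = diagram lam \<nu>"
  by (auto simp: diagram_def not_less not_le le_fun_def intro: order_trans)

lemma diagram_diff_inner: "\<mu> \<le> \<nu> \<Longrightarrow> \<nu> \<le> lam \<Longrightarrow> diagram lam \<mu> - diagram lam \<nu> = diagram \<nu> \<mu>"
  by (auto simp: diagram_def not_less not_le le_fun_def intro: less_le_trans)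

lemma diagram_inj:
  assumes "\<mu> \<le> \<nu>" "\<mu> \<le> \<nu>'" "diagram \<nu> \<mu> = diagram \<nu>' \<mu>"
  shows "\<nu> = \<nu>'"
proof
  fix i
  have *: "\<mu> i \<le> j \<and> j < \<nu> i \<longleftrightarrow> \<mu> i \<le> j \<and> j < \<nu>' i" for j
    using assms(3) by (auto simp: diagram_def set_eq_iff)
  show "\<nu> i = \<nu>' i"
    using *[of "\<nu> i"] *[of "\<nu>' i"] le_funD[OF assms(1), of i] le_funD[OF assms(2), of i]
    by (cases "\<nu> i" "\<nu>' i" rule: linorder_cases) auto
qed

text \<open>
  A lower set meets every row in an initial segment, and the ends of these segments form a
  partition.
\<close>

lemma bij_betw_lower_sets:
  assumes lam: "is_partition lam" and \<mu>: "is_partition \<mu>" and le: "\<mu> \<le> lam"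
  shows "bij_betw (\<lambda>\<nu>. diagram \<nu> \<mu>) (parts_between \<mu> lam) (lower_sets before (diagram lam \<mu>))"
proof (rule bij_betw_imageI)
  show "inj_on (\<lambda>\<nu>. diagram \<nu> \<mu>) (parts_between \<mu> lam)"
    by (auto simp: inj_on_def parts_between_def intro: diagram_inj)
  show "(\<lambda>\<nu>. diagram \<nu> \<mu>) ` parts_between \<mu> lam = lower_sets before (diagram lam \<mu>)"
  proof
    show "(\<lambda>\<nu>. diagram \<nu> \<mu>) ` parts_between \<mu> lam \<subseteq> lower_sets before (diagram lam \<mu>)"
    proof
      fix E assume "E \<in> (\<lambda>\<nu>. diagram \<nu> \<mu>) ` parts_between \<mu> lam"
      then obtain \<nu> where \<nu>: "E = diagram \<nu> \<mu>" "is_partition \<nu>" "\<mu> \<le> \<nu>" "\<nu> \<le> lam"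
        by (auto simp: parts_between_def)
      have "E \<subseteq> diagram lam \<mu>"
        using \<nu> by (auto simp: diagram_def le_fun_def intro: less_le_trans)
      moreover have "(i, j) \<in> E" if "(i, j) \<in> diagram lam \<mu>" "(k, l) \<in> E" "before (i, j) (k, l)" for i j k l
        using that partition_antimono[OF \<nu>(2), of i k] by (auto simp: \<nu>(1) diagram_def before_def)
      ultimately show "E \<in> lower_sets before (diagram lam \<mu>)"
        by (auto simp: lower_sets_def)
    qed
    show "lower_sets before (diagram lam \<mu>) \<subseteq> (\<lambda>\<nu>. diagram \<nu> \<mu>) ` parts_between \<mu> lam"
    proof
      fix E assume "E \<in> lower_sets before (diagram lam \<mu>)"
      then have sub: "E \<subseteq> diagram lam \<mu>"
        and low: "\<And>c d. c \<in> diagram lam \<mu> \<Longrightarrow> d \<in> E \<Longrightarrow> before c d \<Longrightarrow> c \<in> E"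
        by (auto simp: lower_sets_def)
      (* The first cell of row i outside E. *)
      define \<nu> where "\<nu> i = (LEAST j. \<mu> i \<le> j \<and> (i, j) \<notin> E)" for i
      have outside: "(i, max (\<mu> i) (lam i)) \<notin> E" for i
        using sub by (auto simp: diagram_def)
      have "\<mu> i \<le> \<nu> i \<and> (i, \<nu> i) \<notin> E" for i
        unfolding \<nu>_def by (rule LeastI[of _ "max (\<mu> i) (lam i)"]) (use outside in auto)
      then have \<nu>: "\<mu> i \<le> \<nu> i" "(i, \<nu> i) \<notin> E" for i by auto
      have below: "(i, j) \<in> E" if "\<mu> i \<le> j" "j < \<nu> i" for i j
        using that not_less_Least[of j "\<lambda>j. \<mu> i \<le> j \<and> (i, j) \<notin> E"] unfolding \<nu>_def by blast
      have above: "(i, j) \<notin> E" if "\<nu> i \<le> j" for i j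
      proof
        assume E: "(i, j) \<in> E"
        then have "j < lam i" "\<nu> i < j" using sub that \<nu>(2)[of i] by (auto simp: diagram_def le_less)
        then show False
          using low[of "(i, \<nu> i)" "(i, j)"] E \<nu>[of i] by (auto simp: diagram_def before_def)
      qed
      have le_lam: "\<nu> i \<le> lam i" for i
      proof -
        have "(i, lam i) \<notin> E" using sub by (auto simp: diagram_def)
        then show ?thesis
          using le_funD[OF le, of i] below[of i "lam i"] by (auto simp: not_le[symmetric])
      qed
      have "is_partition \<nu>"
      proof -
        obtain N where N: "\<forall>i\<ge>N. lam i = 0" using partition_bound[OF lam] by auto
        show ?thesis
        proof (rule is_partitionI)
          show "\<nu> (Suc i) \<le> \<nu> i" for i
          proof (rule ccontr)
            assume "\<not> \<nu> (Suc i) \<le> \<nu> i"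
            then have lt: "\<nu> i < \<nu> (Suc i)" by simp
            have "\<mu> (Suc i) \<le> \<nu> i"
              using partition_antimono[OF \<mu>, of i "Suc i"] \<nu>(1)[of i] by simp
            then have E: "(Suc i, \<nu> i) \<in> E" using below lt by simp
            have "\<nu> i < lam i"
              using lt le_lam[of "Suc i"] partition_antimono[OF lam, of i "Suc i"] by simp
            then have "(i, \<nu> i) \<in> diagram lam \<mu>" using \<nu>(1) by (simp add: diagram_def)
            then show False using low[OF _ E] \<nu>(2)[of i] by (simp add: before_def)
          qed
          show "\<forall>i\<ge>N. \<nu> i = 0"
            by (rule zero_beyond_mono[OF _ N]) (simp add: le_fun_def le_lam)
        qed
      qed
      moreover have "E = diagram \<nu> \<mu>"
      proof -
        have "(i, j) \<in> E \<longleftrightarrow> (i, j) \<in> diagram \<nu> \<mu>" for i j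
          using sub below[of i j] above[of i j] by (cases "\<nu> i \<le> j") (auto simp: diagram_def)
        then show ?thesis by auto
      qed
      ultimately show "E \<in> (\<lambda>\<nu>. diagram \<nu> \<mu>) ` parts_between \<mu> lam"
        using \<nu>(1) le_lam by (auto simp: parts_between_def le_fun_def)
    qed
  qed
qed

lemma lower_sets_converse: "lower_sets (\<lambda>c d. R d c) D = (\<lambda>E. D - E) ` lower_sets R D"
proof
  show "lower_sets (\<lambda>c d. R d c) D \<subseteq> (\<lambda>E. D - E) ` lower_sets R D"
  proof
    fix E assume "E \<in> lower_sets (\<lambda>c d. R d c) D"
    then have "E = D - (D - E)" "D - E \<in> lower_sets R D"
      by (auto simp: lower_sets_def)
    then show "E \<in> (\<lambda>E. D - E) ` lower_sets R D" by (rule image_eqI)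
  qed
qed (auto simp: lower_sets_def)

text \<open>
  In a decreasing filling the small entries lie outside, so that the largest entry fills an
  inner shape.
\<close>

lemma bij_betw_upper_sets:
  assumes lam: "is_partition lam" and \<mu>: "is_partition \<mu>" and le: "\<mu> \<le> lam"
  shows "bij_betw (\<lambda>\<nu>. diagram lam \<nu>) (parts_between \<mu> lam)
    (lower_sets (\<lambda>c d. before d c) (diagram lam \<mu>))"
proof -
  let ?D = "diagram lam \<mu>"
  have "bij_betw (\<lambda>E. ?D - E) (lower_sets before ?D) (lower_sets (\<lambda>c d. before d c) ?D)"
    by (rule bij_betw_imageI[OF _ lower_sets_converse[symmetric]])
      (auto simp: inj_on_def lower_sets_def)
  from bij_betw_trans[OF bij_betw_lower_sets[OF assms] this]
  have "bij_betw ((\<lambda>E. ?D - E) \<circ> (\<lambda>\<nu>. diagram \<nu> \<mu>)) (parts_between \<mu> lam)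
    (lower_sets (\<lambda>c d. before d c) ?D)" .
  then show ?thesis
    by (rule bij_betw_cong[THEN iffD1, rotated]) (simp add: parts_between_def diagram_diff_outer)
qed

lemma sum_increasing_Suc:
  assumes "is_partition lam" "is_partition \<mu>" "\<mu> \<le> lam"
  shows "(\<Sum>T\<in>mono_fillings before (diagram lam \<mu>) (Suc n). G T) =
    (\<Sum>\<nu>\<in>parts_between \<mu> lam. \<Sum>T\<in>mono_fillings before (diagram \<nu> \<mu>) n.
       G (extend (diagram lam \<mu>) (diagram \<nu> \<mu>) n T))"
  unfolding sum_mono_fillings_Suc[OF finite_diagram[OF assms(1)]]
  by (rule sum.reindex_bij_betw[OF bij_betw_lower_sets[OF assms], symmetric])

lemma sum_decreasing_Suc:
  assumes "is_partition lam" "is_partition \<mu>" "\<mu> \<le> lam"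
  shows "(\<Sum>T\<in>mono_fillings (\<lambda>c d. before d c) (diagram lam \<mu>) (Suc n). G T) =
    (\<Sum>\<nu>\<in>parts_between \<mu> lam. \<Sum>T\<in>mono_fillings (\<lambda>c d. before d c) (diagram lam \<nu>) n.
       G (extend (diagram lam \<mu>) (diagram lam \<nu>) n T))"
  unfolding sum_mono_fillings_Suc[OF finite_diagram[OF assms(1)]]
  by (rule sum.reindex_bij_betw[OF bij_betw_upper_sets[OF assms], symmetric])

section \<open>Coefficients of power series\<close>

definition mono_series :: "mon \<Rightarrow> 'a::comm_ring_1 series" where
  "mono_series a = Series (\<lambda>m. if m = a then 1 else 0)"

definition const_series :: "'a::comm_ring_1 \<Rightarrow> 'a series" where
  "const_series c = scale c 1"

lemma mcoeff_0 [simp]: "mcoeff 0 m = 0" by (simp add: zero_series_def)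
lemma mcoeff_1: "mcoeff 1 m = (if m = 0 then 1 else 0)" by (simp add: one_series_def)
lemma mcoeff_add [simp]: "mcoeff (f + g) m = mcoeff f m + mcoeff g m" by (simp add: plus_series_def)
lemma mcoeff_diff [simp]: "mcoeff (f - g) m = mcoeff f m - mcoeff g m" by (simp add: minus_series_def)
lemma mcoeff_scale [simp]: "mcoeff (scale c f) m = c * mcoeff f m" by (simp add: scale_def)

lemma mcoeff_sum: "mcoeff (\<Sum>i\<in>A. f i) m = (\<Sum>i\<in>A. mcoeff (f i) m)"
  by (induction A rule: infinite_finite_induct) auto

lemma mcoeff_mult: "mcoeff (f * g) m = (\<Sum>(a, b)\<in>{(a, b). a + b = m}. mcoeff f a * mcoeff g b)"
  by (simp add: times_series_def)

lemma mcoeff_mono_mult: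
  "mcoeff (mono_series a * f) m = (if \<exists>b. m = a + b then mcoeff f (m - a) else 0)"
proof -
  have "mcoeff (mono_series a * f) m = (\<Sum>(u, v)\<in>{(u, v). u + v = m \<and> u = a}. mcoeff f v)"
    unfolding mcoeff_mult
    by (rule sum.mono_neutral_cong_right[OF finite_mon_splits]) (auto simp: mono_series_def split: if_splits)
  also have "\<dots> = (if \<exists>b. m = a + b then mcoeff f (m - a) else 0)"
  proof (cases "\<exists>b. m = a + b")
    case True
    then obtain b where b: "m = a + b" ..
    then have "{(u, v). u + v = m \<and> u = a} = {(a, b)}" by auto
    then show ?thesis using b by simp
  next
    case False
    then have "{(u, v). u + v = m \<and> u = a} = {}" by auto
    then show ?thesis using False by (simp only: sum.empty if_False)
  qed
  finally show ?thesis .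
qed

lemma mono_series_0: "mono_series 0 = 1"
  by (simp add: mono_series_def one_series_def)

lemma mono_series_add: "mono_series (a + b) = mono_series a * mono_series b"
proof (rule series_eqI)
  fix m show "mcoeff (mono_series (a + b)) m = mcoeff (mono_series a * mono_series b) m"
    unfolding mcoeff_mono_mult by (auto simp: mono_series_def)
qed

definition var :: "nat \<Rightarrow> 'a::comm_ring_1 series" where
  "var i = mono_series (Poly_Mapping.single i 1)"

lemma var_power: "var i ^ k = mono_series (Poly_Mapping.single i k)"
proof (induction k)
  case (Suc k)
  have "Poly_Mapping.single i (Suc k) = Poly_Mapping.single i 1 + Poly_Mapping.single i k"
    by (simp flip: single_add)
  then show ?case using Suc by (simp add: var_def mono_series_add)
qed (simp add: mono_series_0)

lemma scale_eq_mult: "scale c f = const_series c * f"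
proof (rule series_eqI)
  fix m
  have "mcoeff (const_series c * f) m = c * mcoeff (1 * f) m"
    unfolding mcoeff_mult const_series_def sum_distrib_left mcoeff_scale
    by (auto intro!: sum.cong)
  then show "mcoeff (scale c f) m = mcoeff (const_series c * f) m" by simp
qed

lemma const_series_simps:
  "const_series (c * d) = const_series c * const_series d"
  "const_series (c - d) = const_series c - const_series d"
  "const_series 1 = 1" "const_series 0 = 0" "const_series (- c) = - const_series c"
proof -
  show "const_series (c * d) = const_series c * const_series d"
    unfolding scale_eq_mult[symmetric] by (rule series_eqI) (simp add: const_series_def mult.assoc)
qed (rule series_eqI; simp add: const_series_def left_diff_distrib uminus_series_def)+

lemma const_series_power: "const_series (c ^ n) = const_series c ^ n"
  by (induction n) (simp_all add: const_series_simps)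

text \<open>
  As \<open>f\<close> does not involve the variable \<open>n\<close>, all of its exponent must come from the power.
\<close>

lemma mcoeff_var_power_mult:
  assumes "\<And>m. \<not> Poly_Mapping.keys m \<subseteq> {..<n} \<Longrightarrow> mcoeff f m = 0"
  shows "mcoeff (var n ^ k * f) m =
    (if Poly_Mapping.lookup m n = k \<and> Poly_Mapping.keys m \<subseteq> {..<Suc n}
     then mcoeff f (m - Poly_Mapping.single n k) else 0)"
proof -
  let ?s = "Poly_Mapping.single n k"
  have eq: "mcoeff (var n ^ k * f) m = (if \<exists>b. m = ?s + b then mcoeff f (m - ?s) else 0)"
    unfolding var_power by (rule mcoeff_mono_mult)
  show ?thesis
  proof (cases "Poly_Mapping.lookup m n = k \<and> Poly_Mapping.keys m \<subseteq> {..<Suc n}")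
    case True
    have "m = ?s + (m - ?s)"
      by (rule poly_mapping_eqI) (use True in \<open>auto simp: lookup_add lookup_minus lookup_single when_def\<close>)
    then show ?thesis using eq True by auto
  next
    case False
    have "mcoeff f b = 0" if b: "m = ?s + b" for b
    proof (rule ccontr)
      assume "mcoeff f b \<noteq> 0"
      then have k: "Poly_Mapping.keys b \<subseteq> {..<n}" using assms by blast
      then have "Poly_Mapping.lookup b n = 0" by (auto simp: in_keys_iff)
      then have "Poly_Mapping.lookup m n = k" by (simp add: b lookup_add)
      moreover have "Poly_Mapping.keys m \<subseteq> {..<Suc n}"
        using keys_add[of ?s b] k unfolding b by (auto split: if_splits)
      ultimately show False using False by simp
    qed
    then show ?thesis using eq False by auto
  qed
qed

section \<open>Skew Schur functions in finitely many variables\<close>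

definition column_free :: "cell set \<Rightarrow> bool" where
  "column_free C \<longleftrightarrow> (\<forall>i i' j. (i, j) \<in> C \<and> (i', j) \<in> C \<longrightarrow> i = i')"

lemma hstrip_iff_column_free:
  assumes lam: "is_partition lam" and \<rho>: "is_partition \<rho>" and le: "\<rho> \<le> lam"
  shows "hstrip \<rho> lam \<longleftrightarrow> column_free (diagram lam \<rho>)"
proof
  assume h: "hstrip \<rho> lam"
  have False if "(i, j) \<in> diagram lam \<rho>" "(i', j) \<in> diagram lam \<rho>" "i < i'" for i i' j
  proof -
    have "j < lam (Suc i)"
      using that partition_antimono[OF lam, of "Suc i" i'] by (auto simp: diagram_def)
    also have "\<dots> \<le> \<rho> i" using h by (simp add: hstrip_def)
    finally show False using that by (auto simp: diagram_def)
  qed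
  then show "column_free (diagram lam \<rho>)"
    unfolding column_free_def by (metis linorder_neqE_nat)
next
  assume c: "column_free (diagram lam \<rho>)"
  have "lam (Suc i) \<le> \<rho> i" for i
  proof (rule ccontr)
    assume "\<not> lam (Suc i) \<le> \<rho> i"
    then have "(i, \<rho> i) \<in> diagram lam \<rho>" "(Suc i, \<rho> i) \<in> diagram lam \<rho>"
      using partition_antimono[OF lam, of i "Suc i"] partition_antimono[OF \<rho>, of i "Suc i"]
      by (auto simp: diagram_def)
    then have "i = Suc i" using c unfolding column_free_def by blast
    then show False by simp
  qed
  then show "hstrip \<rho> lam" using le by (simp add: hstrip_def)
qed

definition strip_indicator :: "mon \<Rightarrow> nat \<Rightarrow> cell set \<Rightarrow> 'a::comm_ring_1" where
  "strip_indicator m i C = (if column_free C \<and> card C = Poly_Mapping.lookup m i then 1 else 0)"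

lemma diagram_empty_iff:
  assumes "\<mu> \<le> lam"
  shows "diagram lam \<mu> = {} \<longleftrightarrow> lam = \<mu>"
proof
  assume e: "diagram lam \<mu> = {}"
  show "lam = \<mu>"
  proof
    fix i
    have "(i, \<mu> i) \<notin> diagram lam \<mu>" using e by simp
    then show "lam i = \<mu> i" using le_funD[OF assms, of i] by (simp add: diagram_def)
  qed
qed (auto simp: diagram_def)

lemma mono_fillings_0: "mono_fillings R D 0 = (if D = {} then {\<lambda>_. undefined} else {})"
  by (auto simp: mono_fillings_def PiE_eq_empty_iff)

lemma prod_extend:
  assumes "E \<subseteq> D" "T \<in> mono_fillings R E n"
  shows "(\<Prod>i<Suc n. w i (entry_cells D (extend D E n T) i)) =
    (\<Prod>i<n. w i (entry_cells E T i)) * w n (D - E)"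
  using entry_cells_extend[OF assms] by simp

text \<open>
  Semistandard tableaux are the weakly increasing fillings in which each entry fills a
  horizontal strip.  The branching rule removes the largest entry, whose multiplicity is the
  exponent of the last variable.
\<close>

lemma mcoeff_schur_vars:
  assumes "is_partition lam" "is_partition \<mu>" "\<mu> \<le> lam"
  shows "mcoeff (schur_vars var n \<mu> lam :: 'a::comm_ring_1 series) m =
    (if Poly_Mapping.keys m \<subseteq> {..<n}
     then \<Sum>T\<in>mono_fillings before (diagram lam \<mu>) n.
       \<Prod>i<n. strip_indicator m i (entry_cells (diagram lam \<mu>) T i) else 0)"
  using assms(1,3)
proof (induction n arbitrary: lam m)
  case 0
  show ?case
    using diagram_empty_iff[OF 0(2)] by (auto simp: mono_fillings_0 mcoeff_1)
next
  case (Suc n)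
  let ?S = "{\<rho> \<in> parts_below lam. hstrip \<rho> lam}"
  let ?Z = "\<lambda>m \<rho>. \<Sum>T\<in>mono_fillings before (diagram \<rho> \<mu>) n.
       \<Prod>i<n. strip_indicator m i (entry_cells (diagram \<rho> \<mu>) T i) :: 'a"
  have supp: "mcoeff (schur_vars var n \<mu> \<rho> :: 'a series) m = 0"
    if "is_partition \<rho>" "\<not> Poly_Mapping.keys m \<subseteq> {..<n}" for \<rho> m
    using Suc.IH[OF that(1)] that by (cases "\<mu> \<le> \<rho>") (auto simp: schur_vars_zero)
  have summand: "mcoeff (var n ^ (psize lam - psize \<rho>) * schur_vars var n \<mu> \<rho>) m =
    (if Poly_Mapping.keys m \<subseteq> {..<Suc n} \<and> psize lam - psize \<rho> = Poly_Mapping.lookup m n then ?Z m \<rho> else 0)"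
    if \<rho>: "is_partition \<rho>" "\<mu> \<le> \<rho>" for \<rho>
  proof (cases "Poly_Mapping.keys m \<subseteq> {..<Suc n} \<and> Poly_Mapping.lookup m n = psize lam - psize \<rho>")
    case True
    let ?m = "m - Poly_Mapping.single n (psize lam - psize \<rho>)"
    have lk: "Poly_Mapping.lookup ?m i = (if i = n then 0 else Poly_Mapping.lookup m i)" for i
      using True by (auto simp: lookup_minus lookup_single when_def)
    have "Poly_Mapping.keys ?m \<subseteq> {..<n}"
    proof
      fix i assume "i \<in> Poly_Mapping.keys ?m"
      then have "i \<in> Poly_Mapping.keys m" "i \<noteq> n" by (auto simp: in_keys_iff lk split: if_splits)
      then show "i \<in> {..<n}" using True by auto
    qed
    moreover have "?Z ?m \<rho> = ?Z m \<rho>"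
      by (intro sum.cong prod.cong refl) (simp add: strip_indicator_def lk)
    ultimately show ?thesis
      using True by (simp add: mcoeff_var_power_mult[OF supp[OF \<rho>(1)]] Suc.IH[OF \<rho>])
  next
    case False
    then show ?thesis by (auto simp: mcoeff_var_power_mult[OF supp[OF \<rho>(1)]])
  qed
  have "mcoeff (schur_vars var (Suc n) \<mu> lam :: 'a series) m =
    (\<Sum>\<rho>\<in>?S. mcoeff (var n ^ (psize lam - psize \<rho>) * schur_vars var n \<mu> \<rho> :: 'a series) m)"
    by (simp add: mcoeff_sum)
  also have "\<dots> = (\<Sum>\<rho>\<in>parts_between \<mu> lam. if hstrip \<rho> lam \<and> Poly_Mapping.keys m \<subseteq> {..<Suc n} \<and>
      psize lam - psize \<rho> = Poly_Mapping.lookup m n then ?Z m \<rho> else 0)"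
  proof (rule sum.mono_neutral_cong)
    show "finite ?S" using finite_parts_below[OF Suc.prems(1)] by simp
    show "finite (parts_between \<mu> lam)" by (rule finite_parts_between[OF Suc.prems(1)])
    show "(if hstrip \<rho> lam \<and> Poly_Mapping.keys m \<subseteq> {..<Suc n} \<and>
      psize lam - psize \<rho> = Poly_Mapping.lookup m n then ?Z m \<rho> else 0) = 0"
      if "\<rho> \<in> parts_between \<mu> lam - ?S" for \<rho>
      using that by (auto simp: parts_between_def parts_below_def)
    show "mcoeff (var n ^ (psize lam - psize \<rho>) * schur_vars var n \<mu> \<rho> :: 'a series) m = 0"
      if "\<rho> \<in> ?S - parts_between \<mu> lam" for \<rho>
    proof -
      have "\<not> \<mu> \<le> \<rho>" using that by (auto simp: parts_between_def parts_below_def)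
      then show ?thesis by (simp add: schur_vars_zero)
    qed
    show "mcoeff (var n ^ (psize lam - psize \<rho>) * schur_vars var n \<mu> \<rho> :: 'a series) m =
      (if hstrip \<rho> lam \<and> Poly_Mapping.keys m \<subseteq> {..<Suc n} \<and>
        psize lam - psize \<rho> = Poly_Mapping.lookup m n then ?Z m \<rho> else 0)"
      if "\<rho> \<in> ?S \<inter> parts_between \<mu> lam" for \<rho>
    proof -
      have \<rho>: "is_partition \<rho>" "\<mu> \<le> \<rho>" "hstrip \<rho> lam" using that by (auto simp: parts_between_def)
      show ?thesis unfolding summand[OF \<rho>(1,2)] using \<rho>(3) by simp
    qed
  qed
  also have "\<dots> = (if Poly_Mapping.keys m \<subseteq> {..<Suc n}
     then \<Sum>\<rho>\<in>parts_between \<mu> lam. ?Z m \<rho> * strip_indicator m n (diagram lam \<rho>) else 0)"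
  proof -
    have "(hstrip \<rho> lam \<and> psize lam - psize \<rho> = Poly_Mapping.lookup m n) =
      (column_free (diagram lam \<rho>) \<and> card (diagram lam \<rho>) = Poly_Mapping.lookup m n)"
      if "\<rho> \<in> parts_between \<mu> lam" for \<rho>
      using that Suc.prems by (auto simp: parts_between_def hstrip_iff_column_free card_diagram)
    then show ?thesis
      by (auto simp: strip_indicator_def intro!: sum.cong)
  qed
  also have "(\<Sum>\<rho>\<in>parts_between \<mu> lam. ?Z m \<rho> * strip_indicator m n (diagram lam \<rho>)) =
    (\<Sum>T\<in>mono_fillings before (diagram lam \<mu>) (Suc n).
       \<Prod>i<Suc n. strip_indicator m i (entry_cells (diagram lam \<mu>) T i))"
    unfolding sum_increasing_Suc[OF Suc.prems(1) assms(2) Suc.prems(2)] sum_distrib_right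
  proof (intro sum.cong refl)
    fix \<rho> T assume \<rho>: "\<rho> \<in> parts_between \<mu> lam" and T: "T \<in> mono_fillings before (diagram \<rho> \<mu>) n"
    have le: "\<mu> \<le> \<rho>" "\<rho> \<le> lam" using \<rho> by (auto simp: parts_between_def)
    then have sub: "diagram \<rho> \<mu> \<subseteq> diagram lam \<mu>"
      by (auto simp: diagram_def le_fun_def intro: less_le_trans)
    show "(\<Prod>i<n. strip_indicator m i (entry_cells (diagram \<rho> \<mu>) T i)) * strip_indicator m n (diagram lam \<rho>) =
      (\<Prod>i<Suc n. strip_indicator m i (entry_cells (diagram lam \<mu>)
         (extend (diagram lam \<mu>) (diagram \<rho> \<mu>) n T) i) :: 'a)"
      unfolding prod_extend[OF sub T] diagram_diff_outer[OF le] ..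
  qed
  finally show ?case .
qed

lemma mcoeff_skew_schur:
  assumes lam: "is_partition lam" and \<mu>: "is_partition \<mu>" and le: "\<mu> \<le> lam"
    and m: "Poly_Mapping.keys m \<subseteq> {..<n}"
  shows "mcoeff (skew_schur lam \<mu>) m = mcoeff (schur_vars var n \<mu> lam) m"
proof -
  let ?D = "diagram lam \<mu>"
  let ?P = "\<lambda>T. \<forall>i<n. column_free (entry_cells ?D T i) \<and> card (entry_cells ?D T i) = Poly_Mapping.lookup m i"
  have fin: "finite ?D" by (rule finite_diagram[OF lam])
  have m0: "Poly_Mapping.lookup m i = 0" if "\<not> i < n" for i
    using m that by (meson in_keys_iff lessThan_iff subsetD)
  have "{T \<in> ?D \<rightarrow>\<^sub>E UNIV. rows_weakly_incr ?D T \<and> cols_strictly_incr ?D T \<and>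
      (\<forall>i. card (entry_cells ?D T i) = Poly_Mapping.lookup m i)} =
    {T \<in> mono_fillings before ?D n. ?P T}" (is "?L = ?R")
  proof
    show "?L \<subseteq> ?R"
    proof
      fix T assume T: "T \<in> ?L"
      have "T c < n" if c: "c \<in> ?D" for c
      proof (rule ccontr)
        assume "\<not> T c < n"
        then have "card (entry_cells ?D T (T c)) = 0" using T m0 by simp
        moreover have "finite (entry_cells ?D T (T c))" using fin by (simp add: entry_cells_def)
        moreover have "c \<in> entry_cells ?D T (T c)" using c by (simp add: entry_cells_def)
        ultimately show False by (metis card_0_eq empty_iff)
      qed
      moreover have "T c \<le> T d" if "c \<in> ?D" "d \<in> ?D" "before c d" for c d
        using that T by (cases c; cases d) (auto simp: before_def rows_weakly_incr_def cols_strictly_incr_def intro: less_imp_le)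
      moreover have "column_free (entry_cells ?D T i)" for i
      proof -
        have "\<not> k < l" if "(k, j) \<in> entry_cells ?D T i" "(l, j) \<in> entry_cells ?D T i" for j k l
          using that T by (fastforce simp: entry_cells_def cols_strictly_incr_def)
        then show ?thesis unfolding column_free_def by (metis linorder_neqE_nat)
      qed
      ultimately show "T \<in> ?R"
        using T by (auto simp: mono_fillings_def PiE_iff)
    qed
    show "?R \<subseteq> ?L"
    proof
      fix T assume T: "T \<in> ?R"
      then have mono: "T c \<le> T d" if "c \<in> ?D" "d \<in> ?D" "before c d" for c d
        using that by (auto simp: mono_fillings_def)
      have lt: "T c < n" if "c \<in> ?D" for c
        using T that by (auto simp: mono_fillings_def PiE_iff)
      have "T (i, j) < T (i', j)" if "(i, j) \<in> ?D" "(i', j) \<in> ?D" "i < i'" for i i' j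
      proof -
        have "T (i, j) \<noteq> T (i', j)"
        proof
          assume "T (i, j) = T (i', j)"
          then have "(i, j) \<in> entry_cells ?D T (T (i, j))" "(i', j) \<in> entry_cells ?D T (T (i, j))"
            using that by (auto simp: entry_cells_def)
          moreover have "column_free (entry_cells ?D T (T (i, j)))"
            using T lt[OF that(1)] by auto
          ultimately show False using that(3) unfolding column_free_def by blast
        qed
        then show ?thesis using mono[OF that(1,2)] that(3) by (simp add: before_def)
      qed
      moreover have "T (i, j) \<le> T (i, j')" if "(i, j) \<in> ?D" "(i, j') \<in> ?D" "j < j'" for i j j'
        using mono[OF that(1,2)] that(3) by (simp add: before_def)
      moreover have "card (entry_cells ?D T i) = Poly_Mapping.lookup m i" for i
      proof (cases "i < n")
        case False
        then have "entry_cells ?D T i = {}" using lt by (auto simp: entry_cells_def)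
        then show ?thesis using m0[OF False] by simp
      qed (use T in auto)
      ultimately show "T \<in> ?L"
        using T by (auto simp: mono_fillings_def PiE_iff rows_weakly_incr_def cols_strictly_incr_def)
    qed
  qed
  moreover have "(\<Sum>T\<in>mono_fillings before ?D n. \<Prod>i<n. strip_indicator m i (entry_cells ?D T i)) =
    (of_nat (card {T \<in> mono_fillings before ?D n. ?P T}) :: int poly)"
  proof -
    have "(\<Prod>i<n. strip_indicator m i (entry_cells ?D T i)) = (if ?P T then 1 else 0 :: int poly)" for T
      unfolding strip_indicator_def by (auto intro!: prod.neutral prod_zero)
    then show ?thesis
      by (simp add: sum.If_cases finite_mono_fillings[OF fin] Int_def)
  qed
  ultimately show ?thesis
    using m by (simp add: skew_schur_def mcoeff_schur_vars[OF lam \<mu> le])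
qed

section \<open>Quantum power sums\<close>

definition mon_degree :: "mon \<Rightarrow> nat" where
  "mon_degree m = (\<Sum>i\<in>Poly_Mapping.keys m. Poly_Mapping.lookup m i)"

text \<open>
  The condition under which \<open>m\<close> occurs in the monomial symmetric function of \<open>\<tau>\<close>.
\<close>

definition rearranges :: "(nat \<Rightarrow> nat) \<Rightarrow> (nat \<Rightarrow> nat) \<Rightarrow> mon \<Rightarrow> bool" where
  "rearranges v \<tau> m \<longleftrightarrow> inj_on v {..<num_parts \<tau>} \<and>
     m = (\<Sum>k<num_parts \<tau>. Poly_Mapping.single (v k) (\<tau> k))"

lemma mon_eq_sum_singles:
  "(\<Sum>i\<in>Poly_Mapping.keys m. Poly_Mapping.single i (Poly_Mapping.lookup m i)) = (m :: mon)"
  by (rule poly_mapping_eqI)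
    (simp add: lookup_sum lookup_single when_def in_keys_iff)

lemma rearranges_lookup:
  assumes "rearranges v \<tau> m" "k < num_parts \<tau>"
  shows "Poly_Mapping.lookup m (v k) = \<tau> k"
proof -
  have "Poly_Mapping.lookup m (v k) = (\<Sum>j<num_parts \<tau>. if v j = v k then \<tau> j else 0)"
    using assms(1) by (simp add: rearranges_def lookup_sum lookup_single when_def)
  also have "\<dots> = (\<Sum>j<num_parts \<tau>. if j = k then \<tau> j else 0)"
    using assms by (intro sum.cong) (auto simp: rearranges_def inj_on_def)
  finally show ?thesis using assms(2) by simp
qed

lemma rearranges_keys:
  assumes "is_partition \<tau>" "rearranges v \<tau> m"
  shows "Poly_Mapping.keys m = v ` {..<num_parts \<tau>}"
proof
  show "v ` {..<num_parts \<tau>} \<subseteq> Poly_Mapping.keys m"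
    using rearranges_lookup[OF assms(2)] num_parts_iff[OF assms(1)] by (auto simp: in_keys_iff)
  show "Poly_Mapping.keys m \<subseteq> v ` {..<num_parts \<tau>}"
  proof
    fix i assume i: "i \<in> Poly_Mapping.keys m"
    show "i \<in> v ` {..<num_parts \<tau>}"
    proof (rule ccontr)
      assume "i \<notin> v ` {..<num_parts \<tau>}"
      then have "Poly_Mapping.lookup m i = 0"
        using assms(2) by (auto simp: rearranges_def lookup_sum lookup_single when_def intro!: sum.neutral)
      then show False using i by (simp add: in_keys_iff)
    qed
  qed
qed

lemma rearranges_inj: "rearranges v \<tau> m \<Longrightarrow> inj_on v {..<num_parts \<tau>}"
  by (simp add: rearranges_def)

lemma rearranges_card_keys:
  assumes "is_partition \<tau>" "rearranges v \<tau> m"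
  shows "card (Poly_Mapping.keys m) = num_parts \<tau>"
  by (simp add: rearranges_keys[OF assms] card_image[OF rearranges_inj[OF assms(2)]])

lemma rearranges_degree:
  assumes "is_partition \<tau>" "rearranges v \<tau> m"
  shows "mon_degree m = psize \<tau>"
proof -
  have "mon_degree m = (\<Sum>k<num_parts \<tau>. Poly_Mapping.lookup m (v k))"
    by (simp add: mon_degree_def rearranges_keys[OF assms] sum.reindex[OF rearranges_inj[OF assms(2)]])
  also have "\<dots> = (\<Sum>k<num_parts \<tau>. \<tau> k)"
    by (simp add: rearranges_lookup[OF assms(2)])
  also have "\<dots> = psize \<tau>"
    by (rule psize_eq_sum[symmetric]) (use num_parts_iff[OF assms(1)] in \<open>auto simp: not_less[symmetric]\<close>)
  finally show ?thesis .
qed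

text \<open>
  The parts of size at least \<open>c\<close> form an initial segment of \<open>\<tau>\<close>, so \<open>\<tau>\<close> can be read off from the
  numbers of exponents of size at least \<open>c\<close>.
\<close>

lemma rearranges_at_least:
  assumes \<tau>: "is_partition \<tau>" and v: "rearranges v \<tau> m" and c: "0 < c"
  shows "c \<le> \<tau> k \<longleftrightarrow> k < card {i. c \<le> Poly_Mapping.lookup m i}"
proof -
  let ?S = "{k. c \<le> \<tau> k}"
  have sub: "?S \<subseteq> {..<num_parts \<tau>}"
    using c by (auto simp: num_parts_iff[OF \<tau>])
  have "{i. c \<le> Poly_Mapping.lookup m i} = v ` ?S"
  proof
    show "{i. c \<le> Poly_Mapping.lookup m i} \<subseteq> v ` ?S"
    proof
      fix i assume i: "i \<in> {i. c \<le> Poly_Mapping.lookup m i}"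
      then have "i \<in> Poly_Mapping.keys m" using c by (auto simp: in_keys_iff)
      then obtain k where "k < num_parts \<tau>" "i = v k"
        using rearranges_keys[OF \<tau> v] by auto
      then show "i \<in> v ` ?S" using i rearranges_lookup[OF v] by auto
    qed
    show "v ` ?S \<subseteq> {i. c \<le> Poly_Mapping.lookup m i}"
      using sub rearranges_lookup[OF v] by auto
  qed
  moreover have "inj_on v ?S"
    using v sub by (auto simp: rearranges_def intro: inj_on_subset)
  ultimately have "card {i. c \<le> Poly_Mapping.lookup m i} = card ?S"
    by (simp add: card_image)
  moreover have "?S = {..<card ?S}"
  proof (rule down_closed_eq_lessThan)
    show "finite ?S" by (rule finite_subset[OF sub]) simp
    show "j \<in> ?S" if "j \<le> i" "i \<in> ?S" for i j
      using that partition_antimono[OF \<tau>, of j i] by simp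
  qed
  ultimately show ?thesis by auto
qed

lemma rearranges_unique:
  assumes "is_partition \<tau>" "rearranges v \<tau> m" "is_partition \<sigma>" "rearranges w \<sigma> m"
  shows "\<tau> = \<sigma>"
proof
  fix k
  have *: "c \<le> \<tau> k \<longleftrightarrow> c \<le> \<sigma> k" for c
    using rearranges_at_least[OF assms(1,2), of c k] rearranges_at_least[OF assms(3,4), of c k]
    by (cases "c = 0") auto
  show "\<tau> k = \<sigma> k" using *[of "\<tau> k"] *[of "\<sigma> k"] by simp
qed

lemma rearranges_exists: "\<exists>\<tau> v. is_partition \<tau> \<and> rearranges v \<tau> m"
proof -
  (* The variables of m, sorted by decreasing exponent. *)
  define ks where "ks = rev (sort_key (Poly_Mapping.lookup m) (sorted_list_of_set (Poly_Mapping.keys m)))"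
  define \<tau> where "\<tau> k = (if k < length ks then Poly_Mapping.lookup m (ks ! k) else 0)" for k
  have set: "set ks = Poly_Mapping.keys m" and dist: "distinct ks"
    by (simp_all add: ks_def)
  have sorted: "sorted (rev (map (Poly_Mapping.lookup m) ks))"
    by (simp add: ks_def rev_map)
  have \<tau>: "is_partition \<tau>"
  proof (rule is_partitionI)
    show "\<tau> (Suc i) \<le> \<tau> i" for i
      using sorted_rev_nth_mono[OF sorted, of i "Suc i"] by (simp add: \<tau>_def)
    show "\<forall>i\<ge>length ks. \<tau> i = 0" by (simp add: \<tau>_def)
  qed
  have "\<tau> i \<noteq> 0 \<longleftrightarrow> i < length ks" for i
  proof (cases "i < length ks")
    case True
    then have "ks ! i \<in> Poly_Mapping.keys m" using nth_mem set by blast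
    then show ?thesis using True by (simp add: \<tau>_def in_keys_iff)
  qed (simp add: \<tau>_def)
  then have "{i. \<tau> i \<noteq> 0} = {..<length ks}" by auto
  then have np: "num_parts \<tau> = length ks" by (simp add: num_parts_def)
  have bij: "bij_betw ((!) ks) {..<length ks} (Poly_Mapping.keys m)"
    by (rule bij_betw_nth[OF dist]) (simp_all add: set)
  have "(\<Sum>k<length ks. Poly_Mapping.single (ks ! k) (\<tau> k)) =
    (\<Sum>k<length ks. Poly_Mapping.single (ks ! k) (Poly_Mapping.lookup m (ks ! k)))"
    by (intro sum.cong) (auto simp: \<tau>_def)
  also have "\<dots> = m"
    using sum.reindex_bij_betw[OF bij, of "\<lambda>i. Poly_Mapping.single i (Poly_Mapping.lookup m i)"]
    by (simp add: mon_eq_sum_singles)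
  finally have "rearranges ((!) ks) \<tau> m"
    using bij by (simp add: rearranges_def np bij_betw_def)
  then show ?thesis using \<tau> by blast
qed

text \<open>
  Every monomial occurs in exactly one monomial symmetric function, that of its sorted
  exponents.
\<close>

lemma mcoeff_quantum_power_sum:
  "mcoeff (quantum_power_sum r) m =
    (if mon_degree m = r then (1 - q) ^ (card (Poly_Mapping.keys m) - 1) else 0)"
proof -
  let ?P = "{\<tau>. is_partition \<tau> \<and> psize \<tau> = r}"
  obtain \<sigma> w where \<sigma>: "is_partition \<sigma>" "rearranges w \<sigma> m" using rearranges_exists by blast
  have fin: "finite ?P"
    by (rule finite_subset[OF _ finite_parts_size[of r]]) auto
  have sgn: "(- 1) ^ k * (q - 1) ^ k = (1 - q) ^ k" for k
    by (simp flip: power_mult_distrib)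
  have coeff: "mcoeff (monomial_sym \<tau>) m = (if \<tau> = \<sigma> then 1 else 0)" if "is_partition \<tau>" for \<tau>
  proof -
    have "(\<exists>v. rearranges v \<tau> m) \<longleftrightarrow> \<tau> = \<sigma>"
      using rearranges_unique[OF that _ \<sigma>] \<sigma>(2) by blast
    then show ?thesis by (simp add: monomial_sym_def rearranges_def)
  qed
  have "mcoeff (quantum_power_sum r) m =
    (\<Sum>\<tau>\<in>?P. if \<tau> = \<sigma> then (1 - q) ^ (num_parts \<sigma> - 1) else 0)"
    unfolding quantum_power_sum_def mcoeff_sum mcoeff_scale sgn
    by (intro sum.cong) (auto simp: coeff)
  also have "\<dots> = (if psize \<sigma> = r then (1 - q) ^ (num_parts \<sigma> - 1) else 0)"
    using fin \<sigma>(1) by simp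
  finally show ?thesis
    by (simp add: rearranges_degree[OF \<sigma>] rearranges_card_keys[OF \<sigma>])
qed

lemma ribbon_factor_nth:
  "fps_nth (ribbon_factor b x) k = (if k = 0 then 1 else 1 - b) * x ^ k"
  by (cases k) (simp_all add: ribbon_factor_def left_diff_distrib mult.assoc)

lemma mon_degree_split:
  "mon_degree m = Poly_Mapping.lookup m n + mon_degree (m - Poly_Mapping.single n (Poly_Mapping.lookup m n))"
  "Poly_Mapping.keys (m - Poly_Mapping.single n (Poly_Mapping.lookup m n)) = Poly_Mapping.keys m - {n}"
proof -
  let ?m = "m - Poly_Mapping.single n (Poly_Mapping.lookup m n)"
  have lk: "Poly_Mapping.lookup ?m i = (if i = n then 0 else Poly_Mapping.lookup m i)" for i
    by (auto simp: lookup_minus lookup_single when_def)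
  show keys: "Poly_Mapping.keys ?m = Poly_Mapping.keys m - {n}"
    by (auto simp: in_keys_iff lk split: if_splits)
  have "mon_degree ?m = (\<Sum>i\<in>Poly_Mapping.keys m - {n}. Poly_Mapping.lookup m i)"
    unfolding mon_degree_def keys by (intro sum.cong) (auto simp: lk)
  then show "mon_degree m = Poly_Mapping.lookup m n + mon_degree ?m"
    unfolding mon_degree_def[of m]
    by (cases "n \<in> Poly_Mapping.keys m") (simp_all add: sum.remove in_keys_iff)
qed

text \<open>
  All coefficients of \<open>ribbon_factor c x\<close> except the constant one are \<open>1 - c\<close> times a power of
  \<open>x\<close>, so each variable that occurs in \<open>m\<close> contributes \<open>1 - c\<close>.
\<close>

lemma mcoeff_ribbon_factors:
  fixes c :: "'a::comm_ring_1"
  shows "mcoeff (fps_nth (\<Prod>i<n. ribbon_factor (const_series c) (var i)) r) m =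
    (if Poly_Mapping.keys m \<subseteq> {..<n} \<and> mon_degree m = r then (1 - c) ^ card (Poly_Mapping.keys m) else 0)"
proof (induction n arbitrary: r m)
  case 0
  show ?case by (auto simp: mcoeff_1 mon_degree_def)
next
  case (Suc n)
  let ?W = "\<lambda>r. fps_nth (\<Prod>i<n. ribbon_factor (const_series c) (var i)) r"
  let ?l = "Poly_Mapping.lookup m n" and ?m = "m - Poly_Mapping.single n (Poly_Mapping.lookup m n)"
  let ?d = "\<lambda>j. if j = 0 then 1 else 1 - c"
  have supp: "mcoeff (?W k) m = 0" if "\<not> Poly_Mapping.keys m \<subseteq> {..<n}" for k m
    using that by (simp add: Suc.IH)
  have summand: "mcoeff (?W k * fps_nth (ribbon_factor (const_series c) (var n)) j) m =
    (if ?l = j \<and> Poly_Mapping.keys m \<subseteq> {..<Suc n} then ?d j * mcoeff (?W k) ?m else 0)" for k j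
  proof -
    have "?W k * fps_nth (ribbon_factor (const_series c) (var n)) j = scale (?d j) (var n ^ j * ?W k)"
      by (simp add: ribbon_factor_nth scale_eq_mult const_series_simps mult_ac)
    then show ?thesis by (simp add: mcoeff_var_power_mult[OF supp])
  qed
  have "mcoeff (fps_nth (\<Prod>i<Suc n. ribbon_factor (const_series c) (var i)) r) m =
    (\<Sum>k=0..r. mcoeff (?W k * fps_nth (ribbon_factor (const_series c) (var n)) (r - k)) m)"
    by (simp add: fps_mult_nth mcoeff_sum)
  also have "\<dots> = (\<Sum>k=0..r. if k = r - ?l then
      (if ?l \<le> r \<and> Poly_Mapping.keys m \<subseteq> {..<Suc n} then ?d ?l * mcoeff (?W (r - ?l)) ?m else 0) else 0)"
    unfolding summand by (intro sum.cong refl) auto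
  also have "\<dots> = (if ?l \<le> r \<and> Poly_Mapping.keys m \<subseteq> {..<Suc n} then ?d ?l * mcoeff (?W (r - ?l)) ?m else 0)"
    by simp
  also have "\<dots> = (if Poly_Mapping.keys m \<subseteq> {..<Suc n} \<and> mon_degree m = r
      then (1 - c) ^ card (Poly_Mapping.keys m) else 0)"
  proof (cases "?l \<le> r \<and> Poly_Mapping.keys m \<subseteq> {..<Suc n}")
    case True
    have "Poly_Mapping.keys m - {n} \<subseteq> {..<n}" using True by (auto simp: less_Suc_eq)
    moreover have "mon_degree ?m = r - ?l \<longleftrightarrow> mon_degree m = r"
      using mon_degree_split(1)[of m n] True by auto
    moreover have "?d ?l * (1 - c) ^ card (Poly_Mapping.keys m - {n}) = (1 - c) ^ card (Poly_Mapping.keys m)"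
    proof (cases "n \<in> Poly_Mapping.keys m")
      case True
      then have card: "card (Poly_Mapping.keys m) = Suc (card (Poly_Mapping.keys m - {n}))"
        by (intro card.remove) simp_all
      have "?l \<noteq> 0" using True by (simp add: in_keys_iff)
      then show ?thesis unfolding card power_Suc by simp
    qed (simp add: in_keys_iff)
    ultimately show ?thesis
      using True by (simp add: Suc.IH mon_degree_split(2))
  next
    case False
    have "?l \<le> mon_degree m"
      by (subst mon_degree_split(1)[of m n]) (rule le_add1)
    then show ?thesis using False by auto
  qed
  finally show ?case .
qed

section \<open>The rule for a single quantum power sum\<close>

text \<open>
  The contribution of one entry of a pair of tableaux, if \<open>C\<close> and \<open>D\<close> are the cells that it
  occupies in the two tableaux.
\<close>

definition step_weight :: "'a::comm_ring_1 \<Rightarrow> nat \<Rightarrow> cell set \<Rightarrow> cell set \<Rightarrow> 'a" where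
  "step_weight b r C D = (if broken_ribbon C \<and> broken_ribbon D \<and> card C + card D = r
     then (- b) ^ (ht C + wt D) * (1 - b) ^ (rib C + rib D - 1) else 0)"

lemma rib_pos:
  assumes "finite C" "C \<noteq> {}"
  shows "0 < rib C"
proof -
  have "linked C \<subseteq> C \<times> C" by (auto simp: linked_def)
  then have "finite (components C)"
    unfolding components_def using assms(1) by (rule finite_quotient[rotated])
  moreover have "components C \<noteq> {}"
    using assms(2) by (auto simp: components_def quotient_def)
  ultimately show ?thesis by (simp add: rib_def card_gt_0_iff)
qed

lemma outer_inner_weight:
  fixes b :: "'a::comm_ring_1"
  assumes lam: "is_partition lam" and \<mu>: "is_partition \<mu>"
    and s: "(\<nu>, \<kappa>) \<in> shifts lam \<mu> r" and r: "0 < r"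
  shows "outer_weight b \<nu> lam * inner_weight b \<mu> \<kappa> =
    (1 - b) * step_weight b r (diagram \<nu> lam) (diagram \<mu> \<kappa>)"
proof -
  let ?C = "diagram \<nu> lam" and ?D = "diagram \<mu> \<kappa>"
  have s': "is_partition \<nu>" "lam \<le> \<nu>" "\<kappa> \<le> \<mu>" "psize \<nu> - psize lam + (psize \<mu> - psize \<kappa>) = r"
    using s by (auto simp: shifts_def)
  have card: "card ?C + card ?D = r"
    using s' by (simp add: card_diagram[OF s'(1,2)] card_diagram[OF \<mu> s'(3)])
  have fin: "finite ?C" "finite ?D" by (auto intro: finite_diagram s' \<mu>)
  have "?C \<noteq> {} \<or> ?D \<noteq> {}" using card r by auto
  then have "0 < rib ?C + rib ?D"
    using rib_pos[OF fin(1)] rib_pos[OF fin(2)] add_pos_pos by (elim disjE) simp_all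
  then obtain k where k: "rib ?C + rib ?D = Suc k" by (auto simp: gr0_conv_Suc)
  have pw: "(1 - b) ^ rib ?C * (1 - b) ^ rib ?D = (1 - b) * (1 - b) ^ (rib ?C + rib ?D - 1)"
    unfolding power_add[symmetric] k by simp
  show ?thesis
  proof (cases "broken_ribbon ?C \<and> broken_ribbon ?D")
    case True
    then have "outer_weight b \<nu> lam * inner_weight b \<mu> \<kappa> =
      ((- b) ^ ht ?C * (- b) ^ wt ?D) * ((1 - b) ^ rib ?C * (1 - b) ^ rib ?D)"
      by (simp add: outer_weight_def inner_weight_def mult_ac)
    also have "\<dots> = (1 - b) * ((- b) ^ (ht ?C + wt ?D) * (1 - b) ^ (rib ?C + rib ?D - 1))"
      unfolding pw power_add by (simp only: mult_ac)
    finally show ?thesis using True card by (simp add: step_weight_def)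
  qed (auto simp: outer_weight_def inner_weight_def step_weight_def)
qed

lemma const_series_weights:
  "outer_weight (const_series b) \<kappa> lam = const_series (outer_weight b \<kappa> lam)"
  "inner_weight (const_series b) \<kappa> lam = const_series (inner_weight b \<kappa> lam)"
  by (simp_all add: outer_weight_def inner_weight_def const_series_simps const_series_power)

lemma mcoeff_mult_cong:
  assumes "\<And>a. Poly_Mapping.keys a \<subseteq> Poly_Mapping.keys m \<Longrightarrow> mcoeff f a = mcoeff f' a"
    and "\<And>a. Poly_Mapping.keys a \<subseteq> Poly_Mapping.keys m \<Longrightarrow> mcoeff g a = mcoeff g' a"
  shows "mcoeff (f * g) m = mcoeff (f' * g') m"
  unfolding mcoeff_mult
proof (rule sum.cong[OF refl])
  fix p assume "p \<in> {(a, b). a + b = m}"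
  then obtain a b where p: "p = (a, b)" "m = a + b" by auto
  then have "Poly_Mapping.keys a \<subseteq> Poly_Mapping.keys m" "Poly_Mapping.keys b \<subseteq> Poly_Mapping.keys m"
    by (auto simp: in_keys_iff lookup_add)
  then show "(case p of (a, b) \<Rightarrow> mcoeff f a * mcoeff g b) = (case p of (a, b) \<Rightarrow> mcoeff f' a * mcoeff g' b)"
    using assms p(1) by simp
qed

text \<open>
  The rule in finitely many variables determines the coefficient of each monomial up to the
  common factor \<open>1 - q\<close>, which cancels because \<open>\<int>[q]\<close> is an integral domain.
\<close>

lemma skew_schur_times_quantum_power_sum:
  assumes lam: "is_partition lam" and \<mu>: "is_partition \<mu>" and le: "\<mu> \<le> lam" and r: "0 < r"
  shows "skew_schur lam \<mu> * quantum_power_sum r =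
    (\<Sum>(\<nu>, \<kappa>)\<in>shifts lam \<mu> r.
       scale ((- 1) ^ (psize \<mu> - psize \<kappa>) * step_weight q r (diagram \<nu> lam) (diagram \<mu> \<kappa>)) (skew_schur \<nu> \<kappa>))"
    (is "_ = ?R")
proof (rule series_eqI)
  fix m :: mon
  obtain n where n: "Poly_Mapping.keys m \<subseteq> {..<n}"
    using finite_nat_iff_bounded[of "Poly_Mapping.keys m"] by auto
  let ?W = "fps_nth (\<Prod>i<n. ribbon_factor (const_series q) (var i)) r"
  let ?w = "\<lambda>\<nu> \<kappa>. (- 1) ^ (psize \<mu> - psize \<kappa>) * step_weight q r (diagram \<nu> lam) (diagram \<mu> \<kappa>)"
  have W: "mcoeff ?W a = mcoeff (const_series (1 - q) * quantum_power_sum r) a"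
    if "Poly_Mapping.keys a \<subseteq> Poly_Mapping.keys m" for a
  proof -
    have "card (Poly_Mapping.keys a) \<noteq> 0" if "mon_degree a = r"
      using that r by (auto simp: mon_degree_def)
    moreover have "Poly_Mapping.keys a \<subseteq> {..<n}" using that n by blast
    ultimately show ?thesis
      unfolding scale_eq_mult[symmetric] mcoeff_scale mcoeff_quantum_power_sum mcoeff_ribbon_factors
      by (cases "card (Poly_Mapping.keys a)") auto
  qed
  have S: "mcoeff (schur_vars var n \<kappa> \<nu>) a = mcoeff (skew_schur \<nu> \<kappa>) a"
    if "Poly_Mapping.keys a \<subseteq> Poly_Mapping.keys m" "is_partition \<nu>" "is_partition \<kappa>" "\<kappa> \<le> \<nu>" for a \<nu> \<kappa>
    using that n by (intro mcoeff_skew_schur[symmetric]) auto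
  have "(1 - q) * mcoeff (skew_schur lam \<mu> * quantum_power_sum r) m =
    mcoeff (const_series (1 - q) * quantum_power_sum r * skew_schur lam \<mu>) m"
    by (simp flip: scale_eq_mult mcoeff_scale add: scale_eq_mult mult_ac)
  also have "\<dots> = mcoeff (?W * schur_vars var n \<mu> lam) m"
    by (rule mcoeff_mult_cong) (erule W[symmetric], erule S[OF _ lam \<mu> le, symmetric])
  also have "\<dots> = mcoeff (\<Sum>(\<nu>, \<kappa>)\<in>shifts lam \<mu> r. (- 1) ^ (psize \<mu> - psize \<kappa>) *
       (outer_weight (const_series q) \<nu> lam * inner_weight (const_series q) \<mu> \<kappa>) * schur_vars var n \<kappa> \<nu>) m"
    unfolding ribbon_rule_finite[OF lam \<mu> le] ..
  also have "\<dots> = (\<Sum>(\<nu>, \<kappa>)\<in>shifts lam \<mu> r. (1 - q) * (?w \<nu> \<kappa> * mcoeff (skew_schur \<nu> \<kappa>) m))"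
    unfolding mcoeff_sum split_def
  proof (intro sum.cong refl)
    fix p assume "p \<in> shifts lam \<mu> r"
    moreover obtain \<nu> \<kappa> where p: "p = (\<nu>, \<kappa>)" by force
    ultimately have s: "(\<nu>, \<kappa>) \<in> shifts lam \<mu> r" by simp
    then have \<nu>: "is_partition \<nu>" "is_partition \<kappa>" "\<kappa> \<le> \<nu>"
      using le order_trans by (auto simp: shifts_def)
    let ?o = "outer_weight q \<nu> lam * inner_weight q \<mu> \<kappa>"
    have eq: "(- 1) ^ (psize \<mu> - psize \<kappa>) *
       (outer_weight (const_series q) \<nu> lam * inner_weight (const_series q) \<mu> \<kappa>) * schur_vars var n \<kappa> \<nu> =
       scale ((- 1) ^ (psize \<mu> - psize \<kappa>) * ?o) (schur_vars var n \<kappa> \<nu>)"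
      by (simp add: scale_eq_mult const_series_weights const_series_simps const_series_power mult_ac)
    show "mcoeff ((- 1) ^ (psize \<mu> - psize (snd p)) *
       (outer_weight (const_series q) (fst p) lam * inner_weight (const_series q) \<mu> (snd p)) *
         schur_vars var n (snd p) (fst p)) m =
      (1 - q) * (?w (fst p) (snd p) * mcoeff (skew_schur (fst p) (snd p)) m)"
      unfolding p fst_conv snd_conv eq
      unfolding mcoeff_scale outer_inner_weight[OF lam \<mu> s r] S[OF order_refl \<nu>]
      by (simp only: mult_ac)
  qed
  also have "\<dots> = (1 - q) * mcoeff ?R m"
    by (simp add: mcoeff_sum sum_distrib_left split_def)
  finally have "(1 - q) * mcoeff (skew_schur lam \<mu> * quantum_power_sum r) m = (1 - q) * mcoeff ?R m" .
  moreover have "1 - q \<noteq> 0"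
  proof
    assume "1 - q = 0"
    then have "coeff (1 - q) 0 = 0" by simp
    then show False by simp
  qed
  ultimately show "mcoeff (skew_schur lam \<mu> * quantum_power_sum r) m = mcoeff ?R m"
    by simp
qed

section \<open>Products of quantum power sums\<close>

text \<open>
  The sum over pairs of tableaux as a sum over all pairs of monotone fillings: those whose
  entries do not fill broken ribbons of the right total size have weight \<open>0\<close>.
\<close>

definition pair_sum :: "'a::comm_ring_1 \<Rightarrow> (nat \<Rightarrow> nat) \<Rightarrow> nat \<Rightarrow> (nat \<Rightarrow> nat) \<Rightarrow> (nat \<Rightarrow> nat) \<Rightarrow>
    (nat \<Rightarrow> nat) \<Rightarrow> (nat \<Rightarrow> nat) \<Rightarrow> 'a" where
  "pair_sum b \<tau> n \<nu> lam \<mu> \<kappa> =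
    (\<Sum>T'\<in>mono_fillings before (diagram \<nu> lam) n.
     \<Sum>T''\<in>mono_fillings (\<lambda>c d. before d c) (diagram \<mu> \<kappa>) n.
     \<Prod>i<n. step_weight b (\<tau> i) (entry_cells (diagram \<nu> lam) T' i) (entry_cells (diagram \<mu> \<kappa>) T'' i))"

lemma pair_sum_0:
  assumes "lam \<le> \<nu>" "\<kappa> \<le> \<mu>"
  shows "pair_sum b \<tau> 0 \<nu> lam \<mu> \<kappa> = (if \<nu> = lam \<and> \<mu> = \<kappa> then 1 else 0)"
  using assms by (auto simp: pair_sum_def mono_fillings_0 diagram_empty_iff)

text \<open>
  The shapes \<open>\<nu>'\<close> and \<open>\<kappa>'\<close> are what remains to be filled after the removal of the largest entry
  from both tableaux.
\<close>

lemma pair_sum_Suc: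
  assumes \<nu>: "is_partition \<nu>" and lam: "is_partition lam" and \<mu>: "is_partition \<mu>" and \<kappa>: "is_partition \<kappa>"
    and le: "lam \<le> \<nu>" "\<kappa> \<le> \<mu>"
  shows "pair_sum b \<tau> (Suc n) \<nu> lam \<mu> \<kappa> =
    (\<Sum>\<nu>'\<in>parts_between lam \<nu>. \<Sum>\<kappa>'\<in>parts_between \<kappa> \<mu>.
       pair_sum b \<tau> n \<nu>' lam \<mu> \<kappa>' * step_weight b (\<tau> n) (diagram \<nu> \<nu>') (diagram \<kappa>' \<kappa>))"
proof -
  let ?M' = "\<lambda>\<nu>'. mono_fillings before (diagram \<nu>' lam) n"
  let ?M'' = "\<lambda>\<kappa>'. mono_fillings (\<lambda>c d. before d c) (diagram \<mu> \<kappa>') n"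
  let ?w = "\<lambda>i. step_weight b (\<tau> i)"
  have "pair_sum b \<tau> (Suc n) \<nu> lam \<mu> \<kappa> =
    (\<Sum>\<nu>'\<in>parts_between lam \<nu>. \<Sum>T'\<in>?M' \<nu>'. \<Sum>\<kappa>'\<in>parts_between \<kappa> \<mu>. \<Sum>T''\<in>?M'' \<kappa>'.
      \<Prod>i<Suc n. ?w i (entry_cells (diagram \<nu> lam) (extend (diagram \<nu> lam) (diagram \<nu>' lam) n T') i)
        (entry_cells (diagram \<mu> \<kappa>) (extend (diagram \<mu> \<kappa>) (diagram \<mu> \<kappa>') n T'') i))"
    unfolding pair_sum_def sum_increasing_Suc[OF \<nu> lam le(1)] sum_decreasing_Suc[OF \<mu> \<kappa> le(2)] ..
  also have "\<dots> = (\<Sum>\<nu>'\<in>parts_between lam \<nu>. \<Sum>T'\<in>?M' \<nu>'. \<Sum>\<kappa>'\<in>parts_between \<kappa> \<mu>. \<Sum>T''\<in>?M'' \<kappa>'.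
      (\<Prod>i<n. ?w i (entry_cells (diagram \<nu>' lam) T' i) (entry_cells (diagram \<mu> \<kappa>') T'' i)) *
      ?w n (diagram \<nu> \<nu>') (diagram \<kappa>' \<kappa>))"
  proof (intro sum.cong refl)
    fix \<nu>' T' \<kappa>' T''
    assume *: "\<nu>' \<in> parts_between lam \<nu>" "T' \<in> ?M' \<nu>'" "\<kappa>' \<in> parts_between \<kappa> \<mu>" "T'' \<in> ?M'' \<kappa>'"
    have les: "lam \<le> \<nu>'" "\<nu>' \<le> \<nu>" "\<kappa> \<le> \<kappa>'" "\<kappa>' \<le> \<mu>"
      using * by (auto simp: parts_between_def)
    have sub: "diagram \<nu>' lam \<subseteq> diagram \<nu> lam" "diagram \<mu> \<kappa>' \<subseteq> diagram \<mu> \<kappa>"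
      using les by (auto simp: diagram_def le_fun_def intro: less_le_trans order_trans)
    show "(\<Prod>i<Suc n. ?w i (entry_cells (diagram \<nu> lam) (extend (diagram \<nu> lam) (diagram \<nu>' lam) n T') i)
        (entry_cells (diagram \<mu> \<kappa>) (extend (diagram \<mu> \<kappa>) (diagram \<mu> \<kappa>') n T'') i)) =
      (\<Prod>i<n. ?w i (entry_cells (diagram \<nu>' lam) T' i) (entry_cells (diagram \<mu> \<kappa>') T'' i)) *
      ?w n (diagram \<nu> \<nu>') (diagram \<kappa>' \<kappa>)"
      using entry_cells_extend[OF sub(1) *(2)] entry_cells_extend[OF sub(2) *(4)]
      by (simp add: diagram_diff_outer[OF les(1,2)] diagram_diff_inner[OF les(3,4)])
  qed
  also have "\<dots> = (\<Sum>\<nu>'\<in>parts_between lam \<nu>. \<Sum>\<kappa>'\<in>parts_between \<kappa> \<mu>. \<Sum>T'\<in>?M' \<nu>'. \<Sum>T''\<in>?M'' \<kappa>'.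
      (\<Prod>i<n. ?w i (entry_cells (diagram \<nu>' lam) T' i) (entry_cells (diagram \<mu> \<kappa>') T'' i)) *
      ?w n (diagram \<nu> \<nu>') (diagram \<kappa>' \<kappa>))"
    by (rule sum.cong[OF refl], rule sum.swap)
  finally show ?thesis
    by (simp only: pair_sum_def sum_distrib_right)
qed

lemma card_eq_sum_entry_cells:
  assumes "finite D" "T \<in> mono_fillings R D n"
  shows "card D = (\<Sum>i<n. card (entry_cells D T i))"
proof -
  have "card D = (\<Sum>c\<in>D. 1)" by simp
  also have "\<dots> = (\<Sum>i<n. \<Sum>c\<in>{c \<in> D. T c = i}. 1)"
    by (rule sum.group[symmetric]) (use assms in \<open>auto simp: mono_fillings_def\<close>)
  finally show ?thesis by (simp add: entry_cells_def)
qed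

lemma pair_sum_size:
  assumes \<nu>: "is_partition \<nu>" and \<mu>: "is_partition \<mu>" and le: "lam \<le> \<nu>" "\<kappa> \<le> \<mu>"
    and nz: "pair_sum b \<tau> n \<nu> lam \<mu> \<kappa> \<noteq> 0"
  shows "(psize \<nu> - psize lam) + (psize \<mu> - psize \<kappa>) = (\<Sum>i<n. \<tau> i)"
proof -
  let ?C = "diagram \<nu> lam" and ?D = "diagram \<mu> \<kappa>"
  obtain T' T'' where T: "T' \<in> mono_fillings before ?C n" "T'' \<in> mono_fillings (\<lambda>c d. before d c) ?D n"
    and w: "(\<Prod>i<n. step_weight b (\<tau> i) (entry_cells ?C T' i) (entry_cells ?D T'' i)) \<noteq> 0"
    using nz unfolding pair_sum_def by (meson sum.not_neutral_contains_not_neutral)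
  have "card (entry_cells ?C T' i) + card (entry_cells ?D T'' i) = \<tau> i" if "i < n" for i
  proof -
    have "step_weight b (\<tau> i) (entry_cells ?C T' i) (entry_cells ?D T'' i) \<noteq> 0"
      using w that by (metis finite_lessThan lessThan_iff prod_zero)
    then show ?thesis by (auto simp: step_weight_def split: if_splits)
  qed
  then have "card ?C + card ?D = (\<Sum>i<n. \<tau> i)"
    by (simp add: card_eq_sum_entry_cells[OF finite_diagram[OF \<nu>] T(1)]
        card_eq_sum_entry_cells[OF finite_diagram[OF \<mu>] T(2)] flip: sum.distrib)
  then show ?thesis
    by (simp add: card_diagram[OF \<nu> le(1)] card_diagram[OF \<mu> le(2)])
qed

lemma shifts_0:
  assumes "is_partition lam" "is_partition \<mu>"
  shows "shifts lam \<mu> 0 = {(lam, \<mu>)}"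
  using assms psize_eq_imp_eq[of _ lam] psize_eq_imp_eq[of \<mu>] by (force simp: shifts_def)

lemma shifts_shifts_iff:
  assumes lam: "is_partition lam" and \<mu>: "is_partition \<mu>"
    and p: "(\<nu>', \<kappa>') \<in> shifts lam \<mu> s"
  shows "(\<nu>, \<kappa>) \<in> shifts \<nu>' \<kappa>' r \<longleftrightarrow> (\<nu>, \<kappa>) \<in> shifts lam \<mu> (s + r) \<and> \<nu>' \<le> \<nu> \<and> \<kappa> \<le> \<kappa>'"
proof -
  have p': "is_partition \<nu>'" "is_partition \<kappa>'" "lam \<le> \<nu>'" "\<kappa>' \<le> \<mu>"
    "psize \<nu>' - psize lam + (psize \<mu> - psize \<kappa>') = s" "psize lam \<le> psize \<nu>'" "psize \<kappa>' \<le> psize \<mu>"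
    using p \<mu> psize_mono by (auto simp: shifts_def)
  show ?thesis
  proof (cases "is_partition \<nu> \<and> is_partition \<kappa> \<and> \<nu>' \<le> \<nu> \<and> \<kappa> \<le> \<kappa>'")
    case True
    then have "psize \<nu>' \<le> psize \<nu>" "psize \<kappa> \<le> psize \<kappa>'" "lam \<le> \<nu>" "\<kappa> \<le> \<mu>"
      using p' psize_mono order_trans by auto
    then show ?thesis using True p' by (auto simp: shifts_def)
  qed (auto simp: shifts_def)
qed

text \<open>
  The steps of the iteration fit together because sizes add up and signs multiply.  The sums
  over intermediate shapes may be taken over all shapes in between, as those of the wrong size
  have weight \<open>0\<close>.
\<close>

theorem skew_schur_times_quantum_power_sums:
  assumes lam: "is_partition lam" and \<mu>: "is_partition \<mu>" and le: "\<mu> \<le> lam"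
    and pos: "\<And>i. i < n \<Longrightarrow> 0 < \<tau> i"
  shows "skew_schur lam \<mu> * (\<Prod>i<n. quantum_power_sum (\<tau> i)) =
    (\<Sum>(\<nu>, \<kappa>)\<in>shifts lam \<mu> (\<Sum>i<n. \<tau> i).
       scale ((- 1) ^ (psize \<mu> - psize \<kappa>) * pair_sum q \<tau> n \<nu> lam \<mu> \<kappa>) (skew_schur \<nu> \<kappa>))"
  using pos
proof (induction n)
  case 0
  show ?case
    by (simp add: shifts_0[OF lam \<mu>] pair_sum_0 scale_eq_mult const_series_simps)
next
  case (Suc n)
  let ?s = "\<Sum>i<n. \<tau> i" and ?r = "\<tau> n"
  let ?w = "\<lambda>\<nu> \<kappa> \<nu>' \<kappa>'. pair_sum q \<tau> n \<nu>' lam \<mu> \<kappa>' * step_weight q ?r (diagram \<nu> \<nu>') (diagram \<kappa>' \<kappa>)"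
  let ?t = "\<lambda>\<nu> \<kappa> \<nu>' \<kappa>'. scale ((- 1) ^ (psize \<mu> - psize \<kappa>) * ?w \<nu> \<kappa> \<nu>' \<kappa>') (skew_schur \<nu> \<kappa>)"
  have "skew_schur lam \<mu> * (\<Prod>i<Suc n. quantum_power_sum (\<tau> i)) =
    (\<Sum>(\<nu>', \<kappa>')\<in>shifts lam \<mu> ?s.
       scale ((- 1) ^ (psize \<mu> - psize \<kappa>') * pair_sum q \<tau> n \<nu>' lam \<mu> \<kappa>') (skew_schur \<nu>' \<kappa>')) *
     quantum_power_sum ?r"
    using Suc by (simp flip: mult.assoc)
  also have "\<dots> = (\<Sum>p'\<in>shifts lam \<mu> ?s. \<Sum>p\<in>shifts (fst p') (snd p') ?r.
      ?t (fst p) (snd p) (fst p') (snd p'))"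
    unfolding sum_distrib_right
  proof (rule sum.cong[OF refl])
    fix p' assume p': "p' \<in> shifts lam \<mu> ?s"
    obtain \<nu>' \<kappa>' where e: "p' = (\<nu>', \<kappa>')" by force
    have \<nu>': "is_partition \<nu>'" "is_partition \<kappa>'" "\<kappa>' \<le> \<nu>'" "\<kappa>' \<le> \<mu>"
      using p' le order_trans by (auto simp: e shifts_def)
    have "scale ((- 1) ^ (psize \<mu> - psize \<kappa>') * pair_sum q \<tau> n \<nu>' lam \<mu> \<kappa>') (skew_schur \<nu>' \<kappa>') *
        quantum_power_sum ?r =
      const_series ((- 1) ^ (psize \<mu> - psize \<kappa>') * pair_sum q \<tau> n \<nu>' lam \<mu> \<kappa>') *
        (\<Sum>(\<nu>, \<kappa>)\<in>shifts \<nu>' \<kappa>' ?r. scale ((- 1) ^ (psize \<kappa>' - psize \<kappa>) *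
          step_weight q ?r (diagram \<nu> \<nu>') (diagram \<kappa>' \<kappa>)) (skew_schur \<nu> \<kappa>))"
      unfolding scale_eq_mult[of "_ * pair_sum q \<tau> n \<nu>' lam \<mu> \<kappa>'"] mult.assoc[of "const_series _"]
      using skew_schur_times_quantum_power_sum[OF \<nu>'(1,2,3) Suc.prems[of n]] by simp
    also have "\<dots> = (\<Sum>p\<in>shifts \<nu>' \<kappa>' ?r. ?t (fst p) (snd p) \<nu>' \<kappa>')"
      unfolding sum_distrib_left split_def
    proof (rule sum.cong[OF refl])
      fix p assume "p \<in> shifts \<nu>' \<kappa>' ?r"
      then have \<kappa>: "snd p \<le> \<kappa>'" by (auto simp: shifts_def)
      have "psize \<mu> - psize (snd p) = (psize \<mu> - psize \<kappa>') + (psize \<kappa>' - psize (snd p))"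
        using psize_mono[OF \<nu>'(2) \<kappa>] psize_mono[OF \<mu> \<nu>'(4)] by simp
      then have sgn: "(- 1 :: int poly) ^ (psize \<mu> - psize (snd p)) =
        (- 1) ^ (psize \<mu> - psize \<kappa>') * (- 1) ^ (psize \<kappa>' - psize (snd p))"
        by (simp add: power_add)
      show "const_series ((- 1) ^ (psize \<mu> - psize \<kappa>') * pair_sum q \<tau> n \<nu>' lam \<mu> \<kappa>') *
        scale ((- 1) ^ (psize \<kappa>' - psize (snd p)) *
          step_weight q ?r (diagram (fst p) \<nu>') (diagram \<kappa>' (snd p))) (skew_schur (fst p) (snd p)) =
        ?t (fst p) (snd p) \<nu>' \<kappa>'"
        unfolding scale_eq_mult sgn const_series_simps by (simp only: mult_ac)
    qed
    finally show "(case p' of (\<nu>', \<kappa>') \<Rightarrow>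
        scale ((- 1) ^ (psize \<mu> - psize \<kappa>') * pair_sum q \<tau> n \<nu>' lam \<mu> \<kappa>') (skew_schur \<nu>' \<kappa>')) *
        quantum_power_sum ?r = (\<Sum>p\<in>shifts (fst p') (snd p') ?r. ?t (fst p) (snd p) (fst p') (snd p'))"
      by (simp add: e)
  qed
  also have "\<dots> = (\<Sum>(p', p)\<in>(SIGMA p':shifts lam \<mu> ?s. shifts (fst p') (snd p') ?r).
      ?t (fst p) (snd p) (fst p') (snd p'))"
    by (rule sum.Sigma) (auto simp: finite_shifts[OF \<mu>] intro!: finite_shifts, auto simp: shifts_def)
  also have "\<dots> = (\<Sum>(p, p')\<in>(SIGMA p:shifts lam \<mu> (?s + ?r).
      {p' \<in> shifts lam \<mu> ?s. fst p' \<le> fst p \<and> snd p \<le> snd p'}). ?t (fst p) (snd p) (fst p') (snd p'))"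
    by (rule sum.reindex_bij_witness[where i = prod.swap and j = prod.swap])
      (auto simp: shifts_shifts_iff[OF lam \<mu>])
  also have "\<dots> = (\<Sum>p\<in>shifts lam \<mu> (?s + ?r).
      \<Sum>p'\<in>{p' \<in> shifts lam \<mu> ?s. fst p' \<le> fst p \<and> snd p \<le> snd p'}. ?t (fst p) (snd p) (fst p') (snd p'))"
    by (rule sum.Sigma[symmetric]) (auto simp: finite_shifts[OF \<mu>])
  also have "\<dots> = (\<Sum>(\<nu>, \<kappa>)\<in>shifts lam \<mu> (?s + ?r).
      scale ((- 1) ^ (psize \<mu> - psize \<kappa>) * pair_sum q \<tau> (Suc n) \<nu> lam \<mu> \<kappa>) (skew_schur \<nu> \<kappa>))"
  proof (rule sum.cong[OF refl])
    fix p assume p: "p \<in> shifts lam \<mu> (?s + ?r)"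
    obtain \<nu> \<kappa> where e: "p = (\<nu>, \<kappa>)" by force
    have \<nu>: "is_partition \<nu>" "is_partition \<kappa>" "lam \<le> \<nu>" "\<kappa> \<le> \<mu>"
      using p by (auto simp: e shifts_def)
    let ?P = "{p' \<in> shifts lam \<mu> ?s. fst p' \<le> \<nu> \<and> \<kappa> \<le> snd p'}"
    have "(\<Sum>p'\<in>?P. ?w \<nu> \<kappa> (fst p') (snd p')) =
      (\<Sum>p'\<in>parts_between lam \<nu> \<times> parts_between \<kappa> \<mu>. ?w \<nu> \<kappa> (fst p') (snd p'))"
    proof (rule sum.mono_neutral_left)
      show "finite (parts_between lam \<nu> \<times> parts_between \<kappa> \<mu>)"
        by (simp add: finite_parts_between \<nu> \<mu>)
      show "?P \<subseteq> parts_between lam \<nu> \<times> parts_between \<kappa> \<mu>"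
        by (auto simp: shifts_def parts_between_def)
      show "\<forall>p'\<in>parts_between lam \<nu> \<times> parts_between \<kappa> \<mu> - ?P. ?w \<nu> \<kappa> (fst p') (snd p') = 0"
      proof
        fix p' assume p': "p' \<in> parts_between lam \<nu> \<times> parts_between \<kappa> \<mu> - ?P"
        have "pair_sum q \<tau> n (fst p') lam \<mu> (snd p') = 0"
        proof (rule ccontr)
          assume nz: "pair_sum q \<tau> n (fst p') lam \<mu> (snd p') \<noteq> 0"
          have "p' \<in> ?P"
            using p' pair_sum_size[OF _ \<mu> _ _ nz] by (auto simp: parts_between_def shifts_def)
          then show False using p' by simp
        qed
        then show "?w \<nu> \<kappa> (fst p') (snd p') = 0" by simp
      qed
    qed
    also have "\<dots> = pair_sum q \<tau> (Suc n) \<nu> lam \<mu> \<kappa>"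
      unfolding pair_sum_Suc[OF \<nu>(1) lam \<mu> \<nu>(2,3,4)] sum.cartesian_product
      by (simp only: split_def)
    finally have w: "(\<Sum>p'\<in>?P. ?w \<nu> \<kappa> (fst p') (snd p')) = pair_sum q \<tau> (Suc n) \<nu> lam \<mu> \<kappa>" .
    have "(\<Sum>p'\<in>?P. ?t \<nu> \<kappa> (fst p') (snd p')) =
      scale ((- 1) ^ (psize \<mu> - psize \<kappa>) * (\<Sum>p'\<in>?P. ?w \<nu> \<kappa> (fst p') (snd p'))) (skew_schur \<nu> \<kappa>)"
      by (rule series_eqI) (simp only: mcoeff_sum mcoeff_scale sum_distrib_left sum_distrib_right)
    then show "(\<Sum>p'\<in>{p' \<in> shifts lam \<mu> ?s. fst p' \<le> fst p \<and> snd p \<le> snd p'}.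
        ?t (fst p) (snd p) (fst p') (snd p')) =
      (case p of (\<nu>, \<kappa>) \<Rightarrow>
        scale ((- 1) ^ (psize \<mu> - psize \<kappa>) * pair_sum q \<tau> (Suc n) \<nu> lam \<mu> \<kappa>) (skew_schur \<nu> \<kappa>))"
      unfolding w e fst_conv snd_conv prod.case .
  qed
  finally show ?case by (simp only: sum.lessThan_Suc)
qed

section \<open>Pairs of tableaux\<close>

lemma mono_fillings_before_iff:
  "T \<in> mono_fillings before D n \<longleftrightarrow>
   T \<in> D \<rightarrow>\<^sub>E UNIV \<and> (\<forall>c\<in>D. T c < n) \<and> rows_weakly_incr D T \<and> cols_weakly_incr D T"
  by (auto simp: mono_fillings_def before_def rows_weakly_incr_def cols_weakly_incr_def PiE_iff)

lemma mono_fillings_after_iff: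
  "T \<in> mono_fillings (\<lambda>c d. before d c) D n \<longleftrightarrow>
   T \<in> D \<rightarrow>\<^sub>E UNIV \<and> (\<forall>c\<in>D. T c < n) \<and> rows_weakly_decr D T \<and> cols_weakly_decr D T"
  by (auto simp: mono_fillings_def before_def rows_weakly_decr_def cols_weakly_decr_def PiE_iff)

lemma entries_below:
  assumes "finite D" "\<And>i. n \<le> i \<Longrightarrow> card (entry_cells D T i) = 0" "c \<in> D"
  shows "T c < n"
proof (rule ccontr)
  assume "\<not> T c < n"
  then have "card (entry_cells D T (T c)) = 0" by (intro assms(2)) simp
  moreover have "finite (entry_cells D T (T c))" using assms(1) by (simp add: entry_cells_def)
  moreover have "c \<in> entry_cells D T (T c)" using assms(3) by (simp add: entry_cells_def)
  ultimately show False by (metis card_0_eq empty_iff)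
qed

lemma components_empty: "components {} = {}"
  by (simp add: components_def quotient_def)

lemma entry_sum:
  assumes "finite D" "\<forall>c\<in>D. T c < n" "f {} = 0"
  shows "(\<Sum>i\<in>T ` D. f (entry_cells D T i)) = (\<Sum>i<n. f (entry_cells D T i) :: nat)"
proof (rule sum.mono_neutral_left)
  show "\<forall>i\<in>{..<n} - T ` D. f (entry_cells D T i) = 0"
  proof
    fix i assume "i \<in> {..<n} - T ` D"
    then have "entry_cells D T i = {}" by (auto simp: entry_cells_def)
    then show "f (entry_cells D T i) = 0" using assms(3) by simp
  qed
qed (use assms in auto)

lemma tab_statistics:
  assumes "finite D" "\<forall>c\<in>D. T c < n"
  shows "tab_ht D T = (\<Sum>i<n. ht (entry_cells D T i))"
    and "tab_wt D T = (\<Sum>i<n. wt (entry_cells D T i))"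
    and "tab_rib D T = (\<Sum>i<n. rib (entry_cells D T i))"
  unfolding tab_ht_def tab_wt_def tab_rib_def
  by (rule entry_sum[OF assms], simp add: ht_def wt_def rib_def components_empty)+

lemma broken_ribbon_empty: "broken_ribbon {}"
proof -
  have "is_partition (\<lambda>_. 0)" by (rule is_partitionI[of _ 0]) auto
  moreover have "{} = diagram (\<lambda>_. 0) (\<lambda>_. 0)" by (simp add: diagram_def)
  ultimately show ?thesis unfolding broken_ribbon_def has_block_def by blast
qed

text \<open>
  As all parts \<open>\<tau> i\<close> with \<open>i < num_parts \<tau>\<close> are positive, each of these entries occupies at
  least one ribbon, so the exponent of \<open>1 - q\<close> is the sum of the exponents for the single
  entries.
\<close>

lemma chi_eq_pair_sum:
  assumes \<nu>: "is_partition \<nu>" and \<mu>: "is_partition \<mu>" and \<tau>: "is_partition \<tau>"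
  shows "chi \<nu> lam \<mu> \<kappa> \<tau> = pair_sum q \<tau> (num_parts \<tau>) \<nu> lam \<mu> \<kappa>"
proof -
  let ?n = "num_parts \<tau>" and ?C = "diagram \<nu> lam" and ?D = "diagram \<mu> \<kappa>"
  let ?M' = "mono_fillings before ?C ?n" and ?M'' = "mono_fillings (\<lambda>c d. before d c) ?D ?n"
  let ?P = "{(T', T''). \<exists>\<tau>' \<tau>''. T' \<in> broken_ribbon_tableaux \<nu> lam \<tau>' \<and>
     T'' \<in> reverse_broken_ribbon_tableaux \<mu> \<kappa> \<tau>'' \<and> (\<forall>n. \<tau>' n + \<tau>'' n = \<tau> n)}"
  let ?ok = "\<lambda>T' T'' i. broken_ribbon (entry_cells ?C T' i) \<and> broken_ribbon (entry_cells ?D T'' i) \<and>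
     card (entry_cells ?C T' i) + card (entry_cells ?D T'' i) = \<tau> i"
  have fin: "finite ?C" "finite ?D" using \<nu> \<mu> by (simp_all add: finite_diagram)
  have \<tau>0: "\<tau> i = 0" if "?n \<le> i" for i using num_parts_iff[OF \<tau>, of i] that by simp
  have P: "(T', T'') \<in> ?P \<longleftrightarrow> T' \<in> ?M' \<and> T'' \<in> ?M'' \<and> (\<forall>i<?n. ?ok T' T'' i)" for T' T''
  proof
    assume "(T', T'') \<in> ?P"
    then have T: "T' \<in> ?C \<rightarrow>\<^sub>E UNIV" "rows_weakly_incr ?C T'" "cols_weakly_incr ?C T'"
        "T'' \<in> ?D \<rightarrow>\<^sub>E UNIV" "rows_weakly_decr ?D T''" "cols_weakly_decr ?D T''"
      and ok: "\<And>i. ?ok T' T'' i"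
      by (auto simp: broken_ribbon_tableaux_def reverse_broken_ribbon_tableaux_def)
    have zero: "card (entry_cells ?C T' i) = 0" "card (entry_cells ?D T'' i) = 0" if "?n \<le> i" for i
      using ok[of i] \<tau>0[OF that] by simp_all
    show "T' \<in> ?M' \<and> T'' \<in> ?M'' \<and> (\<forall>i<?n. ?ok T' T'' i)"
      using T ok entries_below[OF fin(1) zero(1)] entries_below[OF fin(2) zero(2)]
      by (simp add: mono_fillings_before_iff mono_fillings_after_iff)
  next
    assume R: "T' \<in> ?M' \<and> T'' \<in> ?M'' \<and> (\<forall>i<?n. ?ok T' T'' i)"
    have ok: "?ok T' T'' i" for i
    proof (cases "i < ?n")
      case False
      then have e: "entry_cells ?C T' i = {}" "entry_cells ?D T'' i = {}"
        using R by (auto simp: entry_cells_def mono_fillings_before_iff mono_fillings_after_iff)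
      have "\<tau> i = 0" using False by (intro \<tau>0) simp
      then show ?thesis unfolding e by (simp add: broken_ribbon_empty)
    qed (use R in blast)
    have "T' \<in> broken_ribbon_tableaux \<nu> lam (\<lambda>i. card (entry_cells ?C T' i))"
      using R ok by (simp add: broken_ribbon_tableaux_def mono_fillings_before_iff)
    moreover have "T'' \<in> reverse_broken_ribbon_tableaux \<mu> \<kappa> (\<lambda>i. card (entry_cells ?D T'' i))"
      using R ok by (simp add: reverse_broken_ribbon_tableaux_def mono_fillings_after_iff)
    ultimately show "(T', T'') \<in> ?P"
      using ok by blast
  qed
  let ?w = "\<lambda>T' T''. \<Prod>i<?n. step_weight q (\<tau> i) (entry_cells ?C T' i) (entry_cells ?D T'' i)"
  have weight: "(- q) ^ (tab_ht ?C T' + tab_wt ?D T'') * (1 - q) ^ (tab_rib ?C T' + tab_rib ?D T'' - ?n) =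
      ?w T' T''"
    if p: "(T', T'') \<in> ?P" for T' T''
  proof -
    let ?c = "entry_cells ?C T'" and ?d = "entry_cells ?D T''"
    have T: "\<forall>c\<in>?C. T' c < ?n" "\<forall>c\<in>?D. T'' c < ?n" and ok: "\<And>i. i < ?n \<Longrightarrow> ?ok T' T'' i"
      using p unfolding P by (auto simp: mono_fillings_before_iff mono_fillings_after_iff)
    have pos: "1 \<le> rib (?c i) + rib (?d i)" if "i < ?n" for i
    proof -
      have "card (?c i) + card (?d i) \<noteq> 0"
        using ok[OF that] num_parts_iff[OF \<tau>, of i] that by simp
      then have "?c i \<noteq> {} \<or> ?d i \<noteq> {}" by auto
      moreover have "finite (?c i)" "finite (?d i)" using fin by (simp_all add: entry_cells_def)
      ultimately show ?thesis using rib_pos[of "?c i"] rib_pos[of "?d i"] by (elim disjE) simp_all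
    qed
    have "?w T' T'' = (\<Prod>i<?n. (- q) ^ (ht (?c i) + wt (?d i)) * (1 - q) ^ (rib (?c i) + rib (?d i) - 1))"
      by (intro prod.cong refl) (simp add: step_weight_def ok)
    also have "\<dots> = (- q) ^ (\<Sum>i<?n. ht (?c i) + wt (?d i)) * (1 - q) ^ (\<Sum>i<?n. rib (?c i) + rib (?d i) - 1)"
      by (simp only: prod.distrib power_sum)
    also have "(\<Sum>i<?n. rib (?c i) + rib (?d i) - 1) = (\<Sum>i<?n. rib (?c i) + rib (?d i)) - ?n"
      by (subst sum_subtractf_nat) (use pos in auto)
    finally show ?thesis
      by (simp only: tab_statistics[OF fin(1) T(1)] tab_statistics[OF fin(2) T(2)] sum.distrib)
  qed
  have "chi \<nu> lam \<mu> \<kappa> \<tau> = (\<Sum>(T', T'')\<in>?P. ?w T' T'')"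
    unfolding chi_def by (intro sum.cong refl) (auto simp only: split_paired_all prod.case weight)
  also have "\<dots> = (\<Sum>(T', T'')\<in>?M' \<times> ?M''. ?w T' T'')"
  proof (rule sum.mono_neutral_left)
    show "finite (?M' \<times> ?M'')" by (simp add: finite_mono_fillings fin)
    show "?P \<subseteq> ?M' \<times> ?M''" using P by blast
    show "\<forall>p\<in>?M' \<times> ?M'' - ?P. (case p of (T', T'') \<Rightarrow> ?w T' T'') = 0"
    proof
      fix p assume p: "p \<in> ?M' \<times> ?M'' - ?P"
      obtain T' T'' where e: "p = (T', T'')" by force
      have "T' \<in> ?M'" "T'' \<in> ?M''" "(T', T'') \<notin> ?P" using p unfolding e by auto
      then obtain i where "i < ?n" "\<not> ?ok T' T'' i" unfolding P by blast
      then have "?w T' T'' = 0"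
        by (intro prod_zero) (auto simp: step_weight_def intro!: bexI[of _ i])
      then show "(case p of (T', T'') \<Rightarrow> ?w T' T'') = 0" by (simp only: e prod.case)
    qed
  qed
  also have "\<dots> = pair_sum q \<tau> ?n \<nu> lam \<mu> \<kappa>"
    unfolding pair_sum_def by (rule sum.cartesian_product[symmetric])
  finally show ?thesis .
qed

theorem corollary6:
  fixes lam \<mu> \<tau> :: "nat \<Rightarrow> nat"
  assumes "is_partition lam" and "is_partition \<mu>" and "\<mu> \<le> lam" and "is_partition \<tau>"
  defines "I \<equiv> {(lam_plus, \<mu>_minus). is_partition lam_plus \<and> is_partition \<mu>_minus \<and> lam \<le> lam_plus \<and> \<mu>_minus \<le> \<mu> \<and>
                  chi lam_plus lam \<mu> \<mu>_minus \<tau> \<noteq> 0}"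
  shows "finite I \<and>
    skew_schur lam \<mu> * quantum_power_sum_part \<tau> =
      (\<Sum>(lam_plus, \<mu>_minus)\<in>I.
        scale ((- 1) ^ (psize \<mu> - psize \<mu>_minus) * chi lam_plus lam \<mu> \<mu>_minus \<tau>) (skew_schur lam_plus \<mu>_minus))"
proof -
  let ?n = "num_parts \<tau>"
  let ?S = "shifts lam \<mu> (\<Sum>i<?n. \<tau> i)"
  have chi: "chi \<nu> lam \<mu> \<kappa> \<tau> = pair_sum q \<tau> ?n \<nu> lam \<mu> \<kappa>" if "is_partition \<nu>" for \<nu> \<kappa>
    by (rule chi_eq_pair_sum[OF that assms(2,4)])
  have fin: "finite ?S" by (rule finite_shifts[OF assms(2)])
  have sub: "I \<subseteq> ?S"
  proof
    fix p assume "p \<in> I"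
    then obtain \<nu> \<kappa> where p: "p = (\<nu>, \<kappa>)" "is_partition \<nu>" "is_partition \<kappa>" "lam \<le> \<nu>" "\<kappa> \<le> \<mu>"
      and nz: "pair_sum q \<tau> ?n \<nu> lam \<mu> \<kappa> \<noteq> 0"
      by (auto simp: I_def chi)
    show "p \<in> ?S"
      using p pair_sum_size[OF p(2) assms(2) p(4,5) nz] by (simp add: shifts_def)
  qed
  have "skew_schur lam \<mu> * quantum_power_sum_part \<tau> =
    (\<Sum>(\<nu>, \<kappa>)\<in>?S. scale ((- 1) ^ (psize \<mu> - psize \<kappa>) * pair_sum q \<tau> ?n \<nu> lam \<mu> \<kappa>) (skew_schur \<nu> \<kappa>))"
    unfolding quantum_power_sum_part_def
    by (rule skew_schur_times_quantum_power_sums[OF assms(1-3)]) (simp add: num_parts_iff[OF assms(4)])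
  also have "\<dots> = (\<Sum>(\<nu>, \<kappa>)\<in>I. scale ((- 1) ^ (psize \<mu> - psize \<kappa>) * chi \<nu> lam \<mu> \<kappa> \<tau>) (skew_schur \<nu> \<kappa>))"
  proof (rule sum.mono_neutral_cong_right[OF fin sub])
    show "\<forall>p\<in>?S - I. (case p of (\<nu>, \<kappa>) \<Rightarrow>
        scale ((- 1) ^ (psize \<mu> - psize \<kappa>) * pair_sum q \<tau> ?n \<nu> lam \<mu> \<kappa>) (skew_schur \<nu> \<kappa>)) = 0"
      by (auto simp: I_def shifts_def chi scale_eq_mult const_series_simps)
  qed (auto simp: I_def chi)
  finally show ?thesis
    using finite_subset[OF sub fin] by blast
qed

end
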